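(* Let $(X,Y)$ and $(V,W)$ be two interpolation pairs of Banach lattices such that $\text{P-Int}_1(X,Y) = \text{P-Int}_1(V,W)$. Then $(X,Y) \cong (V,W)$; that is, either $X \cong V$ and $Y \cong W$, or $X \cong W$ and $Y \cong V$.
   Context: For a Banach lattice $E$, $\|\cdot\|_E$ denotes its norm and $E^+$ its cone of positive elements. A linear operator $T: E \to E$ is called positive if $T(E^+) \subset E^+$; $L^+(E)$ denotes the set of all positive linear operators in $E$ (such operators are automatically bounded), and $\|T\|_{E \to E}$ denotes the operator norm of a bounded linear operator in $E$. For Banach lattices $E$ and $F$, the notation $E \hookrightarrow F$ means that $E$ is an (order) ideal in $F$ and there is a constant $c>0$ such that $\|x\|_F \le c\|x\|_E$ for all $x \in E$. Two Banach lattices $X$ and $Y$ form an interpolation pair $(X,Y)$ of Banach lattices if both are ideals in a certain vector lattice $U$ which is a Hausdorff topological vector space such that the embeddings of $X$ and of $Y$ into $U$ are continuous. To such a pair are canonically associated the Banach lattices $X \cap Y$, with norm $\max\{\|x\|_X, \|x\|_Y\}$, and $X+Y$, with norm $\|z\|_{X+Y} = \inf\{\|x\|_X + \|y\|_Y : z = x+y,\ x \in X,\ y \in Y\}$. $L^+((X,Y))$ denotes the set of all linear operators $T$ in $X+Y$ with $T|_X \in L^+(X)$ and $T|_Y \in L^+(Y)$ (in particular $T(X)\subset X$ and $T(Y)\subset Y$). A Banach lattice $Z$ is called intermediate for $(X,Y)$ if $X \cap Y \hookrightarrow Z \hookrightarrow X+Y$. $\text{P-Int}_1(X,Y)$ is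 the collection of all intermediate Banach lattices $Z$ for $(X,Y)$ such that for every $T \in L^+((X,Y))$ one has $T(Z) \subset Z$ and $\|T\|_{Z \to Z} \le \max\{\|T\|_{X \to X}, \|T\|_{Y \to Y}\}$. For Banach lattices $E$ and $F$, $E \cong F$ means that $E$ and $F$ coincide as vector lattices and their norms are proportional (there is a constant $k>0$ with $\|x\|_E = k\|x\|_F$ for all $x$). *)

theory Defs
  imports "HOL-Analysis.Analysis" "HOL-Algebra.Group"
begin

text \<open>
  Real vector lattices are explicit structures on a carrier set, ordered in the style of
  HOL-Algebra. The two pairs of the theorem thus need not share an ambient lattice: the
  carriers only have to lie in one common type, with possibly unrelated operations.
  No axiom or notion below depends on the values of the operations outside the carriers.
\<close>

record 'a vector_lattice = "'a gorder" +
  vadd :: "'a \<Rightarrow> 'a \<Rightarrow> 'a"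
  vzero :: 'a
  vscale :: "real \<Rightarrow> 'a \<Rightarrow> 'a"

locale vector_lattice = Lattice.lattice L for L :: "('a, 'b) vector_lattice_scheme" (structure) +
  assumes add_group: "comm_group \<lparr>carrier = carrier L, mult = vadd L, one = vzero L\<rparr>"
    and scale_closed: "x \<in> carrier L \<Longrightarrow> vscale L r x \<in> carrier L"
    and scale_one: "x \<in> carrier L \<Longrightarrow> vscale L 1 x = x"
    and scale_scale: "x \<in> carrier L \<Longrightarrow> vscale L r (vscale L s x) = vscale L (r * s) x"
    and scale_add_left: "x \<in> carrier L \<Longrightarrow> vscale L (r + s) x = vadd L (vscale L r x) (vscale L s x)"
    and scale_add_right: "\<lbrakk>x \<in> carrier L; y \<in> carrier L\<rbrakk> \<Longrightarrow>
      vscale L r (vadd L x y) = vadd L (vscale L r x) (vscale L r y)"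
    and add_mono: "\<lbrakk>x \<in> carrier L; y \<in> carrier L; z \<in> carrier L; x \<sqsubseteq> y\<rbrakk> \<Longrightarrow> vadd L x z \<sqsubseteq> vadd L y z"
    and scale_mono: "\<lbrakk>x \<in> carrier L; y \<in> carrier L; x \<sqsubseteq> y; 0 \<le> r\<rbrakk> \<Longrightarrow> vscale L r x \<sqsubseteq> vscale L r y"

definition vdiff :: "('a, 'b) vector_lattice_scheme \<Rightarrow> 'a \<Rightarrow> 'a \<Rightarrow> 'a" where
  "vdiff L x y = vadd L x (vscale L (-1) y)"

definition vabs :: "('a, 'b) vector_lattice_scheme \<Rightarrow> 'a \<Rightarrow> 'a" where
  "vabs L x = x \<squnion>\<^bsub>L\<^esub> vscale L (-1) x"

definition pos_cone :: "('a, 'b) vector_lattice_scheme \<Rightarrow> 'a set" where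
  "pos_cone L = {x \<in> carrier L. vzero L \<sqsubseteq>\<^bsub>L\<^esub> x}"

record 'a normed_lattice = "'a vector_lattice" +
  vnorm :: "'a \<Rightarrow> real"

text \<open>
  The locale \<^locale>\<open>Metric_space\<close> asks for nonnegativity and symmetry on the whole type,
  hence the value 0 outside the carrier.
\<close>

definition vdist :: "('a, 'b) normed_lattice_scheme \<Rightarrow> 'a \<Rightarrow> 'a \<Rightarrow> real" where
  "vdist E x y = (if x \<in> carrier E \<and> y \<in> carrier E then vnorm E (vdiff E x y) else 0)"

abbreviation norm_topology :: "('a, 'b) normed_lattice_scheme \<Rightarrow> 'a topology" where
  "norm_topology E \<equiv> Metric_space.mtopology (carrier E) (vdist E)"

locale banach_lattice = vector_lattice E for E :: "('a, 'b) normed_lattice_scheme" (structure) +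
  assumes norm_nonneg: "x \<in> carrier E \<Longrightarrow> 0 \<le> vnorm E x"
    and norm_eq_zero: "x \<in> carrier E \<Longrightarrow> vnorm E x = 0 \<longleftrightarrow> x = vzero E"
    and norm_scale: "x \<in> carrier E \<Longrightarrow> vnorm E (vscale E r x) = \<bar>r\<bar> * vnorm E x"
    and norm_triangle: "\<lbrakk>x \<in> carrier E; y \<in> carrier E\<rbrakk> \<Longrightarrow> vnorm E (vadd E x y) \<le> vnorm E x + vnorm E y"
    and norm_lattice: "\<lbrakk>x \<in> carrier E; y \<in> carrier E; vabs E x \<sqsubseteq> vabs E y\<rbrakk> \<Longrightarrow> vnorm E x \<le> vnorm E y"
    and complete: "Metric_space.mcomplete (carrier E) (vdist E)"

definition linear_operator :: "('a, 'b) vector_lattice_scheme \<Rightarrow> ('a \<Rightarrow> 'a) \<Rightarrow> bool" where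
  "linear_operator E T \<longleftrightarrow> T \<in> carrier E \<rightarrow> carrier E \<and>
     (\<forall>x\<in>carrier E. \<forall>y\<in>carrier E. T (vadd E x y) = vadd E (T x) (T y)) \<and>
     (\<forall>x\<in>carrier E. \<forall>r. T (vscale E r x) = vscale E r (T x))"

text \<open>
  An operator is represented by any function that extends it to the whole type, so the
  restriction of an operator to a smaller carrier is the same function.
\<close>

definition L_plus :: "('a, 'b) vector_lattice_scheme \<Rightarrow> ('a \<Rightarrow> 'a) set" where
  "L_plus E = {T. linear_operator E T \<and> T ` pos_cone E \<subseteq> pos_cone E}"

text \<open>
  Meaningful for bounded operators only; it is applied below to operators that are positive
  on a Banach lattice and hence bounded.
\<close>

definition op_norm :: "('a, 'b) normed_lattice_scheme \<Rightarrow> ('a \<Rightarrow> 'a) \<Rightarrow> real" where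
  "op_norm E T = Sup {vnorm E (T x) | x. x \<in> carrier E \<and> vnorm E x \<le> 1}"

text \<open>Linear subspace and sublattice of \<open>F\<close> in the operations and order of \<open>F\<close>, and solid.\<close>

definition order_ideal :: "('a, 'b) vector_lattice_scheme \<Rightarrow> ('a, 'c) vector_lattice_scheme \<Rightarrow> bool" where
  "order_ideal E F \<longleftrightarrow> vector_lattice E \<and> vector_lattice F \<and> carrier E \<subseteq> carrier F \<and>
     (\<forall>x\<in>carrier E. \<forall>y\<in>carrier E. vadd E x y = vadd F x y) \<and>
     (\<forall>x\<in>carrier E. \<forall>r. vscale E r x = vscale F r x) \<and>
     (\<forall>x\<in>carrier E. \<forall>y\<in>carrier E. x \<sqsubseteq>\<^bsub>E\<^esub> y \<longleftrightarrow> x \<sqsubseteq>\<^bsub>F\<^esub> y) \<and>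
     (\<forall>x\<in>carrier E. \<forall>y\<in>carrier F. vabs F y \<sqsubseteq>\<^bsub>F\<^esub> vabs F x \<longrightarrow> y \<in> carrier E)"

definition embeds :: "('a, 'b) normed_lattice_scheme \<Rightarrow> ('a, 'c) normed_lattice_scheme \<Rightarrow> bool" where
  "embeds E F \<longleftrightarrow> order_ideal E F \<and> (\<exists>c>0. \<forall>x\<in>carrier E. vnorm F x \<le> c * vnorm E x)"

definition hausdorff_tvs :: "('a, 'b) vector_lattice_scheme \<Rightarrow> 'a topology \<Rightarrow> bool" where
  "hausdorff_tvs U \<tau> \<longleftrightarrow> topspace \<tau> = carrier U \<and> Hausdorff_space \<tau> \<and>
     continuous_map (prod_topology \<tau> \<tau>) \<tau> (\<lambda>(x, y). vadd U x y) \<and>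
     continuous_map (prod_topology euclideanreal \<tau>) \<tau> (\<lambda>(r, x). vscale U r x)"

definition interpolation_pair ::
    "'a vector_lattice \<Rightarrow> 'a topology \<Rightarrow> 'a normed_lattice \<Rightarrow> 'a normed_lattice \<Rightarrow> bool" where
  "interpolation_pair U \<tau> X Y \<longleftrightarrow>
     vector_lattice U \<and> hausdorff_tvs U \<tau> \<and> banach_lattice X \<and> banach_lattice Y \<and>
     order_ideal X U \<and> order_ideal Y U \<and>
     continuous_map (norm_topology X) \<tau> (\<lambda>x. x) \<and> continuous_map (norm_topology Y) \<tau> (\<lambda>x. x)"

definition restrict_lattice :: "'a vector_lattice \<Rightarrow> 'a set \<Rightarrow> ('a \<Rightarrow> real) \<Rightarrow> 'a normed_lattice" where
  "restrict_lattice U A n =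
     \<lparr>carrier = A, eq = eq U, le = le U, vadd = vadd U, vzero = vzero U, vscale = vscale U, vnorm = n\<rparr>"

definition pair_inter :: "'a vector_lattice \<Rightarrow> 'a normed_lattice \<Rightarrow> 'a normed_lattice \<Rightarrow> 'a normed_lattice" where
  "pair_inter U X Y =
     restrict_lattice U (carrier X \<inter> carrier Y) (\<lambda>x. max (vnorm X x) (vnorm Y x))"

definition pair_sum :: "'a vector_lattice \<Rightarrow> 'a normed_lattice \<Rightarrow> 'a normed_lattice \<Rightarrow> 'a normed_lattice" where
  "pair_sum U X Y =
     restrict_lattice U {vadd U x y | x y. x \<in> carrier X \<and> y \<in> carrier Y}
       (\<lambda>z. Inf {vnorm X x + vnorm Y y | x y. x \<in> carrier X \<and> y \<in> carrier Y \<and> z = vadd U x y})"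

definition L_plus_pair ::
    "'a vector_lattice \<Rightarrow> 'a normed_lattice \<Rightarrow> 'a normed_lattice \<Rightarrow> ('a \<Rightarrow> 'a) set" where
  "L_plus_pair U X Y = {T. linear_operator (pair_sum U X Y) T \<and> T \<in> L_plus X \<and> T \<in> L_plus Y}"

definition intermediate ::
    "'a vector_lattice \<Rightarrow> 'a normed_lattice \<Rightarrow> 'a normed_lattice \<Rightarrow> 'a normed_lattice \<Rightarrow> bool" where
  "intermediate U X Y Z \<longleftrightarrow>
     banach_lattice Z \<and> embeds (pair_inter U X Y) Z \<and> embeds Z (pair_sum U X Y)"

definition P_Int1 ::
    "'a vector_lattice \<Rightarrow> 'a normed_lattice \<Rightarrow> 'a normed_lattice \<Rightarrow> 'a normed_lattice set" where
  "P_Int1 U X Y = {Z. intermediate U X Y Z \<and>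
     (\<forall>T\<in>L_plus_pair U X Y.
        T ` carrier Z \<subseteq> carrier Z \<and> op_norm Z T \<le> max (op_norm X T) (op_norm Y T))}"

definition same_vector_lattice ::
    "('a, 'b) vector_lattice_scheme \<Rightarrow> ('a, 'c) vector_lattice_scheme \<Rightarrow> bool" where
  "same_vector_lattice E F \<longleftrightarrow> carrier E = carrier F \<and> vzero E = vzero F \<and>
     (\<forall>x\<in>carrier E. \<forall>y\<in>carrier E. vadd E x y = vadd F x y) \<and>
     (\<forall>x\<in>carrier E. \<forall>r. vscale E r x = vscale F r x) \<and>
     (\<forall>x\<in>carrier E. \<forall>y\<in>carrier E. x \<sqsubseteq>\<^bsub>E\<^esub> y \<longleftrightarrow> x \<sqsubseteq>\<^bsub>F\<^esub> y)"

definition proportional :: "'a normed_lattice \<Rightarrow> 'a normed_lattice \<Rightarrow> bool" (infix "\<cong>\<^sub>p" 50) where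
  "E \<cong>\<^sub>p F \<longleftrightarrow> same_vector_lattice E F \<and> (\<exists>k>0. \<forall>x\<in>carrier E. vnorm E x = k * vnorm F x)"

end

theory Submission
  imports Defs
begin

text \<open>
  Each of \<open>X\<close>, \<open>Y\<close> is an exact interpolation space for its own pair, hence, by hypothesis, for
  \<open>(V,W)\<close>, and conversely; the proof tests this on the rank-one operators \<open>z \<mapsto> f z * a\<close> with a positive
  functional \<open>f\<close> on the sum and a positive element \<open>a\<close>. The norm of such an operator in \<open>Z\<close> is the product
  of the dual norm of \<open>f\<close> and the norm of \<open>a\<close>. For \<open>a\<close> in the intersection \<open>D\<close> of \<open>X\<close> and \<open>Y\<close>, which is also
  that of \<open>V\<close> and \<open>W\<close>, it follows that
  \<open>max (\<parallel>f\<parallel>\<^sub>X * \<parallel>a\<parallel>\<^sub>X) (\<parallel>f\<parallel>\<^sub>Y * \<parallel>a\<parallel>\<^sub>Y) = max (\<parallel>f\<parallel>\<^sub>V * \<parallel>a\<parallel>\<^sub>V) (\<parallel>f\<parallel>\<^sub>W * \<parallel>a\<parallel>\<^sub>W)\<close>.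

  These maxima, for all \<open>f\<close>, determine the pair of norms on \<open>D\<close> up to order and factors: for two
  targets \<open>a\<close>, \<open>b\<close> the maxima at \<open>b\<close> are at most \<open>k\<close> times those at \<open>a\<close> for all \<open>f\<close> exactly if
  \<open>\<parallel>b\<parallel>\<^sub>X \<le> k * \<parallel>a\<parallel>\<^sub>X\<close> and \<open>\<parallel>b\<parallel>\<^sub>Y \<le> k * \<parallel>a\<parallel>\<^sub>Y\<close> (lemma \<open>rank_one_comparison\<close>). The point is that there are enough
  functionals: a domination between the two dual norms forces one between the norms themselves
  (lemma \<open>dual_norm_domination\<close>), by Hahn--Banach and an iteration as in the open mapping theorem.
  An elementary argument about quotients (lemma \<open>norm_pairs_proportional_or_swapped\<close>) then matches the
  norms of \<open>X\<close>, \<open>Y\<close> on \<open>D\<close> with those of \<open>V\<close>, \<open>W\<close>.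

  It remains to pass from \<open>D\<close> to the whole spaces. If \<open>D\<close> is dense in two matched spaces, both are
  the completion of \<open>D\<close> inside the sum and hence proportional (lemma \<open>proportional_if_dense\<close>). If \<open>D\<close>
  is not dense in \<open>X\<close>, some functional vanishes on \<open>Y\<close> but not on \<open>X\<close>; then every positive \<open>a\<close> of \<open>X\<close>, not only
  of \<open>D\<close>, is the target of an admissible rank-one operator, and this identifies \<open>X\<close> with \<open>V\<close> or with
  \<open>W\<close> together with its norm (lemma \<open>proportional_if_not_dense\<close>).
\<close>

section \<open>Vector lattices\<close>

context vector_lattice
begin

(* Keeps classical search from turning every equation into two inequalities. *)
declare le_antisym [rule del]

abbreviation add (infixl "\<oplus>" 65) where "x \<oplus> y \<equiv> vadd L x y"
abbreviation diff (infixl "\<ominus>" 65) where "x \<ominus> y \<equiv> vdiff L x y"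
abbreviation scale (infixr "\<odot>" 75) where "r \<odot> x \<equiv> vscale L r x"
abbreviation zero ("\<zero>") where "\<zero> \<equiv> vzero L"

interpretation G: comm_group "\<lparr>carrier = carrier L, mult = vadd L, one = \<zero>\<rparr>"
  by (rule add_group)

lemma add_closed [simp]: "x \<in> carrier L \<Longrightarrow> y \<in> carrier L \<Longrightarrow> x \<oplus> y \<in> carrier L"
  using G.m_closed by simp

lemma zero_closed [simp]: "\<zero> \<in> carrier L"
  using G.one_closed by simp

declare scale_closed [simp]

lemma diff_closed [simp]: "x \<in> carrier L \<Longrightarrow> y \<in> carrier L \<Longrightarrow> x \<ominus> y \<in> carrier L"
  by (simp add: vdiff_def)

lemma add_assoc:
  "x \<in> carrier L \<Longrightarrow> y \<in> carrier L \<Longrightarrow> z \<in> carrier L \<Longrightarrow> (x \<oplus> y) \<oplus> z = x \<oplus> (y \<oplus> z)"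
  using G.m_assoc by simp

lemma add_comm: "x \<in> carrier L \<Longrightarrow> y \<in> carrier L \<Longrightarrow> x \<oplus> y = y \<oplus> x"
  using G.m_comm by simp

lemma add_left_comm:
  "x \<in> carrier L \<Longrightarrow> y \<in> carrier L \<Longrightarrow> z \<in> carrier L \<Longrightarrow> x \<oplus> (y \<oplus> z) = y \<oplus> (x \<oplus> z)"
  using G.m_lcomm by simp

lemmas add_ac = add_assoc add_comm add_left_comm

lemma add_zero [simp]: "x \<in> carrier L \<Longrightarrow> x \<oplus> \<zero> = x" "x \<in> carrier L \<Longrightarrow> \<zero> \<oplus> x = x"
  using G.r_one G.l_one by simp_all

lemma add_cancel:
  "x \<in> carrier L \<Longrightarrow> y \<in> carrier L \<Longrightarrow> z \<in> carrier L \<Longrightarrow> x \<oplus> y = x \<oplus> z \<longleftrightarrow> y = z"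
  using G.right_cancel[of x y z] by (simp add: add_comm)

lemma scale_zero_left [simp]: "x \<in> carrier L \<Longrightarrow> 0 \<odot> x = \<zero>"
  using scale_add_left[of x 0 0] add_cancel[of "0 \<odot> x" "0 \<odot> x" \<zero>] by simp

lemma scale_zero_right [simp]: "r \<odot> \<zero> = \<zero>"
  using scale_scale[of \<zero> r 0] by simp

declare scale_one [simp]

lemma add_neg [simp]: "x \<in> carrier L \<Longrightarrow> x \<oplus> (-1) \<odot> x = \<zero>"
  using scale_add_left[of x 1 "-1"] by simp

lemma neg_add [simp]: "x \<in> carrier L \<Longrightarrow> (-1) \<odot> x \<oplus> x = \<zero>"
  using scale_add_left[of x "-1" 1] by simp

lemma neg_neg [simp]: "x \<in> carrier L \<Longrightarrow> (-1) \<odot> (-1) \<odot> x = x"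
  by (simp add: scale_scale)

lemma diff_self [simp]: "x \<in> carrier L \<Longrightarrow> x \<ominus> x = \<zero>"
  by (simp add: vdiff_def)

lemma diff_zero [simp]: "x \<in> carrier L \<Longrightarrow> x \<ominus> \<zero> = x"
  by (simp add: vdiff_def)

lemma diff_add [simp]: "x \<in> carrier L \<Longrightarrow> y \<in> carrier L \<Longrightarrow> (x \<ominus> y) \<oplus> y = x"
  by (simp add: vdiff_def add_assoc)

lemma add_diff [simp]: "x \<in> carrier L \<Longrightarrow> y \<in> carrier L \<Longrightarrow> y \<oplus> (x \<ominus> y) = x"
  using add_comm[of y "x \<ominus> y"] by simp

lemma add_diff_cancel [simp]: "x \<in> carrier L \<Longrightarrow> y \<in> carrier L \<Longrightarrow> (x \<oplus> y) \<ominus> y = x"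
  by (simp add: vdiff_def add_assoc)

lemma eq_diff_iff:
  "x \<in> carrier L \<Longrightarrow> y \<in> carrier L \<Longrightarrow> z \<in> carrier L \<Longrightarrow> x = z \<ominus> y \<longleftrightarrow> x \<oplus> y = z"
  by auto

lemma diff_eq_zero: "x \<in> carrier L \<Longrightarrow> y \<in> carrier L \<Longrightarrow> x \<ominus> y = \<zero> \<longleftrightarrow> x = y"
  by (metis add_zero(2) diff_add diff_self)

lemma diff_swap:
  assumes "x \<in> carrier L" "y \<in> carrier L"
  shows "x \<ominus> y = (-1) \<odot> (y \<ominus> x)"
  using assms by (simp add: vdiff_def scale_add_right add_comm)

lemma diff_trans:
  assumes "x \<in> carrier L" "y \<in> carrier L" "z \<in> carrier L"
  shows "x \<ominus> z = (x \<ominus> y) \<oplus> (y \<ominus> z)"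
proof -
  have "(x \<ominus> y) \<oplus> (y \<ominus> z) \<oplus> z = x" using assms by (simp add: add_assoc)
  then have "(x \<ominus> y) \<oplus> (y \<ominus> z) = x \<ominus> z"
    using assms eq_diff_iff[of "(x \<ominus> y) \<oplus> (y \<ominus> z)" z x] by simp
  then show ?thesis by simp
qed

lemma add_swap:
  assumes "a \<in> carrier L" "b \<in> carrier L" "c \<in> carrier L" "d \<in> carrier L"
  shows "(a \<oplus> b) \<oplus> (c \<oplus> d) = (a \<oplus> c) \<oplus> (b \<oplus> d)"
  using assms by (simp add: add_ac)

lemma le_add_right_iff:
  assumes "x \<in> carrier L" "y \<in> carrier L" "z \<in> carrier L"
  shows "x \<oplus> z \<sqsubseteq> y \<oplus> z \<longleftrightarrow> x \<sqsubseteq> y"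
  using add_mono[of x y z] add_mono[of "x \<oplus> z" "y \<oplus> z" "(-1) \<odot> z"] assms
  by (auto simp: add_assoc)

lemma le_diff_iff:
  assumes "x \<in> carrier L" "y \<in> carrier L" "z \<in> carrier L"
  shows "x \<sqsubseteq> z \<ominus> y \<longleftrightarrow> x \<oplus> y \<sqsubseteq> z"
  using le_add_right_iff[of x "z \<ominus> y" y] assms by simp

lemma diff_le_iff:
  assumes "x \<in> carrier L" "y \<in> carrier L" "z \<in> carrier L"
  shows "z \<ominus> y \<sqsubseteq> x \<longleftrightarrow> z \<sqsubseteq> x \<oplus> y"
  using le_add_right_iff[of "z \<ominus> y" x y] assms by simp

lemma diff_nonneg_iff:
  "x \<in> carrier L \<Longrightarrow> y \<in> carrier L \<Longrightarrow> \<zero> \<sqsubseteq> y \<ominus> x \<longleftrightarrow> x \<sqsubseteq> y"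
  by (simp add: le_diff_iff)

lemma add_mono_both:
  assumes "x \<in> carrier L" "y \<in> carrier L" "z \<in> carrier L" "w \<in> carrier L" "x \<sqsubseteq> y" "z \<sqsubseteq> w"
  shows "x \<oplus> z \<sqsubseteq> y \<oplus> w"
  using assms le_trans[of "x \<oplus> z" "y \<oplus> z" "y \<oplus> w"] le_add_right_iff[of z w y]
  by (simp add: add_mono add_comm)

lemma add_nonneg:
  "x \<in> carrier L \<Longrightarrow> y \<in> carrier L \<Longrightarrow> \<zero> \<sqsubseteq> x \<Longrightarrow> \<zero> \<sqsubseteq> y \<Longrightarrow> \<zero> \<sqsubseteq> x \<oplus> y"
  using add_mono_both[of \<zero> x \<zero> y] by simp

lemma scale_nonneg: "x \<in> carrier L \<Longrightarrow> \<zero> \<sqsubseteq> x \<Longrightarrow> 0 \<le> r \<Longrightarrow> \<zero> \<sqsubseteq> r \<odot> x"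
  using scale_mono[of \<zero> x r] by simp

lemma le_add_nonneg:
  assumes "x \<in> carrier L" "y \<in> carrier L" "\<zero> \<sqsubseteq> y"
  shows "x \<sqsubseteq> x \<oplus> y" "x \<sqsubseteq> y \<oplus> x"
  using add_mono[of \<zero> y x] assms by (simp_all add: add_comm)

lemma diff_le_self:
  "x \<in> carrier L \<Longrightarrow> y \<in> carrier L \<Longrightarrow> \<zero> \<sqsubseteq> y \<Longrightarrow> x \<ominus> y \<sqsubseteq> x"
  by (simp add: diff_le_iff le_add_nonneg)

lemma neg_le_neg: "x \<in> carrier L \<Longrightarrow> y \<in> carrier L \<Longrightarrow> x \<sqsubseteq> y \<Longrightarrow> (-1) \<odot> y \<sqsubseteq> (-1) \<odot> x"
  using le_add_right_iff[of "(-1) \<odot> y" "(-1) \<odot> x" "x \<oplus> y"]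
    add_left_comm[of "(-1) \<odot> y" x y] by (simp add: add_assoc[symmetric])

lemma neg_le_swap:
  "x \<in> carrier L \<Longrightarrow> y \<in> carrier L \<Longrightarrow> (-1) \<odot> x \<sqsubseteq> y \<longleftrightarrow> (-1) \<odot> y \<sqsubseteq> x"
  using neg_le_neg[of "(-1) \<odot> x" y] neg_le_neg[of "(-1) \<odot> y" x] by auto

text \<open>The part of \<open>z\<close> below \<open>x\<close> is \<open>z \<sqinter> x\<close>; what remains is below \<open>y\<close> because
  both \<open>z \<ominus> y \<sqsubseteq> z\<close> and \<open>z \<ominus> y \<sqsubseteq> x\<close>.\<close>

lemma riesz_decomposition:
  assumes c: "x \<in> carrier L" "y \<in> carrier L" "z \<in> carrier L"
    and "\<zero> \<sqsubseteq> x" "\<zero> \<sqsubseteq> y" "\<zero> \<sqsubseteq> z" "z \<sqsubseteq> x \<oplus> y"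
  obtains x' y' where "x' \<in> carrier L" "y' \<in> carrier L" "\<zero> \<sqsubseteq> x'" "x' \<sqsubseteq> x" "\<zero> \<sqsubseteq> y'" "y' \<sqsubseteq> y"
    "z = x' \<oplus> y'"
proof
  let ?m = "z \<sqinter> x"
  show "?m \<in> carrier L" "z \<ominus> ?m \<in> carrier L" "\<zero> \<sqsubseteq> ?m" "?m \<sqsubseteq> x" "z = ?m \<oplus> (z \<ominus> ?m)"
    using assms by (simp_all add: meet_le meet_right)
  show "\<zero> \<sqsubseteq> z \<ominus> ?m" using assms by (simp add: diff_nonneg_iff meet_left)
  have "z \<ominus> y \<sqsubseteq> ?m" using assms by (intro meet_le) (auto simp: diff_le_self diff_le_iff)
  then show "z \<ominus> ?m \<sqsubseteq> y" using c by (simp add: diff_le_iff add_comm)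
qed

subsection \<open>Absolute values\<close>

lemma abs_closed [simp]: "x \<in> carrier L \<Longrightarrow> vabs L x \<in> carrier L"
  by (simp add: vabs_def)

lemma le_abs: "x \<in> carrier L \<Longrightarrow> x \<sqsubseteq> vabs L x"
  by (simp add: vabs_def join_left)

lemma neg_le_abs: "x \<in> carrier L \<Longrightarrow> (-1) \<odot> x \<sqsubseteq> vabs L x"
  by (simp add: vabs_def join_right)

lemma abs_le_iff:
  assumes "x \<in> carrier L" "y \<in> carrier L"
  shows "vabs L x \<sqsubseteq> y \<longleftrightarrow> x \<sqsubseteq> y \<and> (-1) \<odot> x \<sqsubseteq> y"
  using assms le_trans[OF le_abs, of x y] le_trans[OF neg_le_abs, of x y]
  by (auto simp: vabs_def intro: join_le)

lemma abs_nonneg [simp]: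
  assumes "x \<in> carrier L"
  shows "\<zero> \<sqsubseteq> vabs L x"
proof -
  have "\<zero> \<sqsubseteq> vabs L x \<oplus> vabs L x"
    using add_mono_both[OF _ _ _ _ le_abs neg_le_abs, of x x] assms by simp
  then have "\<zero> \<sqsubseteq> (1/2) \<odot> (vabs L x \<oplus> vabs L x)"
    using assms by (intro scale_nonneg) auto
  also have "(1/2) \<odot> (vabs L x \<oplus> vabs L x) = vabs L x"
    using assms scale_add_left[of "vabs L x" "1/2" "1/2"] by (simp add: scale_add_right)
  finally show ?thesis .
qed

lemma abs_of_nonneg: "x \<in> carrier L \<Longrightarrow> \<zero> \<sqsubseteq> x \<Longrightarrow> vabs L x = x"
  using neg_le_neg[of \<zero> x] le_trans[of "(-1) \<odot> x" \<zero> x]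
  by (intro le_antisym) (auto simp: abs_le_iff le_abs)

lemma abs_abs [simp]: "x \<in> carrier L \<Longrightarrow> vabs L (vabs L x) = vabs L x"
  by (simp add: abs_of_nonneg)

lemma abs_add:
  assumes "x \<in> carrier L" "y \<in> carrier L"
  shows "vabs L (x \<oplus> y) \<sqsubseteq> vabs L x \<oplus> vabs L y"
  using assms by (simp add: abs_le_iff scale_add_right add_mono_both le_abs neg_le_abs)

lemma abs_squeeze:
  assumes "x \<in> carrier L" "y \<in> carrier L" "z \<in> carrier L" "x \<sqsubseteq> z" "z \<sqsubseteq> y"
  shows "vabs L z \<sqsubseteq> vabs L x \<oplus> vabs L y"
proof -
  have "z \<sqsubseteq> vabs L y" "(-1) \<odot> z \<sqsubseteq> vabs L x"
    using assms le_trans[OF _ le_abs, of z y] le_trans[OF neg_le_neg neg_le_abs, of x z] by auto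
  moreover have "vabs L y \<sqsubseteq> vabs L x \<oplus> vabs L y" "vabs L x \<sqsubseteq> vabs L x \<oplus> vabs L y"
    using assms by (simp_all add: le_add_nonneg)
  ultimately show ?thesis
    using assms le_trans[of z "vabs L y" "vabs L x \<oplus> vabs L y"]
      le_trans[of "(-1) \<odot> z" "vabs L x" "vabs L x \<oplus> vabs L y"] by (simp add: abs_le_iff)
qed

lemma pos_neg_parts:
  assumes "x \<in> carrier L"
  obtains p n where "p \<in> carrier L" "n \<in> carrier L" "\<zero> \<sqsubseteq> p" "\<zero> \<sqsubseteq> n" "p \<sqsubseteq> vabs L x" "n \<sqsubseteq> vabs L x"
    "x = p \<ominus> n"
proof
  let ?p = "x \<squnion> \<zero>"
  show "?p \<in> carrier L" "?p \<ominus> x \<in> carrier L" "\<zero> \<sqsubseteq> ?p" "\<zero> \<sqsubseteq> ?p \<ominus> x"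
    using assms by (simp_all add: join_right diff_nonneg_iff join_left)
  show "?p \<sqsubseteq> vabs L x" using assms by (intro join_le) (auto simp: le_abs)
  have "x \<sqsubseteq> vabs L x \<oplus> x" using assms by (simp add: le_add_nonneg)
  moreover have "\<zero> \<sqsubseteq> vabs L x \<oplus> x"
    using add_mono[OF _ _ _ neg_le_abs, of x x] assms by simp
  ultimately have "?p \<sqsubseteq> vabs L x \<oplus> x" using assms by (intro join_le) auto
  then show "?p \<ominus> x \<sqsubseteq> vabs L x" using assms by (simp add: diff_le_iff)
  show "x = ?p \<ominus> (?p \<ominus> x)" using assms by (simp add: eq_diff_iff)
qed

end

section \<open>Order ideals and Banach ideals\<close>

text \<open>Suprema and infima of \<open>x\<close> and \<open>y\<close> stay in the subspace because they lie between
  \<open>-(\<bar>x\<bar> + \<bar>y\<bar>)\<close> and \<open>\<bar>x\<bar> + \<bar>y\<bar>\<close>.\<close>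

lemma solid_subspace_order_ideal:
  fixes L :: "'a vector_lattice"
  assumes L: "vector_lattice L" and A: "A \<subseteq> carrier L" "vzero L \<in> A"
    and add: "\<And>x y. x \<in> A \<Longrightarrow> y \<in> A \<Longrightarrow> vadd L x y \<in> A"
    and scale: "\<And>x r. x \<in> A \<Longrightarrow> vscale L r x \<in> A"
    and solid: "\<And>x y. x \<in> A \<Longrightarrow> y \<in> carrier L \<Longrightarrow> vabs L y \<sqsubseteq>\<^bsub>L\<^esub> vabs L x \<Longrightarrow> y \<in> A"
  shows "vector_lattice (restrict_lattice L A n)" "order_ideal (restrict_lattice L A n) L"
proof -
  interpret L: vector_lattice L by fact
  let ?R = "restrict_lattice L A n"
  have R [simp]: "carrier ?R = A" "vadd ?R = vadd L" "vzero ?R = vzero L" "vscale ?R = vscale L"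
    "le ?R = le L" "eq ?R = eq L"
    by (simp_all add: restrict_lattice_def)
  have in_L: "x \<in> carrier L" if "x \<in> A" for x using A that by auto
  have abs: "vabs L x \<in> A" if "x \<in> A" for x
    using that solid[of x "vabs L x"] in_L by simp
  have between: "z \<in> A" if "x \<in> A" "y \<in> A" "z \<in> carrier L" "x \<sqsubseteq>\<^bsub>L\<^esub> z" "z \<sqsubseteq>\<^bsub>L\<^esub> y" for x y z
  proof (rule solid)
    show "vadd L (vabs L x) (vabs L y) \<in> A" using that abs add by auto
    show "vabs L z \<sqsubseteq>\<^bsub>L\<^esub> vabs L (vadd L (vabs L x) (vabs L y))"
      using that in_L L.abs_squeeze[of x y z]
      by (simp add: L.abs_of_nonneg L.add_nonneg)
  qed (use that in auto)
  have abs_sum: "vadd L (vabs L x) (vabs L y) \<in> A" if "x \<in> A" "y \<in> A" for x y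
    using that abs add by auto
  have join: "x \<squnion>\<^bsub>L\<^esub> y \<in> A" if "x \<in> A" "y \<in> A" for x y
  proof (rule between)
    show "x \<squnion>\<^bsub>L\<^esub> y \<sqsubseteq>\<^bsub>L\<^esub> vadd L (vabs L x) (vabs L y)"
      using that in_L L.le_trans[OF L.le_abs, of x] L.le_trans[OF L.le_abs, of y]
      by (intro L.join_le) (auto simp: L.le_add_nonneg)
  qed (use that in_L abs_sum L.join_left in auto)
  have meet: "x \<sqinter>\<^bsub>L\<^esub> y \<in> A" if "x \<in> A" "y \<in> A" for x y
  proof (rule between)
    let ?s = "vadd L (vabs L x) (vabs L y)"
    have "vscale L (-1) ?s \<sqsubseteq>\<^bsub>L\<^esub> x" "vscale L (-1) ?s \<sqsubseteq>\<^bsub>L\<^esub> y"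
      using that in_L L.le_trans[OF L.neg_le_abs, of x ?s] L.le_trans[OF L.neg_le_abs, of y ?s]
      by (auto simp: L.le_add_nonneg L.neg_le_swap)
    then show "vscale L (-1) ?s \<sqsubseteq>\<^bsub>L\<^esub> x \<sqinter>\<^bsub>L\<^esub> y"
      using that in_L by (intro L.meet_le) auto
    show "vscale L (-1) ?s \<in> A" using that abs_sum scale by auto
  qed (use that in_L L.meet_left in auto)
  have "lattice ?R"
  proof
    show "\<exists>s. least ?R s (Upper ?R {x, y})" if "x \<in> carrier ?R" "y \<in> carrier ?R" for x y
      using that join[of x y] in_L L.join_left[of x y] L.join_right[of x y]
      by (intro exI[of _ "x \<squnion>\<^bsub>L\<^esub> y"]) (auto simp: least_def Upper_def intro!: L.join_le)
    show "\<exists>s. greatest ?R s (Lower ?R {x, y})" if "x \<in> carrier ?R" "y \<in> carrier ?R" for x y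
      using that meet[of x y] in_L L.meet_left[of x y] L.meet_right[of x y]
      by (intro exI[of _ "x \<sqinter>\<^bsub>L\<^esub> y"]) (auto simp: greatest_def Lower_def intro!: L.meet_le)
  qed (use in_L L.eq_is_equal in \<open>auto intro: L.le_trans L.le_antisym\<close>)
  moreover have "comm_group \<lparr>carrier = A, mult = vadd L, one = vzero L\<rparr>"
  proof (rule comm_groupI)
    show "\<exists>y\<in>carrier \<lparr>carrier = A, mult = vadd L, one = vzero L\<rparr>.
      y \<otimes>\<^bsub>\<lparr>carrier = A, mult = vadd L, one = vzero L\<rparr>\<^esub> x = \<one>\<^bsub>\<lparr>carrier = A, mult = vadd L, one = vzero L\<rparr>\<^esub>"
      if "x \<in> carrier \<lparr>carrier = A, mult = vadd L, one = vzero L\<rparr>" for x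
      using that scale in_L by (auto intro!: bexI[of _ "vscale L (-1) x"])
  qed (use add A in_L in \<open>auto simp: L.add_ac\<close>)
  ultimately show VR: "vector_lattice ?R"
    using in_L scale
    by (intro vector_lattice.intro vector_lattice_axioms.intro)
      (simp_all add: L.scale_scale L.scale_add_left L.scale_add_right L.add_mono L.scale_mono)
  show "order_ideal ?R L"
    using VR L A by (auto simp: order_ideal_def intro: solid)
qed

locale lattice_ideal = vector_lattice L for L (structure) +
  fixes E :: "('a, 'c) vector_lattice_scheme"
  assumes ideal: "order_ideal E L"
begin

lemma
  shows ideal_carrier: "x \<in> carrier E \<Longrightarrow> x \<in> carrier L"
    and ideal_add: "x \<in> carrier E \<Longrightarrow> y \<in> carrier E \<Longrightarrow> vadd E x y = vadd L x y"
    and ideal_scale: "x \<in> carrier E \<Longrightarrow> vscale E r x = vscale L r x"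
    and ideal_le: "x \<in> carrier E \<Longrightarrow> y \<in> carrier E \<Longrightarrow> x \<sqsubseteq>\<^bsub>E\<^esub> y \<longleftrightarrow> x \<sqsubseteq> y"
    and ideal_solid: "x \<in> carrier E \<Longrightarrow> y \<in> carrier L \<Longrightarrow> vabs L y \<sqsubseteq> vabs L x \<Longrightarrow> y \<in> carrier E"
  using ideal by (auto simp: order_ideal_def)

declare ideal_carrier [simp]

interpretation E: vector_lattice E
  using ideal by (simp add: order_ideal_def)

lemma ideal_zero: "vzero E = vzero L"
  using ideal_scale[of "vzero E" 0] ideal_carrier[of "vzero E"] by simp

lemma ideal_diff: "x \<in> carrier E \<Longrightarrow> y \<in> carrier E \<Longrightarrow> vdiff E x y = vdiff L x y"
  using ideal_add[of x "vscale E (-1) y"] ideal_scale[of y "-1"]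
    E.scale_closed[of y "-1"] by (simp add: vdiff_def)

lemma ideal_zero_closed [simp]: "\<zero> \<in> carrier E"
  using E.zero_closed by (simp add: ideal_zero)

lemma ideal_add_closed [simp]: "x \<in> carrier E \<Longrightarrow> y \<in> carrier E \<Longrightarrow> x \<oplus> y \<in> carrier E"
  using E.add_closed[of x y] by (simp add: ideal_add)

lemma ideal_scale_closed [simp]: "x \<in> carrier E \<Longrightarrow> r \<odot> x \<in> carrier E"
  using E.scale_closed[of x r] by (simp add: ideal_scale)

lemma ideal_diff_closed [simp]: "x \<in> carrier E \<Longrightarrow> y \<in> carrier E \<Longrightarrow> x \<ominus> y \<in> carrier E"
  by (simp add: vdiff_def)

lemma ideal_abs_closed [simp]: "x \<in> carrier E \<Longrightarrow> vabs L x \<in> carrier E"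
  using ideal_solid[of x "vabs L x"] by simp

lemma ideal_abs_closed_iff: "x \<in> carrier L \<Longrightarrow> vabs L x \<in> carrier E \<longleftrightarrow> x \<in> carrier E"
  using ideal_solid[of "vabs L x" x] by auto

lemma ideal_between:
  assumes "x \<in> carrier E" "y \<in> carrier L" "\<zero> \<sqsubseteq> y" "y \<sqsubseteq> x"
  shows "y \<in> carrier E"
proof (rule ideal_solid[of x])
  have "\<zero> \<sqsubseteq> x" using assms le_trans[of \<zero> y x] by simp
  then show "vabs L y \<sqsubseteq> vabs L x" using assms by (simp add: abs_of_nonneg)
qed (use assms in simp_all)

text \<open>The supremum of \<open>x\<close> and \<open>-x\<close> in the larger lattice already belongs to the ideal,
  so it is the supremum there.\<close>

lemma ideal_abs:
  assumes x: "x \<in> carrier E"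
  shows "vabs E x = vabs L x"
proof (rule le_antisym)
  have cl: "vabs L x \<in> carrier E" "vabs E x \<in> carrier E" "vscale E (-1) x \<in> carrier E"
    using x by simp_all
  have "vabs E x \<sqsubseteq>\<^bsub>E\<^esub> vabs L x"
    unfolding E.abs_le_iff[OF x cl(1)]
    using x cl by (simp add: ideal_le ideal_scale le_abs neg_le_abs)
  then show "vabs E x \<sqsubseteq> vabs L x"
    using cl by (simp add: ideal_le)
  have "x \<sqsubseteq> vabs E x" "(-1) \<odot> x \<sqsubseteq> vabs E x"
    using E.le_abs[OF x] E.neg_le_abs[OF x] x cl by (simp_all add: ideal_le ideal_scale)
  then show "vabs L x \<sqsubseteq> vabs E x" using x cl by (simp add: abs_le_iff)
  show "vabs E x \<in> carrier L" "vabs L x \<in> carrier L" using cl by simp_all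
qed

lemma ideal_pos_cone: "x \<in> pos_cone E \<longleftrightarrow> x \<in> carrier E \<and> \<zero> \<sqsubseteq> x"
  using ideal_le[of \<zero> x] by (cases "x \<in> carrier E") (simp_all add: pos_cone_def ideal_zero)

end

lemma (in vector_lattice) ideal_subset_by_pos:
  assumes "order_ideal E L" "order_ideal F L"
    and pos: "\<And>x. x \<in> carrier E \<Longrightarrow> \<zero> \<sqsubseteq> x \<Longrightarrow> x \<in> carrier F"
  shows "carrier E \<subseteq> carrier F"
proof
  interpret E: lattice_ideal L E by unfold_locales fact
  interpret F: lattice_ideal L F by unfold_locales fact
  fix x assume x: "x \<in> carrier E"
  then have xL: "x \<in> carrier L" by (rule E.ideal_carrier)
  have "vabs L x \<in> carrier F" by (rule pos[OF E.ideal_abs_closed[OF x] abs_nonneg[OF xL]])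
  then show "x \<in> carrier F" using F.ideal_abs_closed_iff[OF xL] by simp
qed

lemma (in banach_lattice) metric_space: "Metric_space (carrier E) (vdist E)"
proof
  show "0 \<le> vdist E x y" for x y by (simp add: vdist_def norm_nonneg)
  have "vnorm E (vdiff E x y) = vnorm E (vdiff E y x)" if "x \<in> carrier E" "y \<in> carrier E" for x y
    by (subst diff_swap) (use that norm_scale[of "vdiff E y x" "-1"] in auto)
  then show "vdist E x y = vdist E y x" for x y
    by (simp add: vdist_def)
  show "vdist E x y = 0 \<longleftrightarrow> x = y" if "x \<in> carrier E" "y \<in> carrier E" for x y
    using that by (simp add: vdist_def norm_eq_zero diff_eq_zero)
  show "vdist E x z \<le> vdist E x y + vdist E y z"
    if "x \<in> carrier E" "y \<in> carrier E" "z \<in> carrier E" for x y z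
    using that norm_triangle[of "vdiff E x y" "vdiff E y z"] by (simp add: vdist_def diff_trans[of x y z])
qed

lemma (in banach_lattice) Cauchy_convergent:
  assumes "\<And>n. \<sigma> n \<in> carrier E"
    and "\<And>e. e > 0 \<Longrightarrow> \<exists>N. \<forall>m\<ge>N. \<forall>n\<ge>m. vnorm E (vdiff E (\<sigma> m) (\<sigma> n)) < e"
  obtains x where "x \<in> carrier E" "(\<lambda>n. vnorm E (vdiff E (\<sigma> n) x)) \<longlonglongrightarrow> 0"
proof -
  interpret M: Metric_space "carrier E" "vdist E" by (rule metric_space)
  have "M.MCauchy \<sigma>"
    unfolding M.MCauchy_def
  proof (intro conjI allI impI)
    show "range \<sigma> \<subseteq> carrier E" using assms(1) by auto
    fix e :: real assume "e > 0"
    then obtain N where N: "vnorm E (vdiff E (\<sigma> m) (\<sigma> n)) < e" if "m \<ge> N" "n \<ge> m" for m n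
      using assms(2) by blast
    have "vdist E (\<sigma> m) (\<sigma> n) < e" if "m \<ge> N" "n \<ge> N" for m n
      using N[of m n] N[of n m] that assms(1) M.commute[of "\<sigma> m" "\<sigma> n"]
      by (cases "n \<ge> m") (auto simp: vdist_def)
    then show "\<exists>N. \<forall>m n. N \<le> m \<longrightarrow> N \<le> n \<longrightarrow> vdist E (\<sigma> m) (\<sigma> n) < e" by blast
  qed
  then obtain x where "limitin M.mtopology \<sigma> x sequentially"
    using complete M.mcomplete_def by blast
  then have "x \<in> carrier E" "(\<lambda>n. vdist E (\<sigma> n) x) \<longlonglongrightarrow> 0"
    by (auto simp: M.limitin_metric_dist_null)
  with that assms(1) show thesis by (simp add: vdist_def)
qed

locale banach_ideal = lattice_ideal L E for L (structure) and E :: "'a normed_lattice" +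
  assumes banach: "banach_lattice E"
begin

lemmas to_L = ideal_add ideal_scale ideal_le ideal_zero ideal_diff ideal_abs

lemma norm_nonneg: "x \<in> carrier E \<Longrightarrow> 0 \<le> vnorm E x"
  using banach_lattice.norm_nonneg[OF banach] .

lemma norm_eq_zero: "x \<in> carrier E \<Longrightarrow> vnorm E x = 0 \<longleftrightarrow> x = \<zero>"
  using banach_lattice.norm_eq_zero[OF banach] by (simp add: to_L)

lemma norm_zero [simp]: "vnorm E \<zero> = 0"
  by (simp add: norm_eq_zero)

lemma norm_pos: "x \<in> carrier E \<Longrightarrow> x \<noteq> \<zero> \<Longrightarrow> 0 < vnorm E x"
  using norm_nonneg[of x] norm_eq_zero[of x] by linarith

lemma norm_scale: "x \<in> carrier E \<Longrightarrow> vnorm E (r \<odot> x) = \<bar>r\<bar> * vnorm E x"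
  using banach_lattice.norm_scale[OF banach, of x r] by (simp add: to_L)

lemma norm_add: "x \<in> carrier E \<Longrightarrow> y \<in> carrier E \<Longrightarrow> vnorm E (x \<oplus> y) \<le> vnorm E x + vnorm E y"
  using banach_lattice.norm_triangle[OF banach, of x y] by (simp add: to_L)

lemma norm_abs_mono:
  "x \<in> carrier E \<Longrightarrow> y \<in> carrier E \<Longrightarrow> vabs L x \<sqsubseteq> vabs L y \<Longrightarrow> vnorm E x \<le> vnorm E y"
  using banach_lattice.norm_lattice[OF banach, of x y] by (simp add: to_L)

lemma norm_abs: "x \<in> carrier E \<Longrightarrow> vnorm E (vabs L x) = vnorm E x"
  using norm_abs_mono[of x "vabs L x"] norm_abs_mono[of "vabs L x" x] by (simp add: antisym)

lemma norm_mono: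
  assumes "y \<in> carrier E" "x \<in> carrier L" "\<zero> \<sqsubseteq> x" "x \<sqsubseteq> y"
  shows "x \<in> carrier E" "vnorm E x \<le> vnorm E y"
proof -
  show x: "x \<in> carrier E" using assms ideal_between by blast
  have "\<zero> \<sqsubseteq> y" using assms le_trans[of \<zero> x y] by simp
  then show "vnorm E x \<le> vnorm E y"
    using assms x by (intro norm_abs_mono) (simp_all add: abs_of_nonneg)
qed

lemma norm_diff_comm: "x \<in> carrier E \<Longrightarrow> y \<in> carrier E \<Longrightarrow> vnorm E (x \<ominus> y) = vnorm E (y \<ominus> x)"
  by (subst diff_swap) (use norm_scale[of "y \<ominus> x" "-1"] in simp_all)

lemma norm_le_diff:
  assumes "x \<in> carrier E" "y \<in> carrier E"
  shows "vnorm E x \<le> vnorm E (x \<ominus> y) + vnorm E y"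
  using norm_add[of "x \<ominus> y" y] assms diff_add[of x y] by simp

lemma norm_tendsto:
  assumes "\<And>n. \<sigma> n \<in> carrier E" "x \<in> carrier E" "(\<lambda>n. vnorm E (\<sigma> n \<ominus> x)) \<longlonglongrightarrow> 0"
  shows "(\<lambda>n. vnorm E (\<sigma> n)) \<longlonglongrightarrow> vnorm E x"
proof (rule LIM_zero_cancel, rule Lim_null_comparison[OF _ assms(3)], rule always_eventually, rule allI)
  show "norm (vnorm E (\<sigma> n) - vnorm E x) \<le> vnorm E (\<sigma> n \<ominus> x)" for n
    using norm_le_diff[OF assms(1,2), of n] norm_le_diff[OF assms(2,1), of n]
      norm_diff_comm[OF assms(2,1), of n] unfolding real_norm_def by linarith
qed

lemma Cauchy_convergent:
  assumes "\<And>n. \<sigma> n \<in> carrier E"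
    and "\<And>e. e > 0 \<Longrightarrow> \<exists>N. \<forall>m\<ge>N. \<forall>n\<ge>m. vnorm E (\<sigma> m \<ominus> \<sigma> n) < e"
  shows "\<exists>x\<in>carrier E. (\<lambda>n. vnorm E (\<sigma> n \<ominus> x)) \<longlonglongrightarrow> 0"
proof -
  have *: "vdiff E (\<sigma> n) y = \<sigma> n \<ominus> y" if "y \<in> carrier E" for n y
    using that assms(1) by (rule ideal_diff[rotated])
  obtain x where x: "x \<in> carrier E" "(\<lambda>n. vnorm E (vdiff E (\<sigma> n) x)) \<longlonglongrightarrow> 0"
    by (rule banach_lattice.Cauchy_convergent[OF banach assms(1), unfolded *[OF assms(1)], OF assms(2)])
  from x(2) have "(\<lambda>n. vnorm E (\<sigma> n \<ominus> x)) \<longlonglongrightarrow> 0"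
    unfolding *[OF x(1)] .
  with x(1) show ?thesis ..
qed

end

section \<open>Linear functionals below a sublinear one\<close>

context vector_lattice
begin

definition sublinear :: "('a \<Rightarrow> real) \<Rightarrow> bool" where
  "sublinear p \<longleftrightarrow> (\<forall>x\<in>carrier L. \<forall>y\<in>carrier L. p (x \<oplus> y) \<le> p x + p y) \<and>
     (\<forall>x\<in>carrier L. \<forall>r\<ge>0. p (r \<odot> x) = r * p x)"

lemma sublinear_add: "sublinear p \<Longrightarrow> x \<in> carrier L \<Longrightarrow> y \<in> carrier L \<Longrightarrow> p (x \<oplus> y) \<le> p x + p y"
  by (simp add: sublinear_def)

lemma sublinear_scale: "sublinear p \<Longrightarrow> x \<in> carrier L \<Longrightarrow> 0 \<le> r \<Longrightarrow> p (r \<odot> x) = r * p x"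
  by (simp add: sublinear_def)

lemma sublinear_zero: "sublinear p \<Longrightarrow> p \<zero> = 0"
  using sublinear_scale[of p \<zero> 0] by simp

lemma sublinear_neg: "sublinear p \<Longrightarrow> x \<in> carrier L \<Longrightarrow> - p ((-1) \<odot> x) \<le> p x"
  using sublinear_add[of p x "(-1) \<odot> x"] sublinear_zero[of p] by simp

lemma sublinearI:
  assumes add: "\<And>x y. x \<in> carrier L \<Longrightarrow> y \<in> carrier L \<Longrightarrow> p (x \<oplus> y) \<le> p x + p y"
    and scale: "\<And>x r. x \<in> carrier L \<Longrightarrow> 0 < r \<Longrightarrow> p (r \<odot> x) \<le> r * p x"
    and zero: "p \<zero> = 0"
  shows "sublinear p"
  unfolding sublinear_def
proof (intro conjI ballI allI impI)
  fix x and r :: real assume x: "x \<in> carrier L" and "0 \<le> r"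
  show "p (r \<odot> x) = r * p x"
  proof (cases "r = 0")
    case False
    then have r: "0 < r" using \<open>0 \<le> r\<close> by simp
    have "p x \<le> (1 / r) * p (r \<odot> x)"
      using scale[of "r \<odot> x" "1 / r"] x r by (simp add: scale_scale)
    then show ?thesis using scale[OF x r] r by (simp add: field_simps)
  qed (use x zero in simp)
qed (rule add)

text \<open>The largest sublinear functional below \<open>p\<close> that is at most \<open>- p z\<close> at \<open>-z\<close>.\<close>

definition lowered :: "('a \<Rightarrow> real) \<Rightarrow> 'a \<Rightarrow> 'a \<Rightarrow> real" where
  "lowered p z x = (INF t\<in>{0..}. p (x \<oplus> t \<odot> z) - t * p z)"

lemma lowered_le:
  assumes p: "sublinear p" and x: "x \<in> carrier L" and z: "z \<in> carrier L" and "0 \<le> t"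
  shows "lowered p z x \<le> p (x \<oplus> t \<odot> z) - t * p z"
  unfolding lowered_def
proof (rule cINF_lower)
  have "- p ((-1) \<odot> x) \<le> p (x \<oplus> s \<odot> z) - s * p z" if "0 \<le> s" for s
  proof -
    have "s \<odot> z = (-1) \<odot> x \<oplus> (x \<oplus> s \<odot> z)"
      using x z by (simp add: add_assoc[symmetric])
    then have "s * p z \<le> p ((-1) \<odot> x) + p (x \<oplus> s \<odot> z)"
      using sublinear_add[OF p, of "(-1) \<odot> x" "x \<oplus> s \<odot> z"] sublinear_scale[OF p z that] x z
      by simp
    then show ?thesis by simp
  qed
  then show "bdd_below ((\<lambda>t. p (x \<oplus> t \<odot> z) - t * p z) ` {0..})"
    by (intro bdd_belowI2) auto
qed (use \<open>0 \<le> t\<close> in simp)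

lemma lowered_greatest:
  "(\<And>t. 0 \<le> t \<Longrightarrow> c \<le> p (x \<oplus> t \<odot> z) - t * p z) \<Longrightarrow> c \<le> lowered p z x"
  unfolding lowered_def by (rule cINF_greatest) auto

lemma sublinear_lowered:
  assumes p: "sublinear p" and z: "z \<in> carrier L"
  shows "sublinear (lowered p z)"
proof (rule sublinearI)
  fix x y assume x: "x \<in> carrier L" and y: "y \<in> carrier L"
  have *: "lowered p z (x \<oplus> y) \<le> (p (x \<oplus> s \<odot> z) - s * p z) + (p (y \<oplus> t \<odot> z) - t * p z)"
    if "0 \<le> s" "0 \<le> t" for s t
  proof -
    have "(x \<oplus> s \<odot> z) \<oplus> (y \<oplus> t \<odot> z) = (x \<oplus> y) \<oplus> (s + t) \<odot> z"
      using x y z add_swap[of x "s \<odot> z" y "t \<odot> z"] by (simp add: scale_add_left)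
    then have "p ((x \<oplus> y) \<oplus> (s + t) \<odot> z) \<le> p (x \<oplus> s \<odot> z) + p (y \<oplus> t \<odot> z)"
      using sublinear_add[OF p, of "x \<oplus> s \<odot> z" "y \<oplus> t \<odot> z"] x y z by simp
    then show ?thesis
      using lowered_le[OF p, of "x \<oplus> y" z "s + t"] x y z that by (simp add: distrib_right)
  qed
  have "lowered p z (x \<oplus> y) - (p (x \<oplus> s \<odot> z) - s * p z) \<le> lowered p z y" if "0 \<le> s" for s
  proof (rule lowered_greatest)
    fix t :: real assume "0 \<le> t"
    from *[OF that this]
    show "lowered p z (x \<oplus> y) - (p (x \<oplus> s \<odot> z) - s * p z) \<le> p (y \<oplus> t \<odot> z) - t * p z" by linarith
  qed
  then have "lowered p z (x \<oplus> y) - lowered p z y \<le> p (x \<oplus> s \<odot> z) - s * p z" if "0 \<le> s" for s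
    using that by (smt (verit))
  then have "lowered p z (x \<oplus> y) - lowered p z y \<le> lowered p z x"
    by (rule lowered_greatest)
  then show "lowered p z (x \<oplus> y) \<le> lowered p z x + lowered p z y" by simp
next
  fix x and r :: real assume x: "x \<in> carrier L" and r: "0 < r"
  have "lowered p z (r \<odot> x) / r \<le> lowered p z x"
  proof (rule lowered_greatest)
    fix t :: real assume t: "0 \<le> t"
    have "r \<odot> x \<oplus> (r * t) \<odot> z = r \<odot> (x \<oplus> t \<odot> z)"
      using x z by (simp add: scale_add_right scale_scale)
    then have "p (r \<odot> x \<oplus> (r * t) \<odot> z) = r * p (x \<oplus> t \<odot> z)"
      using sublinear_scale[OF p, of "x \<oplus> t \<odot> z" r] x z r by simp
    then show "lowered p z (r \<odot> x) / r \<le> p (x \<oplus> t \<odot> z) - t * p z"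
      using lowered_le[OF p, of "r \<odot> x" z "r * t"] x z r t by (simp add: field_simps)
  qed
  then show "lowered p z (r \<odot> x) \<le> r * lowered p z x"
    using r by (simp add: field_simps)
next
  have "p (\<zero> \<oplus> t \<odot> z) - t * p z = 0" if "0 \<le> t" for t
    using that z sublinear_scale[OF p z, of t] by simp
  then show "lowered p z \<zero> = 0"
    by (simp add: lowered_def)
qed

text \<open>A sublinear functional that is minimal below \<open>q\<close> cannot be lowered in any
  direction \<open>z\<close>, and for \<open>t = 1\<close> this reads \<open>p x \<le> p (x \<oplus> z) - p z\<close>; so it is additive.\<close>

lemma linear_below_sublinear:
  assumes q: "sublinear q"
  obtains f where "\<And>x y. x \<in> carrier L \<Longrightarrow> y \<in> carrier L \<Longrightarrow> f (x \<oplus> y) = f x + f y"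
    "\<And>x r. x \<in> carrier L \<Longrightarrow> f (r \<odot> x) = r * f x" "\<And>x. x \<in> carrier L \<Longrightarrow> f x \<le> q x"
proof -
  \<comment> \<open>The value 0 outside the carrier makes the pointwise order on \<open>A\<close> antisymmetric.\<close>
  define A where "A = {p. sublinear p \<and> (\<forall>x\<in>carrier L. p x \<le> q x) \<and> (\<forall>x. x \<notin> carrier L \<longrightarrow> p x = 0)}"
  define P where "P p p' \<longleftrightarrow> (\<forall>x\<in>carrier L. p' x \<le> p x)" for p p' :: "'a \<Rightarrow> real"
  define cut where "cut p x = (if x \<in> carrier L then p x else 0)" for p :: "'a \<Rightarrow> real" and x
  have cut_A: "cut p \<in> A" if "sublinear p" "\<And>x. x \<in> carrier L \<Longrightarrow> p x \<le> q x" for p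
    using that by (auto simp: A_def cut_def sublinear_def)
  have "\<exists>m\<in>A. \<forall>p\<in>A. P m p \<longrightarrow> p = m"
  proof (rule predicate_Zorn)
    have "p = p'" if "p \<in> A" "p' \<in> A" "P p p'" "P p' p" for p p'
    proof
      fix x show "p x = p' x" using that by (cases "x \<in> carrier L") (auto simp: A_def P_def intro: antisym)
    qed
    then show "partial_order_on A (relation_of P A)"
      by (intro partial_order_on_relation_ofI) (auto simp: P_def intro: order_trans)
  next
    fix C assume "C \<in> Chains (relation_of P A)"
    then have CA: "C \<subseteq> A" and chain: "\<And>p p'. p \<in> C \<Longrightarrow> p' \<in> C \<Longrightarrow> P p p' \<or> P p' p"
      by (auto simp: Chains_def relation_of_def)
    show "\<exists>u\<in>A. \<forall>a\<in>C. P a u"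
    proof (cases "C = {}")
      case True
      then show ?thesis using cut_A[OF q] by auto
    next
      case False
      define u where "u x = (INF p\<in>C. p x)" for x
      have sub: "sublinear p" and below: "x \<in> carrier L \<Longrightarrow> p x \<le> q x" if "p \<in> C" for p x
        using that CA by (auto simp: A_def)
      have u_le: "u x \<le> p x" if "p \<in> C" "x \<in> carrier L" for p x
        unfolding u_def
      proof (rule cINF_lower)
        have "- q ((-1) \<odot> x) \<le> p x" if "p \<in> C" for p
          using sublinear_neg[OF sub[OF that], of x] below[OF that, of "(-1) \<odot> x"] \<open>x \<in> carrier L\<close>
          by simp
        then show "bdd_below ((\<lambda>p. p x) ` C)" by (rule bdd_belowI2)
      qed (rule that)
      have le_u: "c \<le> u x" if "\<And>p. p \<in> C \<Longrightarrow> c \<le> p x" for c x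
        unfolding u_def using False that by (intro cINF_greatest) auto
      have "sublinear u"
      proof (rule sublinearI)
        fix x y assume x: "x \<in> carrier L" and y: "y \<in> carrier L"
        have *: "u (x \<oplus> y) \<le> p x + p' y" if p: "p \<in> C" "p' \<in> C" for p p'
        proof (cases "P p p'")
          case True
          then have "p' x \<le> p x" using x by (simp add: P_def)
          then show ?thesis
            using u_le[OF p(2), of "x \<oplus> y"] sublinear_add[OF sub[OF p(2)] x y] x y by simp
        next
          case False
          then have "p y \<le> p' y" using chain[OF p] y by (auto simp: P_def)
          then show ?thesis
            using u_le[OF p(1), of "x \<oplus> y"] sublinear_add[OF sub[OF p(1)] x y] x y by simp
        qed
        have "u (x \<oplus> y) - p x \<le> u y" if "p \<in> C" for p
          using *[OF that] by (intro le_u) (simp add: algebra_simps)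
        then have "u (x \<oplus> y) - u y \<le> u x"
          by (intro le_u) (simp add: algebra_simps)
        then show "u (x \<oplus> y) \<le> u x + u y" by simp
      next
        fix x and r :: real assume x: "x \<in> carrier L" and r: "0 < r"
        have "u (r \<odot> x) / r \<le> u x"
          using u_le[of _ "r \<odot> x"] sublinear_scale[OF sub x, of _ r] x r
          by (intro le_u) (simp add: field_simps)
        then show "u (r \<odot> x) \<le> r * u x" using r by (simp add: field_simps)
      next
        have "p \<zero> = 0" if "p \<in> C" for p using sublinear_zero[OF sub[OF that]] .
        then have "u \<zero> = (INF p\<in>C. 0)" unfolding u_def by (rule INF_cong[OF HOL.refl])
        then show "u \<zero> = 0" using False by simp
      qed
      moreover have "u x \<le> q x" if "x \<in> carrier L" for x
        using False u_le[OF _ that] below[OF _ that] by (meson all_not_in_conv order_trans)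
      ultimately have "cut u \<in> A" by (rule cut_A)
      moreover have "P p (cut u)" if "p \<in> C" for p
        using u_le[OF that] by (simp add: P_def cut_def)
      ultimately show ?thesis by blast
    qed
  qed
  then obtain m where "m \<in> A" and minimal: "\<And>p. p \<in> A \<Longrightarrow> P m p \<Longrightarrow> p = m" by blast
  then have m: "sublinear m" and m_le: "\<And>x. x \<in> carrier L \<Longrightarrow> m x \<le> q x" by (auto simp: A_def)
  have add: "m (x \<oplus> z) = m x + m z" if x: "x \<in> carrier L" and z: "z \<in> carrier L" for x z
  proof (rule antisym)
    have low: "lowered m z y \<le> m y" if "y \<in> carrier L" for y
      using lowered_le[OF m that z, of 0] that z by simp
    have "cut (lowered m z) \<in> A"
      using low m_le by (intro cut_A sublinear_lowered m z) (meson order_trans)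
    then have "cut (lowered m z) = m"
      using low by (intro minimal) (simp_all add: P_def cut_def)
    then have "lowered m z x = m x"
      using x by (metis cut_def)
    then show "m x + m z \<le> m (x \<oplus> z)"
      using lowered_le[OF m x z, of 1] z by simp
    show "m (x \<oplus> z) \<le> m x + m z" by (rule sublinear_add[OF m x z])
  qed
  have "m (r \<odot> x) = r * m x" if x: "x \<in> carrier L" for x r
  proof (cases "0 \<le> r")
    case False
    have "r \<odot> x \<oplus> (-r) \<odot> x = \<zero>"
      using x scale_add_left[of x r "-r"] by simp
    then have "m (r \<odot> x) + m ((-r) \<odot> x) = 0"
      using add[of "r \<odot> x" "(-r) \<odot> x"] x sublinear_zero[OF m] by simp
    then show ?thesis using sublinear_scale[OF m x, of "-r"] False by simp
  qed (rule sublinear_scale[OF m x])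
  with add m_le that show thesis by blast
qed

lemma hahn_banach:
  assumes q: "sublinear q" and z: "z \<in> carrier L"
  obtains f where "\<And>x y. x \<in> carrier L \<Longrightarrow> y \<in> carrier L \<Longrightarrow> f (x \<oplus> y) = f x + f y"
    "\<And>x r. x \<in> carrier L \<Longrightarrow> f (r \<odot> x) = r * f x" "\<And>x. x \<in> carrier L \<Longrightarrow> f x \<le> q x"
    "q z \<le> f z"
proof -
  obtain f where f: "\<And>x y. x \<in> carrier L \<Longrightarrow> y \<in> carrier L \<Longrightarrow> f (x \<oplus> y) = f x + f y"
      "\<And>x r. x \<in> carrier L \<Longrightarrow> f (r \<odot> x) = r * f x"
      "\<And>x. x \<in> carrier L \<Longrightarrow> f x \<le> lowered q z x"
    using linear_below_sublinear[OF sublinear_lowered[OF q z]] by blast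
  have "f x \<le> q x" if "x \<in> carrier L" for x
    using f(3)[OF that] lowered_le[OF q that z, of 0] that z by simp
  moreover have "q z \<le> f z"
    using f(3)[of "(-1) \<odot> z"] lowered_le[OF q, of "(-1) \<odot> z" z 1] f(2)[OF z, of "-1"] z
      sublinear_zero[OF q] by simp
  ultimately show thesis using that f(1,2) by blast
qed

end

section \<open>Positive functionals\<close>

definition positive_functional :: "('a, 'b) vector_lattice_scheme \<Rightarrow> ('a \<Rightarrow> real) \<Rightarrow> bool" where
  "positive_functional E f \<longleftrightarrow>
     (\<forall>x\<in>carrier E. \<forall>y\<in>carrier E. f (vadd E x y) = f x + f y) \<and>
     (\<forall>x\<in>carrier E. \<forall>r. f (vscale E r x) = r * f x) \<and> (\<forall>x\<in>pos_cone E. 0 \<le> f x)"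

context vector_lattice
begin

lemma functional_add:
  "positive_functional L f \<Longrightarrow> x \<in> carrier L \<Longrightarrow> y \<in> carrier L \<Longrightarrow> f (x \<oplus> y) = f x + f y"
  by (simp add: positive_functional_def)

lemma functional_scale: "positive_functional L f \<Longrightarrow> x \<in> carrier L \<Longrightarrow> f (r \<odot> x) = r * f x"
  by (simp add: positive_functional_def)

lemma functional_nonneg: "positive_functional L f \<Longrightarrow> x \<in> carrier L \<Longrightarrow> \<zero> \<sqsubseteq> x \<Longrightarrow> 0 \<le> f x"
  by (simp add: positive_functional_def pos_cone_def)

lemma functional_zero: "positive_functional L f \<Longrightarrow> f \<zero> = 0"
  using functional_scale[of f \<zero> 0] by simp

lemma functional_diff:
  "positive_functional L f \<Longrightarrow> x \<in> carrier L \<Longrightarrow> y \<in> carrier L \<Longrightarrow> f (x \<ominus> y) = f x - f y"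
  by (simp add: vdiff_def functional_add functional_scale)

lemma functional_mono:
  "positive_functional L f \<Longrightarrow> x \<in> carrier L \<Longrightarrow> y \<in> carrier L \<Longrightarrow> x \<sqsubseteq> y \<Longrightarrow> f x \<le> f y"
  using functional_nonneg[of f "y \<ominus> x"] by (simp add: diff_nonneg_iff functional_diff)

lemma functional_abs:
  assumes "positive_functional L f" "x \<in> carrier L"
  shows "\<bar>f x\<bar> \<le> f (vabs L x)"
  using assms functional_mono[OF assms(1) _ _ le_abs, of x]
    functional_mono[OF assms(1) _ _ neg_le_abs, of x] functional_scale[OF assms, of "-1"] by auto

lemma functional_eq_by_pos:
  assumes "positive_functional L f" "positive_functional L g" "x \<in> carrier L"
    and eq: "\<And>p. p \<in> carrier L \<Longrightarrow> \<zero> \<sqsubseteq> p \<Longrightarrow> f p = g p"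
  shows "f x = g x"
proof -
  obtain p n where "p \<in> carrier L" "n \<in> carrier L" "\<zero> \<sqsubseteq> p" "\<zero> \<sqsubseteq> n" "x = p \<ominus> n"
    by (rule pos_neg_parts[OF assms(3)])
  then show ?thesis using assms(1,2) eq by (simp add: functional_diff)
qed

end

lemma (in lattice_ideal) positive_functional_restrict:
  assumes "positive_functional L f"
  shows "positive_functional E f"
proof -
  have "x \<in> pos_cone L" if "x \<in> pos_cone E" for x
    using that unfolding ideal_pos_cone by (simp add: pos_cone_def)
  then show ?thesis
    using assms unfolding positive_functional_def by (simp add: ideal_add ideal_scale)
qed

text \<open>The dual norm: for a positive functional the positive part of the unit ball gives the same
  supremum as the whole ball, because \<open>\<bar>f x\<bar> \<le> f \<bar>x\<bar>\<close>.\<close>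

definition functional_norm :: "('a, 'b) normed_lattice_scheme \<Rightarrow> ('a \<Rightarrow> real) \<Rightarrow> real" where
  "functional_norm E f = Sup {f x | x. x \<in> pos_cone E \<and> vnorm E x \<le> 1}"

definition bounded_functional :: "('a, 'b) normed_lattice_scheme \<Rightarrow> ('a \<Rightarrow> real) \<Rightarrow> bool" where
  "bounded_functional E f \<longleftrightarrow> (\<exists>c. \<forall>x\<in>pos_cone E. f x \<le> c * vnorm E x)"

context banach_ideal
begin

context
  fixes f
  assumes f: "positive_functional E f" and b: "bounded_functional E f"
begin

interpretation VE: vector_lattice E
  using banach by (simp add: banach_lattice_def)

lemma unit_values_bdd: "bdd_above {f x | x. x \<in> pos_cone E \<and> vnorm E x \<le> 1}"
proof -
  obtain c where c: "\<And>x. x \<in> pos_cone E \<Longrightarrow> f x \<le> c * vnorm E x"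
    using b by (auto simp: bounded_functional_def)
  have "f x \<le> \<bar>c\<bar>" if "x \<in> pos_cone E" "vnorm E x \<le> 1" for x
  proof -
    have n: "0 \<le> vnorm E x" using that norm_nonneg by (simp add: pos_cone_def)
    have "c * vnorm E x \<le> \<bar>c\<bar> * 1" using n that by (intro mult_mono) auto
    then show ?thesis using c[OF that(1)] by simp
  qed
  then show ?thesis by (intro bdd_aboveI) blast
qed

lemma zero_pos_cone: "\<zero> \<in> pos_cone E" "f \<zero> = 0"
  using VE.functional_zero[OF f] by (simp_all add: ideal_pos_cone ideal_zero)

lemma functional_norm_nonneg: "0 \<le> functional_norm E f"
  unfolding functional_norm_def
  using zero_pos_cone by (intro cSup_upper unit_values_bdd CollectI exI[of _ \<zero>]) simp

lemma functional_norm_least: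
  assumes "0 \<le> c" "\<And>x. x \<in> carrier E \<Longrightarrow> \<zero> \<sqsubseteq> x \<Longrightarrow> f x \<le> c * vnorm E x"
  shows "functional_norm E f \<le> c"
  unfolding functional_norm_def
proof (rule cSup_least)
  show "{f x | x. x \<in> pos_cone E \<and> vnorm E x \<le> 1} \<noteq> {}"
    using zero_pos_cone by (auto intro!: exI[of _ \<zero>])
  fix v assume "v \<in> {f x | x. x \<in> pos_cone E \<and> vnorm E x \<le> 1}"
  then obtain x where x: "v = f x" "x \<in> carrier E" "\<zero> \<sqsubseteq> x" "vnorm E x \<le> 1"
    by (auto simp: ideal_pos_cone)
  have "c * vnorm E x \<le> c * 1" using x assms(1) by (intro mult_left_mono) auto
  then show "v \<le> c" using assms(2)[OF x(2,3)] x(1) by simp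
qed

lemma functional_le_norm:
  assumes x: "x \<in> carrier E" "\<zero> \<sqsubseteq> x"
  shows "f x \<le> functional_norm E f * vnorm E x"
proof (cases "x = \<zero>")
  case False
  let ?n = "vnorm E x"
  have n: "0 < ?n" using norm_pos x False by simp
  let ?u = "(1 / ?n) \<odot> x"
  have "?u \<in> pos_cone E" "vnorm E ?u \<le> 1"
    using x n by (simp_all add: ideal_pos_cone scale_nonneg norm_scale)
  then have "f ?u \<le> functional_norm E f"
    unfolding functional_norm_def by (intro cSup_upper unit_values_bdd) blast
  moreover have "f ?u = f x / ?n"
    using VE.functional_scale[OF f x(1), of "1 / ?n"] x by (simp add: ideal_scale)
  ultimately show ?thesis using n by (simp add: field_simps)
qed (simp add: zero_pos_cone)

lemma functional_abs_le_norm: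
  assumes "x \<in> carrier E"
  shows "\<bar>f x\<bar> \<le> functional_norm E f * vnorm E x"
  using VE.functional_abs[OF f assms] functional_le_norm[of "vabs L x"] assms
  by (simp add: ideal_abs norm_abs)

lemma functional_norm_zero_iff:
  "functional_norm E f = 0 \<longleftrightarrow> (\<forall>x\<in>carrier E. f x = 0)"
proof
  assume "functional_norm E f = 0"
  then show "\<forall>x\<in>carrier E. f x = 0" using functional_abs_le_norm by fastforce
next
  assume "\<forall>x\<in>carrier E. f x = 0"
  then show "functional_norm E f = 0"
    using functional_norm_least[of 0] functional_norm_nonneg by simp
qed

lemma op_norm_rank_one:
  assumes a: "a \<in> carrier E"
  shows "op_norm E (\<lambda>x. f x \<odot> a) = functional_norm E f * vnorm E a"
proof (rule antisym)
  let ?V = "{vnorm E (f x \<odot> a) | x. x \<in> carrier E \<and> vnorm E x \<le> 1}"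
  have val: "vnorm E (f x \<odot> a) = \<bar>f x\<bar> * vnorm E a" for x
    using a by (simp add: norm_scale)
  have na: "0 \<le> vnorm E a" using a by (simp add: norm_nonneg)
  have upper: "v \<le> functional_norm E f * vnorm E a" if "v \<in> ?V" for v
  proof -
    obtain x where x: "x \<in> carrier E" "vnorm E x \<le> 1" "v = \<bar>f x\<bar> * vnorm E a"
      using \<open>v \<in> ?V\<close> val by auto
    have "functional_norm E f * vnorm E x \<le> functional_norm E f * 1"
      using x functional_norm_nonneg by (intro mult_left_mono) auto
    then have "\<bar>f x\<bar> \<le> functional_norm E f"
      using functional_abs_le_norm[OF x(1)] by linarith
    then show ?thesis using x na by (simp add: mult_right_mono)
  qed
  have ne: "?V \<noteq> {}" by (auto intro!: exI[of _ \<zero>])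
  show "op_norm E (\<lambda>x. f x \<odot> a) \<le> functional_norm E f * vnorm E a"
    unfolding op_norm_def by (rule cSup_least[OF ne upper])
  show "functional_norm E f * vnorm E a \<le> op_norm E (\<lambda>x. f x \<odot> a)"
  proof (cases "vnorm E a = 0")
    case True
    have "vnorm E (f \<zero> \<odot> a) \<le> op_norm E (\<lambda>x. f x \<odot> a)"
      unfolding op_norm_def using upper
      by (intro cSup_upper bdd_aboveI CollectI exI[of _ \<zero>]) auto
    then show ?thesis using True val by simp
  next
    case False
    then have pos: "0 < vnorm E a" using na by simp
    let ?o = "op_norm E (\<lambda>x. f x \<odot> a)"
    have o: "\<bar>f x\<bar> * vnorm E a \<le> ?o" if "x \<in> carrier E" "vnorm E x \<le> 1" for x
      unfolding op_norm_def val[symmetric] using upper that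
      by (intro cSup_upper bdd_aboveI) blast+
    have "functional_norm E f \<le> ?o / vnorm E a"
      unfolding functional_norm_def
    proof (rule cSup_least)
      show "{f x | x. x \<in> pos_cone E \<and> vnorm E x \<le> 1} \<noteq> {}"
        using zero_pos_cone by (auto intro!: exI[of _ \<zero>])
      fix v assume "v \<in> {f x | x. x \<in> pos_cone E \<and> vnorm E x \<le> 1}"
      then obtain x where x: "v = f x" "x \<in> carrier E" "vnorm E x \<le> 1"
        by (auto simp: ideal_pos_cone)
      have "f x * vnorm E a \<le> \<bar>f x\<bar> * vnorm E a" using na by (intro mult_right_mono) auto
      then have "f x * vnorm E a \<le> ?o" using o[OF x(2,3)] by (rule order_trans)
      then show "v \<le> ?o / vnorm E a" using x(1) pos by (simp add: pos_le_divide_eq)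
    qed
    then show ?thesis using pos by (simp add: field_simps)
  qed
qed

end

end

section \<open>Couples of Banach ideals\<close>

text \<open>An abstract sum \<open>L\<close> of two Banach ideals. The assumption \<open>null\<close> says that the seminorm of
  the sum is a norm; it is the form in which compatibility of the two norms is used.\<close>

locale banach_couple = vector_lattice L + X: banach_ideal L X + Y: banach_ideal L Y
  for L (structure) and X Y +
  assumes decomposition: "z \<in> carrier L \<Longrightarrow> \<exists>x\<in>carrier X. \<exists>y\<in>carrier Y. z = x \<oplus> y"
    and null: "z \<in> carrier L \<Longrightarrow>
      (\<And>e. 0 < e \<Longrightarrow> \<exists>x\<in>carrier X. \<exists>y\<in>carrier Y. z = x \<oplus> y \<and> vnorm X x + vnorm Y y < e) \<Longrightarrow> z = \<zero>"
begin

lemma couple_swap: "banach_couple L Y X"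
proof
  show "\<exists>x\<in>carrier Y. \<exists>y\<in>carrier X. z = x \<oplus> y" if z: "z \<in> carrier L" for z
  proof -
    from decomposition[OF z] obtain x y where xy: "x \<in> carrier X" "y \<in> carrier Y" "z = x \<oplus> y" by blast
    then have "z = y \<oplus> x" using add_comm[of x y] by simp
    with xy show ?thesis by blast
  qed
  show "z = \<zero>" if z: "z \<in> carrier L"
    and e: "\<And>e. 0 < e \<Longrightarrow> \<exists>x\<in>carrier Y. \<exists>y\<in>carrier X. z = x \<oplus> y \<and> vnorm Y x + vnorm X y < e" for z
  proof (rule null[OF z])
    fix e :: real assume "0 < e"
    from e[OF this] obtain x y
      where xy: "x \<in> carrier X" "y \<in> carrier Y" "z = y \<oplus> x" "vnorm Y y + vnorm X x < e" by blast
    then have "z = x \<oplus> y" "vnorm X x + vnorm Y y < e" using add_comm[of y x] by simp_all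
    with xy(1,2) show "\<exists>x\<in>carrier X. \<exists>y\<in>carrier Y. z = x \<oplus> y \<and> vnorm X x + vnorm Y y < e" by blast
  qed
qed

lemma positive_decomposition:
  assumes z: "z \<in> carrier L" "\<zero> \<sqsubseteq> z"
  obtains x y where "x \<in> carrier X" "y \<in> carrier Y" "\<zero> \<sqsubseteq> x" "\<zero> \<sqsubseteq> y" "z = x \<oplus> y"
proof -
  obtain x y where xy: "x \<in> carrier X" "y \<in> carrier Y" "z = x \<oplus> y"
    using decomposition[OF z(1)] by blast
  have le: "z \<sqsubseteq> vabs L x \<oplus> vabs L y"
    using xy by (simp add: add_mono_both le_abs)
  obtain x' y' where "x' \<in> carrier L" "y' \<in> carrier L" "\<zero> \<sqsubseteq> x'" "x' \<sqsubseteq> vabs L x"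
      "\<zero> \<sqsubseteq> y'" "y' \<sqsubseteq> vabs L y" "z = x' \<oplus> y'"
    by (rule riesz_decomposition[OF _ _ z(1) _ _ z(2) le]) (use xy in simp_all)
  then show thesis
    using that[of x' y'] X.ideal_between[of "vabs L x" x'] Y.ideal_between[of "vabs L y" y'] xy
    by simp
qed

text \<open>Hahn--Banach for the sublinear functional
  \<open>q z = inf {\<parallel>x\<parallel> + r * \<parallel>y\<parallel> : z \<sqsubseteq> x \<oplus> y}\<close> with positive \<open>x\<close> and \<open>y\<close>: since \<open>q\<close> is at most 0
  on negative elements, every linear functional below it is positive, and by Riesz decomposition
  only the splittings of \<open>z\<^sub>0\<close> itself matter for the value at a positive \<open>z\<^sub>0\<close>. For \<open>r = 0\<close>
  the functional annihilates \<open>Y\<close>.\<close>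

lemma norming_functional:
  assumes z: "z0 \<in> carrier L" "\<zero> \<sqsubseteq> z0" and r: "0 \<le> r"
    and m: "\<And>x y. x \<in> carrier X \<Longrightarrow> y \<in> carrier Y \<Longrightarrow> \<zero> \<sqsubseteq> x \<Longrightarrow> \<zero> \<sqsubseteq> y \<Longrightarrow> z0 = x \<oplus> y \<Longrightarrow>
      m \<le> vnorm X x + r * vnorm Y y"
  shows "\<exists>f. positive_functional L f \<and> (\<forall>x\<in>carrier X. \<zero> \<sqsubseteq> x \<longrightarrow> f x \<le> vnorm X x) \<and>
    (\<forall>y\<in>carrier Y. \<zero> \<sqsubseteq> y \<longrightarrow> f y \<le> r * vnorm Y y) \<and> m \<le> f z0"
proof -
  define Q where "Q z = {vnorm X x + r * vnorm Y y | x y.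
    x \<in> carrier X \<and> y \<in> carrier Y \<and> \<zero> \<sqsubseteq> x \<and> \<zero> \<sqsubseteq> y \<and> z \<sqsubseteq> x \<oplus> y}" for z
  define q where "q z = Inf (Q z)" for z
  have Q_pos: "0 \<le> v" if "v \<in> Q z" for v z
    using that r X.norm_nonneg Y.norm_nonneg by (auto simp: Q_def)
  have q_le: "q z \<le> vnorm X x + r * vnorm Y y"
    if "x \<in> carrier X" "y \<in> carrier Y" "\<zero> \<sqsubseteq> x" "\<zero> \<sqsubseteq> y" "z \<sqsubseteq> x \<oplus> y" for z x y
    unfolding q_def using that Q_pos by (intro cInf_lower bdd_belowI[of _ 0]) (auto simp: Q_def)
  have Q_ne: "Q z \<noteq> {}" if z: "z \<in> carrier L" for z
  proof -
    from z have az: "vabs L z \<in> carrier L" "\<zero> \<sqsubseteq> vabs L z" by simp_all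
    obtain x y where xy: "x \<in> carrier X" "y \<in> carrier Y" "\<zero> \<sqsubseteq> x" "\<zero> \<sqsubseteq> y" "vabs L z = x \<oplus> y"
      by (rule positive_decomposition[OF az])
    moreover have "z \<sqsubseteq> x \<oplus> y" using le_abs[OF z] xy by simp
    ultimately show ?thesis by (auto simp: Q_def)
  qed
  have le_q: "c \<le> q z" if "z \<in> carrier L"
    "\<And>x y. x \<in> carrier X \<Longrightarrow> y \<in> carrier Y \<Longrightarrow> \<zero> \<sqsubseteq> x \<Longrightarrow> \<zero> \<sqsubseteq> y \<Longrightarrow> z \<sqsubseteq> x \<oplus> y \<Longrightarrow>
      c \<le> vnorm X x + r * vnorm Y y" for c z
    unfolding q_def using that Q_ne by (intro cInf_greatest) (auto simp: Q_def)
  have q_X: "q x \<le> vnorm X x" if "x \<in> carrier X" "\<zero> \<sqsubseteq> x" for x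
    using q_le[of x \<zero> x] that by simp
  have q_Y: "q y \<le> r * vnorm Y y" if "y \<in> carrier Y" "\<zero> \<sqsubseteq> y" for y
    using q_le[of \<zero> y y] that by simp
  have q_neg: "q z \<le> 0" if "z \<in> carrier L" "z \<sqsubseteq> \<zero>" for z
    using q_le[of \<zero> \<zero> z] that by simp
  have "sublinear q"
  proof (rule sublinearI)
    fix z w assume z: "z \<in> carrier L" and w: "w \<in> carrier L"
    have *: "q (z \<oplus> w) \<le> (vnorm X x + r * vnorm Y y) + (vnorm X x' + r * vnorm Y y')"
      if xy: "x \<in> carrier X" "y \<in> carrier Y" "\<zero> \<sqsubseteq> x" "\<zero> \<sqsubseteq> y" "z \<sqsubseteq> x \<oplus> y"
        "x' \<in> carrier X" "y' \<in> carrier Y" "\<zero> \<sqsubseteq> x'" "\<zero> \<sqsubseteq> y'" "w \<sqsubseteq> x' \<oplus> y'" for x y x' y'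
    proof -
      have "z \<oplus> w \<sqsubseteq> (x \<oplus> y) \<oplus> (x' \<oplus> y')" using xy z w by (simp add: add_mono_both)
      also have "(x \<oplus> y) \<oplus> (x' \<oplus> y') = (x \<oplus> x') \<oplus> (y \<oplus> y')" using xy by (simp add: add_swap)
      finally have "q (z \<oplus> w) \<le> vnorm X (x \<oplus> x') + r * vnorm Y (y \<oplus> y')"
        using xy by (intro q_le) (simp_all add: add_nonneg)
      also have "\<dots> \<le> (vnorm X x + vnorm X x') + r * (vnorm Y y + vnorm Y y')"
        using xy r by (intro Groups.add_mono X.norm_add mult_left_mono Y.norm_add)
      finally show ?thesis by (simp add: distrib_left)
    qed
    have "q (z \<oplus> w) - (vnorm X x + r * vnorm Y y) \<le> q w"
      if "x \<in> carrier X" "y \<in> carrier Y" "\<zero> \<sqsubseteq> x" "\<zero> \<sqsubseteq> y" "z \<sqsubseteq> x \<oplus> y" for x y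
    proof (rule le_q[OF w])
      fix x' y' assume "x' \<in> carrier X" "y' \<in> carrier Y" "\<zero> \<sqsubseteq> x'" "\<zero> \<sqsubseteq> y'" "w \<sqsubseteq> x' \<oplus> y'"
      from *[OF that this]
      show "q (z \<oplus> w) - (vnorm X x + r * vnorm Y y) \<le> vnorm X x' + r * vnorm Y y'" by linarith
    qed
    then have "q (z \<oplus> w) - q w \<le> vnorm X x + r * vnorm Y y"
      if "x \<in> carrier X" "y \<in> carrier Y" "\<zero> \<sqsubseteq> x" "\<zero> \<sqsubseteq> y" "z \<sqsubseteq> x \<oplus> y" for x y
      using that by (smt (verit))
    then have "q (z \<oplus> w) - q w \<le> q z" by (rule le_q[OF z])
    then show "q (z \<oplus> w) \<le> q z + q w" by simp
  next
    fix z and s :: real assume z: "z \<in> carrier L" and s: "0 < s"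
    have "q (s \<odot> z) / s \<le> q z"
    proof (rule le_q[OF z])
      fix x y assume xy: "x \<in> carrier X" "y \<in> carrier Y" "\<zero> \<sqsubseteq> x" "\<zero> \<sqsubseteq> y" "z \<sqsubseteq> x \<oplus> y"
      have "s \<odot> z \<sqsubseteq> s \<odot> x \<oplus> s \<odot> y"
        using scale_mono[of z "x \<oplus> y" s] xy z s by (simp add: scale_add_right)
      then have "q (s \<odot> z) \<le> vnorm X (s \<odot> x) + r * vnorm Y (s \<odot> y)"
        using xy s by (intro q_le) (simp_all add: scale_nonneg)
      then show "q (s \<odot> z) / s \<le> vnorm X x + r * vnorm Y y"
        using xy s by (simp add: X.norm_scale Y.norm_scale field_simps)
    qed
    then show "q (s \<odot> z) \<le> s * q z" using s by (simp add: field_simps)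
  next
    show "q \<zero> = 0"
      using q_neg[of \<zero>] le_q[of \<zero> 0] r X.norm_nonneg Y.norm_nonneg by force
  qed
  then obtain f where f: "\<And>x y. x \<in> carrier L \<Longrightarrow> y \<in> carrier L \<Longrightarrow> f (x \<oplus> y) = f x + f y"
    "\<And>x r. x \<in> carrier L \<Longrightarrow> f (r \<odot> x) = r * f x" "\<And>x. x \<in> carrier L \<Longrightarrow> f x \<le> q x"
    "q z0 \<le> f z0"
    using hahn_banach[OF _ z(1), of q] by blast
  have "0 \<le> f x" if x: "x \<in> carrier L" "\<zero> \<sqsubseteq> x" for x
  proof -
    have "(-1) \<odot> x \<sqsubseteq> \<zero>" using neg_le_neg[of \<zero> x] x by simp
    then show ?thesis using f(3)[of "(-1) \<odot> x"] q_neg[of "(-1) \<odot> x"] f(2)[OF x(1), of "-1"] x by simp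
  qed
  then have pf: "positive_functional L f"
    using f by (simp add: positive_functional_def pos_cone_def)
  have "m \<le> q z0"
  proof (rule le_q[OF z(1)])
    fix x y assume xy: "x \<in> carrier X" "y \<in> carrier Y" "\<zero> \<sqsubseteq> x" "\<zero> \<sqsubseteq> y" "z0 \<sqsubseteq> x \<oplus> y"
    obtain x' y' where xy': "x' \<in> carrier L" "y' \<in> carrier L" "\<zero> \<sqsubseteq> x'" "x' \<sqsubseteq> x"
        "\<zero> \<sqsubseteq> y'" "y' \<sqsubseteq> y" "z0 = x' \<oplus> y'"
      by (rule riesz_decomposition[OF _ _ z(1) xy(3,4) z(2) xy(5)]) (use xy in simp_all)
    note X' = X.norm_mono[OF xy(1) xy'(1,3,4)] and Y' = Y.norm_mono[OF xy(2) xy'(2,5,6)]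
    have "m \<le> vnorm X x' + r * vnorm Y y'" using m X'(1) Y'(1) xy' by blast
    also have "\<dots> \<le> vnorm X x + r * vnorm Y y"
      using X'(2) Y'(2) r by (intro Groups.add_mono mult_left_mono)
    finally show "m \<le> vnorm X x + r * vnorm Y y" .
  qed
  then have "m \<le> f z0" using f(4) by simp
  moreover have "f x \<le> vnorm X x" if "x \<in> carrier X" "\<zero> \<sqsubseteq> x" for x
    using f(3)[of x] q_X[OF that] that by simp
  moreover have "f y \<le> r * vnorm Y y" if "y \<in> carrier Y" "\<zero> \<sqsubseteq> y" for y
    using f(3)[of y] q_Y[OF that] that by simp
  ultimately show ?thesis using pf by (intro exI[of _ f]) simp
qed

definition couple_functional :: "('a \<Rightarrow> real) \<Rightarrow> bool" where
  "couple_functional f \<longleftrightarrow>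
     positive_functional L f \<and> bounded_functional X f \<and> bounded_functional Y f"

lemma couple_functional_X:
  "couple_functional f \<Longrightarrow> positive_functional X f" "couple_functional f \<Longrightarrow> bounded_functional X f"
  using X.positive_functional_restrict by (auto simp: couple_functional_def)

lemma couple_functional_Y:
  "couple_functional f \<Longrightarrow> positive_functional Y f" "couple_functional f \<Longrightarrow> bounded_functional Y f"
  using Y.positive_functional_restrict by (auto simp: couple_functional_def)

lemma couple_functionalI:
  assumes "positive_functional L f" "\<And>x. x \<in> carrier X \<Longrightarrow> \<zero> \<sqsubseteq> x \<Longrightarrow> f x \<le> c * vnorm X x"
    "\<And>y. y \<in> carrier Y \<Longrightarrow> \<zero> \<sqsubseteq> y \<Longrightarrow> f y \<le> d * vnorm Y y"
  shows "couple_functional f"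
  unfolding couple_functional_def bounded_functional_def
proof (intro conjI exI ballI)
  show "f x \<le> c * vnorm X x" if "x \<in> pos_cone X" for x
    using that assms(2) unfolding X.ideal_pos_cone by simp
  show "f y \<le> d * vnorm Y y" if "y \<in> pos_cone Y" for y
    using that assms(3) unfolding Y.ideal_pos_cone by simp
qed (rule assms(1))

text \<open>A functional on \<open>X\<close> and one on \<open>Y\<close> that agree on the intersection are the restrictions
  of one functional, because two splittings of the same element differ by an element of the
  intersection.\<close>

lemma glue_functionals:
  assumes g: "positive_functional X g" and h: "positive_functional Y h"
    and agree: "\<And>x. x \<in> carrier X \<Longrightarrow> x \<in> carrier Y \<Longrightarrow> g x = h x"
  shows "\<exists>f. positive_functional L f \<and> (\<forall>x\<in>carrier X. f x = g x) \<and> (\<forall>y\<in>carrier Y. f y = h y)"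
proof -
  interpret VX: vector_lattice X using X.banach by (simp add: banach_lattice_def)
  interpret VY: vector_lattice Y using Y.banach by (simp add: banach_lattice_def)
  define P where "P z p \<longleftrightarrow> fst p \<in> carrier X \<and> snd p \<in> carrier Y \<and> z = fst p \<oplus> snd p" for z p
  define f where "f z = (let p = SOME p. P z p in g (fst p) + h (snd p))" for z
  have f_eq: "f (x \<oplus> y) = g x + h y" if x: "x \<in> carrier X" and y: "y \<in> carrier Y" for x y
  proof -
    define p where "p = (SOME p. P (x \<oplus> y) p)"
    have "P (x \<oplus> y) (x, y)" using x y by (simp add: P_def)
    then have "P (x \<oplus> y) p" unfolding p_def by (rule someI)
    then obtain x' y' where p: "p = (x', y')" "x' \<in> carrier X" "y' \<in> carrier Y" "x \<oplus> y = x' \<oplus> y'"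
      by (cases p) (auto simp: P_def)
    have d: "x \<ominus> x' = y' \<ominus> y"
    proof -
      have "(x \<ominus> x') \<oplus> (y \<oplus> x') = x \<oplus> y"
        using x y p add_comm[of y x'] add_assoc[of "x \<ominus> x'" x' y] by simp
      moreover have "(y' \<ominus> y) \<oplus> (y \<oplus> x') = x' \<oplus> y'"
        using x y p add_comm[of y' x'] add_assoc[of "y' \<ominus> y" y x'] by simp
      ultimately have "(x \<ominus> x') \<oplus> (y \<oplus> x') = (y' \<ominus> y) \<oplus> (y \<oplus> x')" using p(4) by simp
      then show ?thesis
        using x y p add_cancel[of "y \<oplus> x'" "x \<ominus> x'" "y' \<ominus> y"]
          add_comm[of "x \<ominus> x'" "y \<oplus> x'"] add_comm[of "y' \<ominus> y" "y \<oplus> x'"] by simp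
    qed
    have "g x - g x' = g (x \<ominus> x')"
      using VX.functional_diff[OF g x p(2)] x p by (simp add: X.ideal_diff)
    also have "\<dots> = h (y' \<ominus> y)"
      using agree[of "x \<ominus> x'"] d X.ideal_diff_closed[OF x p(2)] Y.ideal_diff_closed[OF p(3) y] by simp
    also have "\<dots> = h y' - h y"
      using VY.functional_diff[OF h p(3) y] y p by (simp add: Y.ideal_diff)
    finally show ?thesis
      unfolding f_def Let_def p_def[symmetric] p(1) by simp
  qed
  have "positive_functional L f"
    unfolding positive_functional_def
  proof (intro conjI ballI allI)
    fix z w assume z: "z \<in> carrier L" and w: "w \<in> carrier L"
    obtain x y where xy: "x \<in> carrier X" "y \<in> carrier Y" "z = x \<oplus> y"
      using decomposition[OF z] by blast
    obtain x' y' where xy': "x' \<in> carrier X" "y' \<in> carrier Y" "w = x' \<oplus> y'"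
      using decomposition[OF w] by blast
    have "z \<oplus> w = (x \<oplus> x') \<oplus> (y \<oplus> y')" using xy xy' by (simp add: add_swap)
    then have "f (z \<oplus> w) = g (x \<oplus> x') + h (y \<oplus> y')" using xy xy' f_eq by simp
    then show "f (z \<oplus> w) = f z + f w"
      using VX.functional_add[OF g xy(1) xy'(1)] VY.functional_add[OF h xy(2) xy'(2)] xy xy'
        f_eq[OF xy(1,2)] f_eq[OF xy'(1,2)]
      by (simp add: X.ideal_add Y.ideal_add)
  next
    fix z s assume z: "z \<in> carrier L"
    obtain x y where xy: "x \<in> carrier X" "y \<in> carrier Y" "z = x \<oplus> y"
      using decomposition[OF z] by blast
    have "s \<odot> z = s \<odot> x \<oplus> s \<odot> y" using xy by (simp add: scale_add_right)
    then have "f (s \<odot> z) = g (s \<odot> x) + h (s \<odot> y)" using xy f_eq by simp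
    then show "f (s \<odot> z) = s * f z"
      using VX.functional_scale[OF g xy(1), of s] VY.functional_scale[OF h xy(2), of s] xy f_eq[OF xy(1,2)]
      by (simp add: X.ideal_scale Y.ideal_scale distrib_left)
  next
    fix z assume "z \<in> pos_cone L"
    then have z: "z \<in> carrier L" "\<zero> \<sqsubseteq> z" by (simp_all add: pos_cone_def)
    obtain x y where xy: "x \<in> carrier X" "y \<in> carrier Y" "\<zero> \<sqsubseteq> x" "\<zero> \<sqsubseteq> y" "z = x \<oplus> y"
      by (rule positive_decomposition[OF z])
    have "x \<in> pos_cone X" "y \<in> pos_cone Y"
      unfolding X.ideal_pos_cone Y.ideal_pos_cone using xy by simp_all
    then show "0 \<le> f z"
      using g h f_eq[OF xy(1,2)] xy(5) by (simp add: positive_functional_def)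
  qed
  moreover have "f x = g x" if "x \<in> carrier X" for x
    using f_eq[OF that Y.ideal_zero_closed] VY.functional_zero[OF h] that by (simp add: Y.ideal_zero)
  moreover have "f y = h y" if "y \<in> carrier Y" for y
    using f_eq[OF X.ideal_zero_closed that] VX.functional_zero[OF g] that by (simp add: X.ideal_zero)
  ultimately show ?thesis by (intro exI[of _ f]) simp
qed

end

section \<open>Comparing norms through rank-one operators\<close>

context banach_couple
begin

text \<open>By Hahn--Banach the hypothesis lets every \<open>y\<close> in the intersection be split as
  \<open>(y \<ominus> y') \<oplus> y'\<close> where the first part has \<open>X\<close>-norm at most about \<open>c * \<parallel>y\<parallel>\<^sub>Y\<close> and the remainder \<open>y'\<close>
  is a small multiple of \<open>y\<close> in the norm of \<open>Y\<close>. Iterating, the first parts form a series that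
  converges in \<open>X\<close> by completeness, and its sum is \<open>y\<close>, as the remainders tend to zero in \<open>Y\<close>.\<close>

lemma dual_norm_domination:
  assumes c: "0 \<le> c" "c < C"
    and dual: "\<And>f. couple_functional f \<Longrightarrow> functional_norm Y f \<le> c * functional_norm X f"
    and y: "y \<in> carrier X" "y \<in> carrier Y" "\<zero> \<sqsubseteq> y"
  shows "vnorm X y \<le> C * vnorm Y y"
proof -
  \<comment> \<open>With \<open>r * \<theta> = c'\<close> the remainder shrinks by \<open>\<theta>\<close>, and \<open>c' + C * \<theta> = C\<close> makes
    \<open>C * \<parallel>remainder\<parallel>\<close> a bound for everything still to come.\<close>
  define c' where "c' = (c + C) / 2"
  define \<theta> where "\<theta> = 1 - c' / C"
  define r where "r = c' / \<theta>"
  have c': "c < c'" "c' < C" "0 < c'" and C: "0 < C" using c by (auto simp: c'_def)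
  then have \<theta>: "0 < \<theta>" "\<theta> < 1" by (auto simp: \<theta>_def field_simps)
  then have r: "0 < r" "r * \<theta> = c'" using c' by (auto simp: r_def)
  have C\<theta>: "C * \<theta> = C - c'" using C by (simp add: \<theta>_def field_simps)
  define D where "D = {y. y \<in> carrier X \<and> y \<in> carrier Y \<and> \<zero> \<sqsubseteq> y}"
  have "\<exists>y'\<in>D. vnorm X (y \<ominus> y') + r * vnorm Y y' \<le> c' * vnorm Y y" if "y \<in> D" for y
  proof (rule ccontr)
    assume no: "\<not> (\<exists>y'\<in>D. vnorm X (y \<ominus> y') + r * vnorm Y y' \<le> c' * vnorm Y y)"
    have y: "y \<in> carrier X" "y \<in> carrier Y" "\<zero> \<sqsubseteq> y" using that by (auto simp: D_def)
    then have yL: "y \<in> carrier L" by simp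
    have *: "c' * vnorm Y y \<le> vnorm X x + r * vnorm Y y'"
      if xy: "x \<in> carrier X" "y' \<in> carrier Y" "\<zero> \<sqsubseteq> x" "\<zero> \<sqsubseteq> y'" "y = x \<oplus> y'" for x y'
    proof -
      have "y' \<sqsubseteq> y" using xy by (simp add: le_add_nonneg)
      then have "y' \<in> D" using X.ideal_between[OF y(1) _ xy(4)] xy by (simp add: D_def)
      then have "\<not> vnorm X (y \<ominus> y') + r * vnorm Y y' \<le> c' * vnorm Y y" using no by blast
      then show ?thesis using xy by simp
    qed
    obtain f where f: "positive_functional L f" "\<forall>x\<in>carrier X. \<zero> \<sqsubseteq> x \<longrightarrow> f x \<le> vnorm X x"
      "\<forall>y\<in>carrier Y. \<zero> \<sqsubseteq> y \<longrightarrow> f y \<le> r * vnorm Y y" "c' * vnorm Y y \<le> f y"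
      using norming_functional[OF yL y(3) less_imp_le[OF r(1)] *] by blast
    have cf: "couple_functional f"
      by (rule couple_functionalI[of f 1 r]) (use f in simp_all)
    have "functional_norm X f \<le> 1"
      using X.functional_norm_least[OF couple_functional_X[OF cf], of 1] f(2) by simp
    then have "c * functional_norm X f \<le> c * 1" using c(1) by (rule mult_left_mono)
    then have "functional_norm Y f \<le> c" using dual[OF cf] by simp
    then have "functional_norm Y f * vnorm Y y \<le> c * vnorm Y y"
      using Y.norm_nonneg[OF y(2)] by (rule mult_right_mono)
    then have "c' * vnorm Y y \<le> c * vnorm Y y"
      using Y.functional_le_norm[OF couple_functional_Y[OF cf] y(2,3)] f(4) by linarith
    then have "vnorm Y y = 0" using c' Y.norm_nonneg[OF y(2)] by (simp add: mult_le_cancel_right)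
    then have "y = \<zero>" using Y.norm_eq_zero[OF y(2)] by simp
    then have "vnorm X (y \<ominus> \<zero>) + r * vnorm Y \<zero> \<le> c' * vnorm Y y" by simp
    moreover have "\<zero> \<in> D" by (simp add: D_def)
    ultimately show False using no by blast
  qed
  then have "\<forall>y\<in>D. \<exists>y'. y' \<in> D \<and> vnorm X (y \<ominus> y') + r * vnorm Y y' \<le> c' * vnorm Y y" by blast
  from bchoice[OF this] obtain g
    where "\<forall>y\<in>D. g y \<in> D \<and> vnorm X (y \<ominus> g y) + r * vnorm Y (g y) \<le> c' * vnorm Y y" ..
  then have g: "\<And>y. y \<in> D \<Longrightarrow> g y \<in> D"
    "\<And>y. y \<in> D \<Longrightarrow> vnorm X (y \<ominus> g y) + r * vnorm Y (g y) \<le> c' * vnorm Y y" by simp_all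
  define s where "s n = (g ^^ n) y" for n
  have s_Suc: "s (Suc n) = g (s n)" and s_0: "s 0 = y" for n by (simp_all add: s_def)
  have sD: "s n \<in> D" for n
  proof (induction n)
    case 0
    then show ?case using y by (simp add: s_0 D_def)
  qed (simp add: s_Suc g(1))
  have s: "s n \<in> carrier X" "s n \<in> carrier Y" "s n \<in> carrier L" for n
    using sD[of n] by (simp_all add: D_def)
  have step: "vnorm X (s n \<ominus> s (Suc n)) + r * vnorm Y (s (Suc n)) \<le> c' * vnorm Y (s n)" for n
    using g(2)[OF sD] by (simp add: s_Suc)
  have shrink: "vnorm Y (s (Suc n)) \<le> \<theta> * vnorm Y (s n)" for n
  proof -
    have "0 \<le> vnorm X (s n \<ominus> s (Suc n))" using s by (simp add: X.norm_nonneg)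
    then have "r * vnorm Y (s (Suc n)) \<le> r * (\<theta> * vnorm Y (s n))"
      using step[of n] r(2) by (simp add: mult.assoc[symmetric])
    then show ?thesis using r(1) by simp
  qed
  have telescope: "vnorm X (s m \<ominus> s n) + C * vnorm Y (s n) \<le> C * vnorm Y (s m)" if "m \<le> n" for m n
    using that
  proof (induction n rule: dec_induct)
    case base
    then show ?case using s by simp
  next
    case (step n)
    have "s m \<ominus> s (Suc n) = (s m \<ominus> s n) \<oplus> (s n \<ominus> s (Suc n))" using s by (intro diff_trans)
    then have "vnorm X (s m \<ominus> s (Suc n)) \<le> vnorm X (s m \<ominus> s n) + vnorm X (s n \<ominus> s (Suc n))"
      using X.norm_add[of "s m \<ominus> s n" "s n \<ominus> s (Suc n)"] s by simp
    moreover have "vnorm X (s n \<ominus> s (Suc n)) \<le> c' * vnorm Y (s n)"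
      using \<open>\<And>n. vnorm X (s n \<ominus> s (Suc n)) + r * vnorm Y (s (Suc n)) \<le> c' * vnorm Y (s n)\<close>[of n]
        mult_nonneg_nonneg[OF less_imp_le[OF r(1)] Y.norm_nonneg[OF s(2)[of "Suc n"]]] by linarith
    moreover have "C * vnorm Y (s (Suc n)) \<le> (C - c') * vnorm Y (s n)"
      using mult_left_mono[OF shrink[of n], of C] C by (simp add: mult.assoc[symmetric] C\<theta>)
    ultimately show ?case using step.IH by (simp add: left_diff_distrib)
  qed
  have decay: "vnorm Y (s n) \<le> \<theta> ^ n * vnorm Y (s 0)" for n
  proof (induction n)
    case (Suc n)
    have "\<theta> * vnorm Y (s n) \<le> \<theta> * (\<theta> ^ n * vnorm Y (s 0))"
      using Suc \<theta> by (intro mult_left_mono) simp_all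
    then show ?case using shrink[of n] unfolding power_Suc mult.assoc by linarith
  qed simp
  have "(\<lambda>n. \<theta> ^ n) \<longlonglongrightarrow> 0"
    using \<theta> by (simp add: LIMSEQ_power_zero)
  from tendsto_mult[OF this tendsto_const[of "vnorm Y (s 0)"]]
  have lim0: "(\<lambda>n. \<theta> ^ n * vnorm Y (s 0)) \<longlonglongrightarrow> 0" by simp
  have Y0: "(\<lambda>n. vnorm Y (s n)) \<longlonglongrightarrow> 0"
    using always_eventually[OF allI[OF Y.norm_nonneg[OF s(2)]]] always_eventually[OF allI[OF decay]]
      tendsto_const lim0 by (rule tendsto_sandwich)
  have Cs: "vnorm X (s m \<ominus> s n) \<le> C * vnorm Y (s m)" if "m \<le> n" for m n
    using telescope[OF that] mult_nonneg_nonneg[OF less_imp_le[OF C] Y.norm_nonneg[OF s(2)[of n]]]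
    by linarith
  have "\<exists>l\<in>carrier X. (\<lambda>n. vnorm X (s n \<ominus> l)) \<longlonglongrightarrow> 0"
  proof (rule X.Cauchy_convergent[OF s(1)])
    fix e :: real assume "0 < e"
    then have "eventually (\<lambda>n. vnorm Y (s n) < e / C) sequentially"
      using Y0 C by (intro order_tendstoD(2)) auto
    then obtain N where N: "\<And>n. N \<le> n \<Longrightarrow> vnorm Y (s n) < e / C"
      by (auto simp: eventually_sequentially)
    have "vnorm X (s m \<ominus> s n) < e" if "N \<le> m" "m \<le> n" for m n
      using N[OF that(1)] Cs[OF that(2)] C by (simp add: field_simps)
    then show "\<exists>N. \<forall>m\<ge>N. \<forall>n\<ge>m. vnorm X (s m \<ominus> s n) < e" by blast
  qed
  then obtain l where l: "l \<in> carrier X" "(\<lambda>n. vnorm X (s n \<ominus> l)) \<longlonglongrightarrow> 0" by blast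
  have "l = \<zero>"
  proof (rule null)
    show "l \<in> carrier L" using l by simp
    fix e :: real assume "0 < e"
    have "(\<lambda>n. vnorm X (s n \<ominus> l) + vnorm Y (s n)) \<longlonglongrightarrow> 0"
      using tendsto_add[OF l(2) Y0] by simp
    then have "eventually (\<lambda>n. vnorm X (s n \<ominus> l) + vnorm Y (s n) < e) sequentially"
      using \<open>0 < e\<close> by (intro order_tendstoD(2)) auto
    then obtain n where "vnorm X (s n \<ominus> l) + vnorm Y (s n) < e"
      by (auto simp: eventually_sequentially)
    then have "vnorm X (l \<ominus> s n) + vnorm Y (s n) < e"
      using X.norm_diff_comm[OF l(1) s(1)] by simp
    moreover have "l = (l \<ominus> s n) \<oplus> s n" using l s by simp
    ultimately show "\<exists>x\<in>carrier X. \<exists>y\<in>carrier Y. l = x \<oplus> y \<and> vnorm X x + vnorm Y y < e"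
      using l s by (intro bexI[of _ "l \<ominus> s n"] bexI[of _ "s n"]) simp_all
  qed
  then have "(\<lambda>n. vnorm X (s n)) \<longlonglongrightarrow> 0"
    using X.norm_tendsto[OF s(1) l] by simp
  then have lim: "(\<lambda>n. C * vnorm Y y + vnorm X (s n)) \<longlonglongrightarrow> C * vnorm Y y + 0"
    by (intro tendsto_intros)
  have "vnorm X y \<le> C * vnorm Y y + vnorm X (s n)" for n
    using X.norm_le_diff[OF y(1) s(1), of n] Cs[of 0 n] by (simp add: s_0)
  then show ?thesis
    using LIMSEQ_le_const[OF lim, of "vnorm X y"] by simp
qed

end

text \<open>If some functional makes the \<open>X\<close>-term the larger one at \<open>a\<close>, the comparison for it gives
  \<open>\<parallel>b\<parallel>\<^sub>X \<le> k * \<parallel>a\<parallel>\<^sub>X\<close> at once; a little room, a factor \<open>s > 1\<close>, may even be lost. Otherwise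
  the \<open>Y\<close>-term is larger by the factor \<open>s\<close> for every functional, and duality turns this into
  \<open>\<parallel>a\<parallel>\<^sub>Y \<le> C * \<parallel>a\<parallel>\<^sub>X\<close> with some \<open>C < \<parallel>a\<parallel>\<^sub>Y / \<parallel>a\<parallel>\<^sub>X\<close>.\<close>

lemma (in banach_couple) rank_one_comparison_X:
  assumes a: "a \<in> carrier X" "a \<in> carrier Y" "\<zero> \<sqsubseteq> a" "a \<noteq> \<zero>"
    and b: "b \<in> carrier X" and k: "0 < k"
    and le: "\<And>f. couple_functional f \<Longrightarrow>
      max (functional_norm X f * vnorm X b) (functional_norm Y f * vnorm Y b)
        \<le> k * max (functional_norm X f * vnorm X a) (functional_norm Y f * vnorm Y a)"
  shows "vnorm X b \<le> k * vnorm X a"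
proof (rule ccontr)
  assume "\<not> vnorm X b \<le> k * vnorm X a"
  then have gt: "k * vnorm X a < vnorm X b" by simp
  have \<alpha>: "0 < vnorm X a" and \<beta>: "0 < vnorm Y a"
    using a X.norm_pos Y.norm_pos by simp_all
  have ka: "0 < k * vnorm X a" using k \<alpha> by simp
  have "1 < vnorm X b / (k * vnorm X a)" using gt ka by (simp add: pos_less_divide_eq)
  then obtain s where s: "1 < s" "s < vnorm X b / (k * vnorm X a)" using dense by blast
  then have sb: "s * (k * vnorm X a) < vnorm X b" using ka by (simp add: pos_less_divide_eq)
  interpret swap: banach_couple L Y X by (rule couple_swap)
  define c where "c = vnorm Y a / (s * vnorm X a)"
  have c: "0 \<le> c" using \<alpha> \<beta> s by (simp add: c_def)
  have "c < vnorm Y a / vnorm X a"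
    unfolding c_def using \<alpha> \<beta> s(1) by (intro divide_strict_left_mono) simp_all
  then obtain C where C: "c < C" "C < vnorm Y a / vnorm X a" using dense by blast
  have "functional_norm X f \<le> c * functional_norm Y f" if "swap.couple_functional f" for f
  proof (rule ccontr)
    assume no: "\<not> functional_norm X f \<le> c * functional_norm Y f"
    have f: "couple_functional f"
      using that by (simp add: couple_functional_def swap.couple_functional_def)
    have A: "0 \<le> functional_norm X f" and B: "0 \<le> functional_norm Y f"
      using X.functional_norm_nonneg[OF couple_functional_X[OF f]]
        Y.functional_norm_nonneg[OF couple_functional_Y[OF f]] by simp_all
    have "c * functional_norm Y f < functional_norm X f" using no by simp
    then have XY: "functional_norm Y f * vnorm Y a < functional_norm X f * (s * vnorm X a)"
      using \<alpha> s by (simp add: c_def field_simps)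
    have A': "0 < functional_norm X f"
      using no A B c mult_nonneg_nonneg[OF c B] by linarith
    have "functional_norm X f * vnorm X a \<le> functional_norm X f * (s * vnorm X a)"
      using A \<alpha> s by (intro mult_left_mono) simp_all
    then have "max (functional_norm X f * vnorm X a) (functional_norm Y f * vnorm Y a)
        \<le> functional_norm X f * (s * vnorm X a)" using XY by simp
    then have "k * max (functional_norm X f * vnorm X a) (functional_norm Y f * vnorm Y a)
        \<le> k * (functional_norm X f * (s * vnorm X a))" using k by (intro mult_left_mono) simp_all
    with le[OF f] have "functional_norm X f * vnorm X b \<le> functional_norm X f * (s * (k * vnorm X a))"
      by (simp add: algebra_simps)
    then show False using A' sb by simp
  qed
  then have "vnorm Y a \<le> C * vnorm X a"
    using swap.dual_norm_domination[OF c C(1) _ a(2,1,3)] by blast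
  then show False using C(2) \<alpha> by (simp add: pos_less_divide_eq)
qed

lemma (in banach_couple) rank_one_comparison:
  assumes a: "a \<in> carrier X" "a \<in> carrier Y" "\<zero> \<sqsubseteq> a" "a \<noteq> \<zero>"
    and b: "b \<in> carrier X" "b \<in> carrier Y" and k: "0 < k"
    and le: "\<And>f. couple_functional f \<Longrightarrow>
      max (functional_norm X f * vnorm X b) (functional_norm Y f * vnorm Y b)
        \<le> k * max (functional_norm X f * vnorm X a) (functional_norm Y f * vnorm Y a)"
  shows "vnorm X b \<le> k * vnorm X a" "vnorm Y b \<le> k * vnorm Y a"
proof -
  interpret swap: banach_couple L Y X by (rule couple_swap)
  show "vnorm X b \<le> k * vnorm X a"
    by (rule rank_one_comparison_X[OF a b(1) k le])
  show "vnorm Y b \<le> k * vnorm Y a"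
  proof (rule swap.rank_one_comparison_X[OF a(2,1,3,4) b(2) k])
    fix f assume "swap.couple_functional f"
    then have "couple_functional f"
      by (simp add: couple_functional_def swap.couple_functional_def)
    from le[OF this]
    show "max (functional_norm Y f * vnorm Y b) (functional_norm X f * vnorm X b)
        \<le> k * max (functional_norm Y f * vnorm Y a) (functional_norm X f * vnorm X a)"
      by (simp add: max.commute)
  qed
qed

text \<open>Taking \<open>k\<close> optimal, and exchanging \<open>a\<close> and \<open>b\<close>, the hypothesis says that the unordered
  pairs of quotients of the two norms agree; two quotients cannot be matched
  differently for different elements.\<close>

lemma norm_pairs_proportional_or_swapped:
  fixes n1 n2 m1 m2 :: "'a \<Rightarrow> real"
  assumes pos: "\<And>a. a \<in> D \<Longrightarrow> 0 < n1 a \<and> 0 < n2 a \<and> 0 < m1 a \<and> 0 < m2 a"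
    and iff: "\<And>a b k. a \<in> D \<Longrightarrow> b \<in> D \<Longrightarrow> 0 < k \<Longrightarrow>
      (n1 b \<le> k * n1 a \<and> n2 b \<le> k * n2 a) \<longleftrightarrow> (m1 b \<le> k * m1 a \<and> m2 b \<le> k * m2 a)"
  shows "\<exists>k>0. \<exists>l>0. (\<forall>a\<in>D. n1 a = k * m1 a \<and> n2 a = l * m2 a) \<or>
    (\<forall>a\<in>D. n1 a = k * m2 a \<and> n2 a = l * m1 a)"
proof (cases "D = {}")
  case True
  then show ?thesis by (intro exI[of _ "1::real"] conjI) simp_all
next
  case False
  then obtain a0 where a0: "a0 \<in> D" by blast
  have max: "max (n1 b / n1 a) (n2 b / n2 a) = max (m1 b / m1 a) (m2 b / m2 a)"
    if "a \<in> D" "b \<in> D" for a b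
  proof -
    have *: "max (n1 b / n1 a) (n2 b / n2 a) \<le> k \<longleftrightarrow> max (m1 b / m1 a) (m2 b / m2 a) \<le> k"
      if "0 < k" for k
      using iff[OF \<open>a \<in> D\<close> \<open>b \<in> D\<close> that] pos[OF \<open>a \<in> D\<close>] by (simp add: pos_divide_le_eq)
    have "0 < max (n1 b / n1 a) (n2 b / n2 a)" "0 < max (m1 b / m1 a) (m2 b / m2 a)"
      using pos[OF that(1)] pos[OF that(2)] by (auto simp: less_max_iff_disj)
    then show ?thesis using *[of "max (n1 b / n1 a) (n2 b / n2 a)"]
        *[of "max (m1 b / m1 a) (m2 b / m2 a)"] by linarith
  qed
  have min: "min (n1 b / n1 a) (n2 b / n2 a) = min (m1 b / m1 a) (m2 b / m2 a)"
    if "a \<in> D" "b \<in> D" for a b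
  proof -
    have inv: "min (u b / u a) (v b / v a) = 1 / max (u a / u b) (v a / v b)"
      if "0 < u a" "0 < u b" "0 < v a" "0 < v b" for u v :: "'a \<Rightarrow> real"
      using that by (auto simp: min_def max_def field_simps)
    show ?thesis
      using inv[of n1 n2] inv[of m1 m2] max[OF that(2,1)] pos[OF that(1)] pos[OF that(2)] by simp
  qed
  have pair: "(n1 b / n1 a = m1 b / m1 a \<and> n2 b / n2 a = m2 b / m2 a) \<or>
      (n1 b / n1 a = m2 b / m2 a \<and> n2 b / n2 a = m1 b / m1 a)" if "a \<in> D" "b \<in> D" for a b
    using max[OF that] min[OF that] by (auto simp: max_def min_def split: if_splits)
  define N1 where "N1 b = n1 b / n1 a0" for b
  define N2 where "N2 b = n2 b / n2 a0" for b
  define M1 where "M1 b = m1 b / m1 a0" for b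
  define M2 where "M2 b = m2 b / m2 a0" for b
  note defs = N1_def N2_def M1_def M2_def
  have posN: "0 < N1 b \<and> 0 < N2 b \<and> 0 < M1 b \<and> 0 < M2 b" if "b \<in> D" for b
    using pos[OF that] pos[OF a0] by (simp add: defs)
  have one: "(N1 b = M1 b \<and> N2 b = M2 b) \<or> (N1 b = M2 b \<and> N2 b = M1 b)" if "b \<in> D" for b
    using pair[OF a0 that] by (simp add: defs)
  have two: "(N1 b / N1 a = M1 b / M1 a \<and> N2 b / N2 a = M2 b / M2 a) \<or>
      (N1 b / N1 a = M2 b / M2 a \<and> N2 b / N2 a = M1 b / M1 a)" if "a \<in> D" "b \<in> D" for a b
    using pair[OF that] pos[OF a0] by (auto simp: defs)
  have "(\<forall>b\<in>D. N1 b = M1 b \<and> N2 b = M2 b) \<or> (\<forall>b\<in>D. N1 b = M2 b \<and> N2 b = M1 b)"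
  proof (rule ccontr)
    assume "\<not> ?thesis"
    then obtain b c where b: "b \<in> D" "\<not> (N1 b = M1 b \<and> N2 b = M2 b)"
      and c: "c \<in> D" "\<not> (N1 c = M2 c \<and> N2 c = M1 c)" by blast
    have b': "N1 b = M2 b" "N2 b = M1 b" "M1 b \<noteq> M2 b" using one[OF b(1)] b(2) by auto
    have c': "N1 c = M1 c" "N2 c = M2 c" "M1 c \<noteq> M2 c" using one[OF c(1)] c(2) by auto
    show False
      using two[OF b(1) c(1)] posN[OF b(1)] posN[OF c(1)] b' c' by (auto simp: frac_eq_eq)
  qed
  then show ?thesis
  proof
    assume "\<forall>b\<in>D. N1 b = M1 b \<and> N2 b = M2 b"
    then have "\<forall>b\<in>D. n1 b = n1 a0 / m1 a0 * m1 b \<and> n2 b = n2 a0 / m2 a0 * m2 b"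
      using pos[OF a0] by (simp add: defs field_simps)
    then show ?thesis
      using pos[OF a0] by (intro exI[of _ "n1 a0 / m1 a0"] conjI exI[of _ "n2 a0 / m2 a0"] disjI1) simp_all
  next
    assume "\<forall>b\<in>D. N1 b = M2 b \<and> N2 b = M1 b"
    then have "\<forall>b\<in>D. n1 b = n1 a0 / m2 a0 * m2 b \<and> n2 b = n2 a0 / m1 a0 * m1 b"
      using pos[OF a0] by (simp add: defs field_simps)
    then show ?thesis
      using pos[OF a0] by (intro exI[of _ "n1 a0 / m2 a0"] conjI exI[of _ "n2 a0 / m1 a0"] disjI2) simp_all
  qed
qed

section \<open>Interpolation pairs as couples\<close>

lemma (in vector_lattice) order_ideal_within:
  assumes E: "order_ideal E L" and F: "order_ideal F L" and sub: "carrier E \<subseteq> carrier F"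
  shows "order_ideal E F"
proof -
  interpret E: lattice_ideal L E by unfold_locales fact
  interpret F: lattice_ideal L F by unfold_locales fact
  have inF: "x \<in> carrier F" if "x \<in> carrier E" for x using sub that by blast
  have solid: "y \<in> carrier E" if "x \<in> carrier E" "y \<in> carrier F" "vabs F y \<sqsubseteq>\<^bsub>F\<^esub> vabs F x" for x y
  proof (rule E.ideal_solid[OF that(1)])
    show "y \<in> carrier L" using that(2) by simp
    show "vabs L y \<sqsubseteq> vabs L x"
      using that(3) F.ideal_le[of "vabs L y" "vabs L x"] that(2) inF[OF that(1)]
      by (simp add: F.ideal_abs)
  qed
  have "vector_lattice E" "vector_lattice F"
    using E F by (simp_all add: order_ideal_def)
  then show ?thesis
    unfolding order_ideal_def
    by (intro conjI ballI allI impI sub)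
      (simp_all add: inF E.ideal_add F.ideal_add E.ideal_scale F.ideal_scale E.ideal_le F.ideal_le,
       rule solid)
qed

lemma (in vector_lattice) order_ideal_refl: "order_ideal L L"
  unfolding order_ideal_def
  by (intro conjI ballI allI impI vector_lattice_axioms subset_refl) simp_all

locale interpolation_couple =
  fixes U :: "'a vector_lattice" and \<tau> :: "'a topology" and X Y :: "'a normed_lattice"
  assumes pair: "interpolation_pair U \<tau> X Y"
begin

abbreviation S :: "'a normed_lattice" where "S \<equiv> pair_sum U X Y"

sublocale U: vector_lattice U
  using pair by (simp add: interpolation_pair_def)

sublocale UX: banach_ideal U X
  using pair
  by (intro banach_ideal.intro lattice_ideal.intro lattice_ideal_axioms.intro
      banach_ideal_axioms.intro) (simp_all add: interpolation_pair_def)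

sublocale UY: banach_ideal U Y
  using pair
  by (intro banach_ideal.intro lattice_ideal.intro lattice_ideal_axioms.intro
      banach_ideal_axioms.intro) (simp_all add: interpolation_pair_def)

lemma S_carrier: "carrier S = {vadd U x y | x y. x \<in> carrier X \<and> y \<in> carrier Y}"
  by (simp add: pair_sum_def restrict_lattice_def)

lemma S_simps [simp]:
  "vadd S = vadd U"
  "vzero S = vzero U" "vscale S = vscale U" "le S = le U"
  by (simp_all add: pair_sum_def restrict_lattice_def)

lemma S_carrierI: "x \<in> carrier X \<Longrightarrow> y \<in> carrier Y \<Longrightarrow> vadd U x y \<in> carrier S"
  unfolding S_carrier by (rule CollectI, rule exI[of _ x], rule exI[of _ y], simp)

lemma S_carrierE:
  assumes "z \<in> carrier S"
  obtains x y where "x \<in> carrier X" "y \<in> carrier Y" "z = vadd U x y"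
  using assms unfolding S_carrier by (elim CollectE exE conjE) (rule that)

text \<open>Solidity: both \<open>z\<^sup>+\<close> and \<open>z\<^sup>-\<close> are below \<open>\<bar>x\<bar> + \<bar>y\<bar>\<close>, so each splits by Riesz decomposition.\<close>

lemma S_ideal: "vector_lattice S" "order_ideal S U"
proof -
  let ?A = "carrier S"
  have below: "p \<in> ?A" if p: "p \<in> carrier U" "le U (vzero U) p" "le U p (vadd U (vabs U x) (vabs U y))"
    and xy: "x \<in> carrier X" "y \<in> carrier Y" for p x y
  proof -
    obtain x' y' where "x' \<in> carrier U" "y' \<in> carrier U" "le U (vzero U) x'" "le U x' (vabs U x)"
        "le U (vzero U) y'" "le U y' (vabs U y)" "p = vadd U x' y'"
      by (rule U.riesz_decomposition[OF _ _ p(1) _ _ p(2,3)]) (use xy in simp_all)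
    then show ?thesis
      using UX.ideal_between[of "vabs U x" x'] UY.ideal_between[of "vabs U y" y'] xy
      by (simp only: S_carrierI UX.ideal_abs_closed UY.ideal_abs_closed)
  qed
  have add: "vadd U z w \<in> ?A" if zw: "z \<in> ?A" "w \<in> ?A" for z w
  proof -
    obtain x y where xy: "x \<in> carrier X" "y \<in> carrier Y" "z = vadd U x y" by (rule S_carrierE[OF zw(1)])
    obtain x' y' where xy': "x' \<in> carrier X" "y' \<in> carrier Y" "w = vadd U x' y'"
      by (rule S_carrierE[OF zw(2)])
    have "vadd U z w = vadd U (vadd U x x') (vadd U y y')"
      using xy xy' by (simp add: U.add_swap)
    then show ?thesis using xy xy' S_carrierI[of "vadd U x x'" "vadd U y y'"] by simp
  qed
  have scale: "vscale U r z \<in> ?A" if z: "z \<in> ?A" for z r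
  proof -
    obtain x y where xy: "x \<in> carrier X" "y \<in> carrier Y" "z = vadd U x y" by (rule S_carrierE[OF z])
    then have "vscale U r z = vadd U (vscale U r x) (vscale U r y)"
      by (simp add: U.scale_add_right)
    then show ?thesis using xy S_carrierI[of "vscale U r x" "vscale U r y"] by simp
  qed
  have solid: "z \<in> ?A" if w: "w \<in> ?A" and z: "z \<in> carrier U" "le U (vabs U z) (vabs U w)" for z w
  proof -
    obtain x y where xy: "x \<in> carrier X" "y \<in> carrier Y" "w = vadd U x y" by (rule S_carrierE[OF w])
    have xyU: "x \<in> carrier U" "y \<in> carrier U" using xy by simp_all
    obtain p n where pn: "p \<in> carrier U" "n \<in> carrier U" "le U (vzero U) p" "le U (vzero U) n"
        "le U p (vabs U z)" "le U n (vabs U z)" "z = vdiff U p n"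
      by (rule U.pos_neg_parts[OF z(1)])
    have zb: "le U (vabs U z) (vadd U (vabs U x) (vabs U y))"
      using U.le_trans[OF z(2), of "vadd U (vabs U x) (vabs U y)"] U.abs_add[OF xyU] xy xyU z(1) by simp
    have "p \<in> ?A" "n \<in> ?A"
      using below[OF pn(1,3) _ xy(1,2)] below[OF pn(2,4) _ xy(1,2)] U.le_trans[OF pn(5) zb]
        U.le_trans[OF pn(6) zb] pn(1,2) z(1) xyU by simp_all
    then show ?thesis
      unfolding pn(7) vdiff_def by (intro add scale)
  qed
  have "z \<in> carrier U" if "z \<in> ?A" for z
    using that by (rule S_carrierE) simp
  then have sub: "?A \<subseteq> carrier U" by blast
  have zero: "vzero U \<in> ?A"
    using S_carrierI[OF UX.ideal_zero_closed UY.ideal_zero_closed] U.add_zero(1)[OF U.zero_closed]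
    by simp
  have S: "S = restrict_lattice U ?A
      (\<lambda>z. Inf {vnorm X x + vnorm Y y | x y. x \<in> carrier X \<and> y \<in> carrier Y \<and> z = vadd U x y})"
    unfolding S_carrier by (simp add: pair_sum_def)
  show "vector_lattice S"
    by (subst S, rule solid_subspace_order_ideal(1)[OF U.vector_lattice_axioms sub zero add scale solid])
  show "order_ideal S U"
    by (subst S, rule solid_subspace_order_ideal(2)[OF U.vector_lattice_axioms sub zero add scale solid])
qed

lemma X_subset_S: "carrier X \<subseteq> carrier S" and Y_subset_S: "carrier Y \<subseteq> carrier S"
proof -
  show "carrier X \<subseteq> carrier S"
  proof
    fix x assume x: "x \<in> carrier X"
    then show "x \<in> carrier S" using S_carrierI[OF x UY.ideal_zero_closed] by simp
  qed
  show "carrier Y \<subseteq> carrier S"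
  proof
    fix y assume y: "y \<in> carrier Y"
    then show "y \<in> carrier S" using S_carrierI[OF UX.ideal_zero_closed y] by simp
  qed
qed

lemma norm_null_limit:
  assumes E: "banach_ideal U E" and cont: "continuous_map (norm_topology E) \<tau> (\<lambda>x. x)"
    and s: "\<And>n. s n \<in> carrier E" and lim: "(\<lambda>n. vnorm E (s n)) \<longlonglongrightarrow> 0"
  shows "limitin \<tau> s (vzero U) sequentially"
proof -
  interpret E: banach_ideal U E by (rule E)
  interpret M: Metric_space "carrier E" "vdist E"
    by (rule banach_lattice.metric_space[OF E.banach])
  have "vdist E (s n) (vzero U) = vnorm E (s n)" for n
    using s[of n] by (simp add: vdist_def E.ideal_diff)
  then have "limitin M.mtopology s (vzero U) sequentially"
    using s lim by (simp add: M.limitin_metric_dist_null)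
  from continuous_map_limit[OF cont this] show ?thesis by (simp add: o_def)
qed

text \<open>This is where the Hausdorff topology enters: an element whose splittings become
  arbitrarily small is a constant sequence converging to zero in \<open>\<tau>\<close>.\<close>

lemma small_splittings_zero:
  assumes e: "\<And>e. 0 < e \<Longrightarrow> \<exists>x\<in>carrier X. \<exists>y\<in>carrier Y. z = vadd U x y \<and> vnorm X x + vnorm Y y < e"
  shows "z = vzero U"
proof -
  have "\<exists>p. fst p \<in> carrier X \<and> snd p \<in> carrier Y \<and> z = vadd U (fst p) (snd p) \<and>
      vnorm X (fst p) + vnorm Y (snd p) < inverse (real (Suc n))" for n
  proof -
    obtain x y where "x \<in> carrier X" "y \<in> carrier Y" "z = vadd U x y"
        "vnorm X x + vnorm Y y < inverse (real (Suc n))"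
      using e[of "inverse (real (Suc n))"] by auto
    then show ?thesis by (intro exI[of _ "(x, y)"]) simp
  qed
  then obtain p where p: "\<And>n. fst (p n) \<in> carrier X" "\<And>n. snd (p n) \<in> carrier Y"
    "\<And>n. z = vadd U (fst (p n)) (snd (p n))"
    "\<And>n. vnorm X (fst (p n)) + vnorm Y (snd (p n)) < inverse (real (Suc n))"
    by metis
  have small: "vnorm X (fst (p n)) \<le> inverse (real (Suc n))" "vnorm Y (snd (p n)) \<le> inverse (real (Suc n))" for n
    using p(4)[of n] UX.norm_nonneg[OF p(1), of n] UY.norm_nonneg[OF p(2), of n] by linarith+
  have pX: "(\<lambda>n. vnorm X (fst (p n))) \<longlonglongrightarrow> 0"
    by (rule tendsto_sandwich[OF always_eventually[OF allI[OF UX.norm_nonneg[OF p(1)]]]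
        always_eventually[OF allI[OF small(1)]] tendsto_const LIMSEQ_inverse_real_of_nat])
  have pY: "(\<lambda>n. vnorm Y (snd (p n))) \<longlonglongrightarrow> 0"
    by (rule tendsto_sandwich[OF always_eventually[OF allI[OF UY.norm_nonneg[OF p(2)]]]
        always_eventually[OF allI[OF small(2)]] tendsto_const LIMSEQ_inverse_real_of_nat])
  have cont: "continuous_map (norm_topology X) \<tau> (\<lambda>x. x)" "continuous_map (norm_topology Y) \<tau> (\<lambda>x. x)"
    and tvs: "hausdorff_tvs U \<tau>"
    using pair by (simp_all add: interpolation_pair_def)
  have lims: "limitin \<tau> (\<lambda>n. fst (p n)) (vzero U) sequentially" "limitin \<tau> (\<lambda>n. snd (p n)) (vzero U) sequentially"
    using norm_null_limit[OF UX.banach_ideal_axioms cont(1) p(1) pX]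
      norm_null_limit[OF UY.banach_ideal_axioms cont(2) p(2) pY] by simp_all
  then have "limitin (prod_topology \<tau> \<tau>) p (vzero U, vzero U) sequentially"
    by (simp add: limitin_pairwise o_def)
  moreover have "continuous_map (prod_topology \<tau> \<tau>) \<tau> (\<lambda>(x, y). vadd U x y)"
    using tvs by (simp add: hausdorff_tvs_def)
  ultimately have "limitin \<tau> ((\<lambda>(x, y). vadd U x y) \<circ> p) ((\<lambda>(x, y). vadd U x y) (vzero U, vzero U)) sequentially"
    by (rule continuous_map_limit[rotated])
  moreover have "(\<lambda>(x, y). vadd U x y) \<circ> p = (\<lambda>n. z)"
    using p(3) by (simp add: fun_eq_iff case_prod_beta)
  ultimately have z0: "limitin \<tau> (\<lambda>n. z) (vzero U) sequentially" by simp
  have "z \<in> carrier U" using p(1,2)[of 0] p(3)[of 0] by simp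
  then have "limitin \<tau> (\<lambda>n::nat. z) z sequentially"
    using tvs by (simp add: hausdorff_tvs_def)
  then show ?thesis
    using limitin_Hausdorff_unique[OF _ z0] tvs by (simp add: hausdorff_tvs_def)
qed

sublocale banach_couple S X Y
proof (intro banach_couple.intro banach_ideal.intro lattice_ideal.intro lattice_ideal_axioms.intro
    banach_ideal_axioms.intro banach_couple_axioms.intro S_ideal(1) UX.banach UY.banach)
  show "order_ideal X S" by (rule U.order_ideal_within[OF UX.ideal S_ideal(2) X_subset_S])
  show "order_ideal Y S" by (rule U.order_ideal_within[OF UY.ideal S_ideal(2) Y_subset_S])
  show "\<exists>x\<in>carrier X. \<exists>y\<in>carrier Y. z = vadd S x y" if z: "z \<in> carrier S" for z
  proof -
    obtain x y where xy: "x \<in> carrier X" "y \<in> carrier Y" "z = vadd U x y" by (rule S_carrierE[OF z])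
    then show ?thesis by (intro bexI[of _ x] bexI[of _ y]) simp_all
  qed
  show "z = vzero S"
    if "\<And>e. 0 < e \<Longrightarrow> \<exists>x\<in>carrier X. \<exists>y\<in>carrier Y. z = vadd S x y \<and> vnorm X x + vnorm Y y < e" for z
    unfolding S_simps by (rule small_splittings_zero) (rule that[unfolded S_simps])
qed

lemma sum_norm_le:
  "x \<in> carrier X \<Longrightarrow> y \<in> carrier Y \<Longrightarrow> vnorm S (vadd U x y) \<le> vnorm X x + vnorm Y y"
  unfolding pair_sum_def restrict_lattice_def
  using UX.norm_nonneg UY.norm_nonneg
  by (auto intro!: cInf_lower bdd_belowI[of _ 0] exI add_nonneg_nonneg)

lemma sum_norm_approx:
  assumes z: "z \<in> carrier S" and e: "0 < e"
  obtains x y where "x \<in> carrier X" "y \<in> carrier Y" "z = vadd U x y"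
    "vnorm X x + vnorm Y y < vnorm S z + e"
proof -
  let ?K = "{vnorm X x + vnorm Y y | x y. x \<in> carrier X \<and> y \<in> carrier Y \<and> z = vadd U x y}"
  have K: "vnorm S z = Inf ?K" by (simp add: pair_sum_def restrict_lattice_def)
  have "?K \<noteq> {}" using z by (auto simp: S_carrier)
  moreover have "Inf ?K < vnorm S z + e" using e K by simp
  ultimately obtain v where "v \<in> ?K" "v < vnorm S z + e" by (rule cInf_lessD[THEN bexE])
  then show thesis using that by auto
qed

lemma inter_ideal: "vector_lattice (pair_inter U X Y)" "order_ideal (pair_inter U X Y) U"
proof -
  have zero: "vzero U \<in> carrier X \<inter> carrier Y" by simp
  have sub: "carrier X \<inter> carrier Y \<subseteq> carrier U"
    by (rule subsetI, erule IntE, erule UX.ideal_carrier)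
  have add: "vadd U x y \<in> carrier X \<inter> carrier Y"
    if "x \<in> carrier X \<inter> carrier Y" "y \<in> carrier X \<inter> carrier Y" for x y
    using that by simp
  have scale: "vscale U r x \<in> carrier X \<inter> carrier Y" if "x \<in> carrier X \<inter> carrier Y" for x r
    using that by simp
  have solid: "y \<in> carrier X \<inter> carrier Y"
    if x: "x \<in> carrier X \<inter> carrier Y" and y: "y \<in> carrier U" "le U (vabs U y) (vabs U x)" for x y
    using UX.ideal_solid[OF IntD1[OF x] y] UY.ideal_solid[OF IntD2[OF x] y] by (rule IntI)
  show "vector_lattice (pair_inter U X Y)"
    unfolding pair_inter_def
    by (rule solid_subspace_order_ideal(1)[OF U.vector_lattice_axioms sub zero add scale solid])
  show "order_ideal (pair_inter U X Y) U"
    unfolding pair_inter_def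
    by (rule solid_subspace_order_ideal(2)[OF U.vector_lattice_axioms sub zero add scale solid])
qed

lemma inter_simps: "carrier (pair_inter U X Y) = carrier X \<inter> carrier Y"
  "vnorm (pair_inter U X Y) x = max (vnorm X x) (vnorm Y x)"
  by (simp_all add: pair_inter_def restrict_lattice_def)

end

lemma interpolation_pair_swap: "interpolation_pair U \<tau> X Y \<Longrightarrow> interpolation_pair U \<tau> Y X"
  by (auto simp: interpolation_pair_def)

lemma (in interpolation_couple) P_Int1_swap: "P_Int1 U Y X = P_Int1 U X Y"
proof -
  have "pair_inter U Y X = pair_inter U X Y"
    by (simp add: pair_inter_def Int_commute max.commute)
  moreover have "pair_sum U Y X = pair_sum U X Y"
  proof -
    have comm: "vadd U y x = vadd U x y" if "x \<in> carrier X" "y \<in> carrier Y" for x y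
      using that by (simp add: U.add_comm)
    have "(\<exists>y x. z = vadd U y x \<and> y \<in> carrier Y \<and> x \<in> carrier X) \<longleftrightarrow>
        (\<exists>x y. z = vadd U x y \<and> x \<in> carrier X \<and> y \<in> carrier Y)" for z
      using comm by metis
    moreover have "(\<exists>y x. v = vnorm Y y + vnorm X x \<and> y \<in> carrier Y \<and> x \<in> carrier X \<and> z = vadd U y x) \<longleftrightarrow>
        (\<exists>x y. v = vnorm X x + vnorm Y y \<and> x \<in> carrier X \<and> y \<in> carrier Y \<and> z = vadd U x y)" for z v
      using comm add.commute by metis
    ultimately show ?thesis by (simp add: pair_sum_def)
  qed
  ultimately show ?thesis
    by (simp add: P_Int1_def intermediate_def L_plus_pair_def max.commute conj_commute)
qed

lemma (in interpolation_couple) X_in_P_Int1: "X \<in> P_Int1 U X Y"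
proof -
  have "embeds (pair_inter U X Y) X"
    unfolding embeds_def
  proof (intro conjI exI[of _ 1] ballI)
    show "order_ideal (pair_inter U X Y) X"
      by (rule U.order_ideal_within[OF inter_ideal(2) UX.ideal]) (simp add: inter_simps)
  qed (simp_all add: inter_simps)
  moreover have "embeds X S"
    unfolding embeds_def
  proof (intro conjI exI[of _ 1] ballI X.ideal)
    show "vnorm S x \<le> 1 * vnorm X x" if "x \<in> carrier X" for x
      using sum_norm_le[OF that UY.ideal_zero_closed] that by simp
  qed simp
  ultimately have "intermediate U X Y X"
    by (simp add: intermediate_def UX.banach)
  moreover have "T ` carrier X \<subseteq> carrier X" if "T \<in> L_plus_pair U X Y" for T
  proof -
    have "T \<in> carrier X \<rightarrow> carrier X"
      using that by (simp add: L_plus_pair_def L_plus_def linear_operator_def)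
    then show ?thesis by (rule funcset_image)
  qed
  ultimately show ?thesis by (simp add: P_Int1_def)
qed

lemma (in interpolation_couple) Y_in_P_Int1: "Y \<in> P_Int1 U X Y"
proof -
  interpret swap: interpolation_couple U \<tau> Y X
    using interpolation_pair_swap[OF pair] by (rule interpolation_couple.intro)
  show ?thesis using swap.X_in_P_Int1 by (simp add: P_Int1_swap)
qed

section \<open>Rank-one operators and interpolation norms\<close>

lemma (in lattice_ideal) rank_one_L_plus:
  assumes f: "positive_functional L f" and a: "a \<in> carrier L" "\<zero> \<sqsubseteq> a"
    and target: "a \<in> carrier E \<or> (\<forall>x\<in>carrier E. f x = 0)"
  shows "(\<lambda>x. f x \<odot> a) \<in> L_plus E"
proof -
  have in_E: "f x \<odot> a \<in> carrier E" if "x \<in> carrier E" for x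
    using target
  proof
    assume "\<forall>x\<in>carrier E. f x = 0"
    then show ?thesis using that a by simp
  qed simp
  have add: "f (vadd E x y) \<odot> a = vadd E (f x \<odot> a) (f y \<odot> a)"
    if "x \<in> carrier E" "y \<in> carrier E" for x y
    using that in_E a by (simp add: ideal_add functional_add[OF f] scale_add_left)
  have scale: "f (vscale E r x) \<odot> a = vscale E r (f x \<odot> a)" if "x \<in> carrier E" for x r
    using that in_E a by (simp add: ideal_scale functional_scale[OF f] scale_scale)
  have "f x \<odot> a \<in> pos_cone E" if "x \<in> pos_cone E" for x
  proof -
    have x: "x \<in> carrier E" "\<zero> \<sqsubseteq> x" using that unfolding ideal_pos_cone by simp_all
    then have "0 \<le> f x" using functional_nonneg[OF f, of x] by simp
    then show ?thesis unfolding ideal_pos_cone using in_E[OF x(1)] a by (simp add: scale_nonneg)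
  qed
  then show ?thesis
    using in_E add scale by (simp add: L_plus_def linear_operator_def image_subset_iff)
qed

context interpolation_couple
begin

context
  fixes Z
  assumes Z: "Z \<in> P_Int1 U X Y"
begin

lemma P_Int1_banach_ideal: "banach_ideal S Z"
  using Z
  by (intro banach_ideal.intro lattice_ideal.intro lattice_ideal_axioms.intro
      banach_ideal_axioms.intro S_ideal(1))
    (simp_all add: P_Int1_def intermediate_def embeds_def)

lemma P_Int1_inter_subset: "carrier X \<inter> carrier Y \<subseteq> carrier Z"
proof -
  have "order_ideal (pair_inter U X Y) Z"
    using Z by (simp add: P_Int1_def intermediate_def embeds_def)
  then have "carrier (pair_inter U X Y) \<subseteq> carrier Z" by (simp add: order_ideal_def)
  then show ?thesis by (simp add: inter_simps)
qed

lemma P_Int1_sum_norm: "\<exists>c>0. \<forall>z\<in>carrier Z. vnorm S z \<le> c * vnorm Z z"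
  using Z by (simp add: P_Int1_def intermediate_def embeds_def)

lemma P_Int1_operator:
  assumes "T \<in> L_plus_pair U X Y"
  shows "T ` carrier Z \<subseteq> carrier Z" "op_norm Z T \<le> max (op_norm X T) (op_norm Y T)"
  using Z assms by (simp_all add: P_Int1_def)

text \<open>On the sum \<open>f\<close> is bounded by the larger of its two norms, and \<open>Z\<close> embeds into the sum.\<close>

lemma P_Int1_bounded:
  assumes f: "couple_functional f"
  shows "bounded_functional Z f"
proof -
  interpret Z: banach_ideal S Z by (rule P_Int1_banach_ideal)
  obtain c where c: "0 < c" "\<And>z. z \<in> carrier Z \<Longrightarrow> vnorm S z \<le> c * vnorm Z z"
    using P_Int1_sum_norm by blast
  have pf: "positive_functional S f" using f by (simp add: couple_functional_def)
  define M where "M = max (functional_norm X f) (functional_norm Y f)"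
  have M: "0 \<le> M"
    using X.functional_norm_nonneg[OF couple_functional_X[OF f]] by (simp add: M_def)
  have "f z \<le> M * c * vnorm Z z" if z: "z \<in> carrier Z" for z
  proof -
    have zS: "z \<in> carrier S" using z by (rule Z.ideal_carrier)
    have "f z \<le> M * (vnorm S z + e)" if e: "0 < e" for e
    proof -
      obtain x y where xy: "x \<in> carrier X" "y \<in> carrier Y" "z = vadd U x y"
          "vnorm X x + vnorm Y y < vnorm S z + e"
        by (rule sum_norm_approx[OF zS e])
      have "f z = f x + f y"
        using functional_add[OF pf, of x y] xy X.ideal_carrier[OF xy(1)] Y.ideal_carrier[OF xy(2)]
        by simp
      also have "f x \<le> functional_norm X f * vnorm X x"
        using X.functional_abs_le_norm[OF couple_functional_X[OF f] xy(1)] by simp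
      also have "\<dots> \<le> M * vnorm X x"
        using X.norm_nonneg[OF xy(1)] by (intro mult_right_mono) (simp_all add: M_def)
      also have "f y \<le> functional_norm Y f * vnorm Y y"
        using Y.functional_abs_le_norm[OF couple_functional_Y[OF f] xy(2)] by simp
      also have "functional_norm Y f * vnorm Y y \<le> M * vnorm Y y"
        using Y.norm_nonneg[OF xy(2)] by (intro mult_right_mono) (simp_all add: M_def)
      finally have "f z \<le> M * (vnorm X x + vnorm Y y)" by (simp add: distrib_left)
      also have "\<dots> \<le> M * (vnorm S z + e)" using M xy(4) by (intro mult_left_mono) simp_all
      finally show ?thesis .
    qed
    then have e: "f z \<le> M * vnorm S z + M * e" if "0 < e" for e
      using that by (simp add: distrib_left)
    have "f z \<le> M * vnorm S z"
    proof (rule field_le_epsilon)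
      fix e :: real assume "0 < e"
      then have "f z \<le> M * vnorm S z + M * (e / (M + 1))" using M by (intro e) simp
      also have "M * (e / (M + 1)) \<le> e" using M \<open>0 < e\<close> by (simp add: field_simps)
      finally show "f z \<le> M * vnorm S z + e" by simp
    qed
    also have "\<dots> \<le> M * (c * vnorm Z z)" using c(2)[OF z] M by (intro mult_left_mono)
    finally show ?thesis by (simp add: mult.assoc)
  qed
  then show ?thesis
    unfolding bounded_functional_def pos_cone_def by blast
qed

lemma P_Int1_functional:
  assumes "couple_functional f"
  shows "positive_functional Z f" "bounded_functional Z f"
proof -
  interpret Z: banach_ideal S Z by (rule P_Int1_banach_ideal)
  show "positive_functional Z f"
    using assms Z.positive_functional_restrict by (simp add: couple_functional_def)
  show "bounded_functional Z f" by (rule P_Int1_bounded[OF assms])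
qed

lemma rank_one_inequality:
  assumes f: "couple_functional f" and a: "a \<in> carrier X" "a \<in> carrier Y" "a \<in> pos_cone S"
  shows "functional_norm Z f * vnorm Z a \<le>
    max (functional_norm X f * vnorm X a) (functional_norm Y f * vnorm Y a)"
proof -
  interpret Z: banach_ideal S Z by (rule P_Int1_banach_ideal)
  interpret S: lattice_ideal S S by unfold_locales (rule order_ideal_refl)
  have pf: "positive_functional S f" using f by (simp add: couple_functional_def)
  have aS: "a \<in> carrier S" "le S (vzero S) a" using a(3) by (simp_all add: pos_cone_def)
  have aZ: "a \<in> carrier Z" using P_Int1_inter_subset a(1,2) by blast
  let ?T = "\<lambda>x. vscale S (f x) a"
  have "?T \<in> L_plus S" "?T \<in> L_plus X" "?T \<in> L_plus Y"
    using S.rank_one_L_plus[OF pf aS] X.rank_one_L_plus[OF pf aS] Y.rank_one_L_plus[OF pf aS] a aS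
    by simp_all
  then have "?T \<in> L_plus_pair U X Y" by (simp add: L_plus_pair_def L_plus_def)
  from P_Int1_operator(2)[OF this] show ?thesis
    unfolding Z.op_norm_rank_one[OF P_Int1_functional[OF f] aZ]
      X.op_norm_rank_one[OF couple_functional_X[OF f] a(1)]
      Y.op_norm_rank_one[OF couple_functional_Y[OF f] a(2)] .
qed

text \<open>A functional vanishing on \<open>Y\<close> admits every positive \<open>a\<close> of \<open>X\<close> as target.\<close>

lemma rank_one_inequality_annihilator:
  assumes f: "couple_functional f" and fY: "\<And>y. y \<in> carrier Y \<Longrightarrow> f y = 0"
    and a: "a \<in> carrier X" "a \<in> pos_cone S" and z: "z \<in> carrier Z" "f z \<noteq> 0"
  shows "a \<in> carrier Z" "functional_norm Z f * vnorm Z a \<le> functional_norm X f * vnorm X a"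
proof -
  interpret Z: banach_ideal S Z by (rule P_Int1_banach_ideal)
  interpret S: lattice_ideal S S by unfold_locales (rule order_ideal_refl)
  have pf: "positive_functional S f" using f by (simp add: couple_functional_def)
  have aS: "a \<in> carrier S" "le S (vzero S) a" using a(2) by (simp_all add: pos_cone_def)
  let ?T = "\<lambda>x. vscale S (f x) a"
  have "?T \<in> L_plus S" "?T \<in> L_plus X" "?T \<in> L_plus Y"
    using S.rank_one_L_plus[OF pf aS] X.rank_one_L_plus[OF pf aS] Y.rank_one_L_plus[OF pf aS] a aS fY
    by simp_all
  then have T: "?T \<in> L_plus_pair U X Y" by (simp add: L_plus_pair_def L_plus_def)
  have "?T z \<in> carrier Z" using P_Int1_operator(1)[OF T] z(1) by blast
  then have "vscale S (1 / f z) (?T z) \<in> carrier Z" by (rule Z.ideal_scale_closed)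
  moreover have "vscale S (1 / f z) (?T z) = a"
    using scale_scale[OF aS(1), of "1 / f z" "f z"] scale_one[OF aS(1)] z(2) by simp
  ultimately show aZ: "a \<in> carrier Z" by simp
  have Ty: "vnorm Y (?T y) = 0" if "y \<in> carrier Y" for y
    using fY[OF that] scale_zero_left[OF aS(1)] Y.norm_zero by simp
  have "{vnorm Y (?T y) | y. y \<in> carrier Y \<and> vnorm Y y \<le> 1} = {0}"
  proof (intro equalityI subsetI)
    fix v assume "v \<in> {vnorm Y (?T y) | y. y \<in> carrier Y \<and> vnorm Y y \<le> 1}"
    then show "v \<in> {0}" using Ty by auto
  next
    fix v :: real assume "v \<in> {0}"
    then have "v = vnorm Y (?T (vzero S)) \<and> vzero S \<in> carrier Y \<and> vnorm Y (vzero S) \<le> 1"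
      using Ty[OF Y.ideal_zero_closed] Y.norm_zero Y.ideal_zero_closed by simp
    then show "v \<in> {vnorm Y (?T y) | y. y \<in> carrier Y \<and> vnorm Y y \<le> 1}" by blast
  qed
  then have "op_norm Y ?T = 0" by (simp add: op_norm_def)
  moreover have "op_norm X ?T = functional_norm X f * vnorm X a"
    by (rule X.op_norm_rank_one[OF couple_functional_X[OF f] a(1)])
  moreover have "0 \<le> functional_norm X f * vnorm X a"
    using X.functional_norm_nonneg[OF couple_functional_X[OF f]] X.norm_nonneg[OF a(1)] by simp
  ultimately show "functional_norm Z f * vnorm Z a \<le> functional_norm X f * vnorm X a"
    using P_Int1_operator(2)[OF T]
    unfolding Z.op_norm_rank_one[OF P_Int1_functional[OF f] aZ] by simp
qed

end

end

section \<open>Proportional norms\<close>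

lemma proportional_sym: "E \<cong>\<^sub>p F \<Longrightarrow> F \<cong>\<^sub>p E"
proof -
  assume EF: "E \<cong>\<^sub>p F"
  then obtain k where k: "0 < k" "\<And>x. x \<in> carrier E \<Longrightarrow> vnorm E x = k * vnorm F x"
    by (auto simp: proportional_def)
  have "vnorm F x = (1 / k) * vnorm E x" if "x \<in> carrier E" for x
    using k(1) k(2)[OF that] by simp
  moreover have "same_vector_lattice F E" "carrier E = carrier F"
    using EF by (simp_all add: proportional_def same_vector_lattice_def)
  ultimately show "F \<cong>\<^sub>p E"
    unfolding proportional_def using k(1) by (intro conjI exI[of _ "1 / k"]) simp_all
qed

lemma (in vector_lattice) proportionalI:
  assumes E: "banach_ideal L E" and F: "banach_ideal L F" and eq: "carrier E = carrier F"
    and k: "0 < k" "\<And>a. a \<in> carrier E \<Longrightarrow> \<zero> \<sqsubseteq> a \<Longrightarrow> vnorm E a = k * vnorm F a"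
  shows "E \<cong>\<^sub>p F"
proof -
  interpret E: banach_ideal L E by (rule E)
  interpret F: banach_ideal L F by (rule F)
  have inF: "x \<in> carrier F" if "x \<in> carrier E" for x using eq that by simp
  have "same_vector_lattice E F"
    unfolding same_vector_lattice_def
    by (intro conjI ballI allI eq)
      (simp_all add: inF E.ideal_zero F.ideal_zero E.ideal_add F.ideal_add E.ideal_scale F.ideal_scale
        E.ideal_le F.ideal_le)
  moreover have "vnorm E x = k * vnorm F x" if "x \<in> carrier E" for x
    using k(2)[of "vabs L x"] that inF[OF that] E.norm_abs[OF that] F.norm_abs[of x] by simp
  ultimately show ?thesis using k(1) by (auto simp: proportional_def)
qed

text \<open>Density, tested with positive elements and positive approximants.\<close>

definition norm_dense :: "'a set \<Rightarrow> 'a normed_lattice \<Rightarrow> bool" where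
  "norm_dense D E \<longleftrightarrow> (\<forall>x\<in>pos_cone E. \<forall>e>0. \<exists>d\<in>D. d \<in> pos_cone E \<and> vnorm E (vdiff E x d) < e)"

context interpolation_couple
begin

text \<open>An approximating sequence from the intersection that converges in \<open>E\<close> converges in \<open>F\<close>
  too, and both limits are limits in the sum, where limits are unique.\<close>

lemma limits_agree:
  assumes E: "E \<in> P_Int1 U X Y" and F: "F \<in> P_Int1 U X Y"
    and k: "0 < k" "\<And>d. d \<in> carrier X \<Longrightarrow> d \<in> carrier Y \<Longrightarrow> d \<in> pos_cone S \<Longrightarrow> vnorm E d = k * vnorm F d"
    and dense: "norm_dense (carrier X \<inter> carrier Y) E"
    and x: "x \<in> pos_cone E"
  shows "x \<in> carrier F" "vnorm E x = k * vnorm F x"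
proof -
  interpret E: banach_ideal S E by (rule P_Int1_banach_ideal[OF E])
  interpret F: banach_ideal S F by (rule P_Int1_banach_ideal[OF F])
  obtain c1 where c1: "0 < c1" "\<And>z. z \<in> carrier E \<Longrightarrow> vnorm S z \<le> c1 * vnorm E z"
    using P_Int1_sum_norm[OF E] by blast
  obtain c2 where c2: "0 < c2" "\<And>z. z \<in> carrier F \<Longrightarrow> vnorm S z \<le> c2 * vnorm F z"
    using P_Int1_sum_norm[OF F] by blast
  have xE: "x \<in> carrier E" using x by (simp add: pos_cone_def)
  have kD: "vnorm E d = k * vnorm F d" if d: "d \<in> carrier X" "d \<in> carrier Y" for d
  proof -
    have a: "vabs S d \<in> pos_cone S" using abs_nonneg[OF X.ideal_carrier[OF d(1)]]
        abs_closed[OF X.ideal_carrier[OF d(1)]] unfolding pos_cone_def by simp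
    have dEF: "d \<in> carrier E" "d \<in> carrier F"
      using P_Int1_inter_subset[OF E] P_Int1_inter_subset[OF F] d by (meson IntI subsetD)+
    show ?thesis
      using k(2)[OF X.ideal_abs_closed[OF d(1)] Y.ideal_abs_closed[OF d(2)] a]
      unfolding E.norm_abs[OF dEF(1)] F.norm_abs[OF dEF(2)] .
  qed
  have "\<forall>n. \<exists>d. d \<in> carrier X \<inter> carrier Y \<and> vnorm E (vdiff E x d) < inverse (real (Suc n))"
  proof
    fix n
    have "0 < inverse (real (Suc n))" by simp
    then show "\<exists>d. d \<in> carrier X \<inter> carrier Y \<and> vnorm E (vdiff E x d) < inverse (real (Suc n))"
      using dense x unfolding norm_dense_def by meson
  qed
  from choice[OF this] obtain d
    where d0: "\<forall>n. d n \<in> carrier X \<inter> carrier Y \<and> vnorm E (vdiff E x (d n)) < inverse (real (Suc n))" ..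
  have dX: "d n \<in> carrier X" and dY: "d n \<in> carrier Y" for n using d0 by simp_all
  have dE: "d n \<in> carrier E" and dF: "d n \<in> carrier F" for n
    using P_Int1_inter_subset[OF E] P_Int1_inter_subset[OF F] d0 by (meson subsetD)+
  have close: "vnorm E (vdiff S x (d n)) < inverse (real (Suc n))" for n
    using d0 unfolding E.ideal_diff[OF xE dE] by simp
  have limE': "(\<lambda>n. vnorm E (vdiff S x (d n))) \<longlonglongrightarrow> 0"
    by (rule tendsto_sandwich[OF always_eventually[OF allI[OF E.norm_nonneg[OF E.ideal_diff_closed[OF xE dE]]]]
        always_eventually[OF allI[OF less_imp_le[OF close]]] tendsto_const LIMSEQ_inverse_real_of_nat])
  then have limE: "(\<lambda>n. vnorm E (vdiff S (d n) x)) \<longlonglongrightarrow> 0"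
    using E.norm_diff_comm[OF xE dE] by simp
  have "\<exists>l\<in>carrier F. (\<lambda>n. vnorm F (vdiff S (d n) l)) \<longlonglongrightarrow> 0"
  proof (rule F.Cauchy_convergent[OF dF])
    fix e :: real assume e: "0 < e"
    then have "0 < k * e / 2" using k(1) by simp
    then have "eventually (\<lambda>n. vnorm E (vdiff S x (d n)) < k * e / 2) sequentially"
      by (rule order_tendstoD(2)[OF limE'])
    then obtain N where N: "\<And>n. N \<le> n \<Longrightarrow> vnorm E (vdiff S x (d n)) < k * e / 2"
      unfolding eventually_sequentially by blast
    have "vnorm F (vdiff S (d m) (d n)) < e" if "N \<le> m" "m \<le> n" for m n
    proof -
      have "N \<le> n" using that by simp
      have "vdiff S (d m) (d n) = vadd S (vdiff S (d m) x) (vdiff S x (d n))"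
        by (rule diff_trans[OF E.ideal_carrier[OF dE] E.ideal_carrier[OF xE] E.ideal_carrier[OF dE]])
      then have "vnorm E (vdiff S (d m) (d n)) \<le> vnorm E (vdiff S (d m) x) + vnorm E (vdiff S x (d n))"
        using E.norm_add[OF E.ideal_diff_closed[OF dE xE] E.ideal_diff_closed[OF xE dE]] by simp
      then have "vnorm E (vdiff S (d m) (d n)) < k * e"
        using N[OF that(1)] N[OF \<open>N \<le> n\<close>] E.norm_diff_comm[OF xE dE, of m] by simp
      then have "k * vnorm F (vdiff S (d m) (d n)) < k * e"
        using kD[OF X.ideal_diff_closed[OF dX dX] Y.ideal_diff_closed[OF dY dY]] by simp
      then show ?thesis using k(1) by simp
    qed
    then show "\<exists>N. \<forall>m\<ge>N. \<forall>n\<ge>m. vnorm F (vdiff S (d m) (d n)) < e" by blast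
  qed
  then obtain l where l: "l \<in> carrier F" "(\<lambda>n. vnorm F (vdiff S (d n) l)) \<longlonglongrightarrow> 0" by blast
  have xS: "x \<in> carrier S" and lS: "l \<in> carrier S" and dS: "d n \<in> carrier S" for n
    using E.ideal_carrier[OF xE] F.ideal_carrier[OF l(1)] E.ideal_carrier[OF dE] by simp_all
  have "vdiff S x l = vzero S"
  proof (rule null)
    show "vdiff S x l \<in> carrier S" using xS lS by (rule diff_closed)
    fix e :: real assume e: "0 < e"
    have "(\<lambda>n. c1 * vnorm E (vdiff S x (d n)) + c2 * vnorm F (vdiff S (d n) l)) \<longlonglongrightarrow> c1 * 0 + c2 * 0"
      by (intro tendsto_add tendsto_mult tendsto_const limE' l(2))
    then have "(\<lambda>n. c1 * vnorm E (vdiff S x (d n)) + c2 * vnorm F (vdiff S (d n) l)) \<longlonglongrightarrow> 0"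
      by simp
    then have "eventually (\<lambda>n. c1 * vnorm E (vdiff S x (d n)) + c2 * vnorm F (vdiff S (d n) l) < e / 2) sequentially"
      using half_gt_zero[OF e] by (rule order_tendstoD(2))
    then obtain n where n: "c1 * vnorm E (vdiff S x (d n)) + c2 * vnorm F (vdiff S (d n) l) < e / 2"
      unfolding eventually_sequentially by blast
    have e4: "0 < e / 4" using e by simp
    obtain x1 y1 where 1: "x1 \<in> carrier X" "y1 \<in> carrier Y" "vdiff S x (d n) = vadd U x1 y1"
        "vnorm X x1 + vnorm Y y1 < vnorm S (vdiff S x (d n)) + e / 4"
      by (rule sum_norm_approx[OF diff_closed[OF xS dS] e4])
    obtain x2 y2 where 2: "x2 \<in> carrier X" "y2 \<in> carrier Y" "vdiff S (d n) l = vadd U x2 y2"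
        "vnorm X x2 + vnorm Y y2 < vnorm S (vdiff S (d n) l) + e / 4"
      by (rule sum_norm_approx[OF diff_closed[OF dS lS] e4])
    have "vdiff S x l = vadd S (vadd S x1 y1) (vadd S x2 y2)"
      using diff_trans[OF xS dS[of n] lS] by (simp only: 1(3) 2(3) S_simps)
    also have "\<dots> = vadd S (vadd S x1 x2) (vadd S y1 y2)"
      by (rule add_swap[OF X.ideal_carrier[OF 1(1)] Y.ideal_carrier[OF 1(2)]
            X.ideal_carrier[OF 2(1)] Y.ideal_carrier[OF 2(2)]])
    finally have split: "vdiff S x l = vadd S (vadd S x1 x2) (vadd S y1 y2)" .
    have "vnorm X (vadd S x1 x2) + vnorm Y (vadd S y1 y2) < e"
      using X.norm_add[OF 1(1) 2(1)] Y.norm_add[OF 1(2) 2(2)] 1(4) 2(4) n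
        c1(2)[OF E.ideal_diff_closed[OF xE dE], of n] c2(2)[OF F.ideal_diff_closed[OF dF l(1)], of n]
      by linarith
    with split show "\<exists>x'\<in>carrier X. \<exists>y'\<in>carrier Y. vdiff S x l = vadd S x' y' \<and> vnorm X x' + vnorm Y y' < e"
      using X.ideal_add_closed[OF 1(1) 2(1)] Y.ideal_add_closed[OF 1(2) 2(2)] by blast
  qed
  then have xl: "x = l" using diff_eq_zero[OF xS lS] by simp
  then show "x \<in> carrier F" using l(1) by simp
  have "(\<lambda>n. k * vnorm F (d n)) \<longlonglongrightarrow> k * vnorm F x"
    using F.norm_tendsto[OF dF l] xl by (intro tendsto_mult tendsto_const) simp
  moreover have "(\<lambda>n. k * vnorm F (d n)) \<longlonglongrightarrow> vnorm E x"
    using E.norm_tendsto[OF dE xE limE] kD[OF dX dY] by simp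
  ultimately show "vnorm E x = k * vnorm F x" by (rule LIMSEQ_unique[rotated])
qed

lemma proportional_if_dense:
  assumes E: "E \<in> P_Int1 U X Y" and F: "F \<in> P_Int1 U X Y"
    and k: "0 < k" "\<And>d. d \<in> carrier X \<Longrightarrow> d \<in> carrier Y \<Longrightarrow> d \<in> pos_cone S \<Longrightarrow> vnorm E d = k * vnorm F d"
    and dense: "norm_dense (carrier X \<inter> carrier Y) E" "norm_dense (carrier X \<inter> carrier Y) F"
  shows "E \<cong>\<^sub>p F"
proof -
  interpret E: banach_ideal S E by (rule P_Int1_banach_ideal[OF E])
  interpret F: banach_ideal S F by (rule P_Int1_banach_ideal[OF F])
  have k': "0 < 1 / k" "\<And>d. d \<in> carrier X \<Longrightarrow> d \<in> carrier Y \<Longrightarrow> d \<in> pos_cone S \<Longrightarrow>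
      vnorm F d = (1 / k) * vnorm E d"
    using k by simp_all
  have "carrier E \<subseteq> carrier F"
  proof (rule ideal_subset_by_pos[OF E.ideal F.ideal])
    fix x assume "x \<in> carrier E" "le S (vzero S) x"
    then have "x \<in> pos_cone E" unfolding E.ideal_pos_cone by simp
    from limits_agree(1)[OF E F k dense(1) this] show "x \<in> carrier F" .
  qed
  moreover have "carrier F \<subseteq> carrier E"
  proof (rule ideal_subset_by_pos[OF F.ideal E.ideal])
    fix x assume "x \<in> carrier F" "le S (vzero S) x"
    then have "x \<in> pos_cone F" unfolding F.ideal_pos_cone by simp
    from limits_agree(1)[OF F E k' dense(2) this] show "x \<in> carrier E" .
  qed
  ultimately have eq: "carrier E = carrier F" by (rule equalityI)
  show ?thesis
  proof (rule proportionalI[OF E.banach_ideal_axioms F.banach_ideal_axioms eq k(1)])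
    fix x assume "x \<in> carrier E" "le S (vzero S) x"
    then have "x \<in> pos_cone E" unfolding E.ideal_pos_cone by simp
    from limits_agree(2)[OF E F k dense(1) this] show "vnorm E x = k * vnorm F x" .
  qed
qed

text \<open>Let a positive \<open>x\<close> in \<open>X\<close> stay away from the intersection. In a positive splitting
  \<open>x = u + y\<close> the element \<open>y \<le> x\<close> of \<open>Y\<close> lies in the intersection, so \<open>u\<close> is not small, and
  Hahn--Banach applies with the weight \<open>r = 0\<close> on \<open>Y\<close>.\<close>

lemma annihilator_if_not_dense:
  assumes "\<not> norm_dense (carrier X \<inter> carrier Y) X"
  shows "\<exists>f. couple_functional f \<and> (\<forall>y\<in>carrier Y. f y = 0) \<and> (\<exists>x\<in>carrier X. f x \<noteq> 0)"
proof -
  obtain x e where x: "x \<in> pos_cone X" and e: "0 < e"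
    and far: "\<And>d. d \<in> carrier X \<inter> carrier Y \<Longrightarrow> d \<in> pos_cone X \<Longrightarrow> e \<le> vnorm X (vdiff X x d)"
    using assms unfolding norm_dense_def by (meson not_le)
  have xX: "x \<in> carrier X" "le S (vzero S) x" using x unfolding X.ideal_pos_cone by simp_all
  have *: "e \<le> vnorm X u + 0 * vnorm Y y"
    if u: "u \<in> carrier X" "y \<in> carrier Y" "le S (vzero S) u" "le S (vzero S) y" "x = vadd S u y" for u y
  proof -
    have uyS: "u \<in> carrier S" "y \<in> carrier S" using u X.ideal_carrier Y.ideal_carrier by simp_all
    have "le S y x" unfolding u(5) by (rule le_add_nonneg(2)[OF uyS(2,1) u(3)])
    then have yX: "y \<in> carrier X" by (rule X.ideal_between[OF xX(1) uyS(2) u(4)])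
    then have "y \<in> pos_cone X" unfolding X.ideal_pos_cone using u(4) by simp
    then have "e \<le> vnorm X (vdiff X x y)" using far yX u(2) by simp
    also have "vdiff X x y = vdiff S x y" by (rule X.ideal_diff[OF xX(1) yX])
    also have "vdiff S x y = u" unfolding u(5) by (rule add_diff_cancel[OF uyS])
    finally show ?thesis by simp
  qed
  obtain f where f: "positive_functional S f" "\<forall>x\<in>carrier X. le S (vzero S) x \<longrightarrow> f x \<le> vnorm X x"
      "\<forall>y\<in>carrier Y. le S (vzero S) y \<longrightarrow> f y \<le> 0 * vnorm Y y" "e \<le> f x"
    using norming_functional[OF X.ideal_carrier[OF xX(1)] xX(2) order_refl[of 0] *] by blast
  have cf: "couple_functional f"
    by (rule couple_functionalI[OF f(1), of 1 0]) (use f(2,3) in simp_all)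
  have "f y = 0" if y: "y \<in> carrier Y" for y
  proof -
    have yS: "y \<in> carrier S" by (rule Y.ideal_carrier[OF y])
    have "f (vabs S y) \<le> 0"
      using f(3) Y.ideal_abs_closed[OF y] abs_nonneg[OF yS] by simp
    then show ?thesis using functional_abs[OF f(1) yS] by simp
  qed
  moreover have "f x \<noteq> 0" using f(4) e by simp
  ultimately show ?thesis using cf xX(1) by (intro exI[of _ f] conjI ballI bexI[of _ x])
qed

end

section \<open>Pairs that are interpolation spaces for each other\<close>

lemma functional_norm_cong:
  "(\<And>x. x \<in> carrier E \<Longrightarrow> f x = g x) \<Longrightarrow> functional_norm E f = functional_norm E g"
  unfolding functional_norm_def pos_cone_def by (rule arg_cong[where f = Sup]) force

lemma bounded_functional_cong:
  "(\<And>x. x \<in> carrier E \<Longrightarrow> f x = g x) \<Longrightarrow> bounded_functional E f \<longleftrightarrow> bounded_functional E g"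
  unfolding bounded_functional_def by (simp add: pos_cone_def)

lemma (in interpolation_couple) P_Int1_pos_cone:
  assumes Z: "Z \<in> P_Int1 U X Y" and a: "a \<in> carrier Z"
  shows "a \<in> pos_cone S \<longleftrightarrow> a \<in> pos_cone Z"
proof -
  interpret Z: banach_ideal S Z by (rule P_Int1_banach_ideal[OF Z])
  show ?thesis
    unfolding Z.ideal_pos_cone using a Z.ideal_carrier[OF a] by (simp add: pos_cone_def)
qed

locale twin_pairs =
  P: interpolation_couple U \<tau> X Y + Q: interpolation_couple U' \<tau>' V W
  for U U' :: "'a vector_lattice" and \<tau> \<tau>' :: "'a topology" and X Y V W :: "'a normed_lattice" +
  assumes V: "V \<in> P_Int1 U X Y" and W: "W \<in> P_Int1 U X Y"
    and X: "X \<in> P_Int1 U' V W" and Y: "Y \<in> P_Int1 U' V W"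
begin

lemma twin_flip: "twin_pairs U' U \<tau>' \<tau> V W X Y"
  by (intro twin_pairs.intro twin_pairs_axioms.intro P.interpolation_couple_axioms
      Q.interpolation_couple_axioms V W X Y)

lemma twin_swap: "twin_pairs U U' \<tau> \<tau>' X Y W V"
proof (intro twin_pairs.intro twin_pairs_axioms.intro P.interpolation_couple_axioms V W)
  show "interpolation_couple U' \<tau>' W V"
    by (rule interpolation_couple.intro[OF interpolation_pair_swap[OF Q.pair]])
  show "X \<in> P_Int1 U' W V" "Y \<in> P_Int1 U' W V"
    unfolding Q.P_Int1_swap by (rule X Y)+
qed

lemma inter_eq: "carrier X \<inter> carrier Y = carrier V \<inter> carrier W"
  by (rule equalityI[OF Int_greatest[OF P.P_Int1_inter_subset[OF V] P.P_Int1_inter_subset[OF W]]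
        Int_greatest[OF Q.P_Int1_inter_subset[OF X] Q.P_Int1_inter_subset[OF Y]]])

lemma inter_carriers:
  assumes "a \<in> carrier X" "a \<in> carrier Y"
  shows "a \<in> carrier V" "a \<in> carrier W"
proof -
  have "a \<in> carrier V \<inter> carrier W" unfolding inter_eq[symmetric] using assms by (rule IntI)
  then show "a \<in> carrier V" "a \<in> carrier W" by simp_all
qed

text \<open>A functional on one sum restricts to \<open>V\<close> and \<open>W\<close>, and these restrictions are glued on the
  other sum. On any common ideal \<open>E\<close> the result agrees with the original, because positive elements
  of \<open>E\<close> split inside \<open>E\<close>, where the additions of both sums coincide with that of \<open>E\<close>.\<close>

lemma transfer_functional:
  assumes f: "P.couple_functional f"
  shows "\<exists>f'. Q.couple_functional f' \<and>
    (\<forall>E\<in>P_Int1 U X Y \<inter> P_Int1 U' V W. \<forall>x\<in>carrier E. f' x = f x)"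
proof -
  obtain f' where glued: "positive_functional Q.S f' \<and> (\<forall>x\<in>carrier V. f' x = f x) \<and> (\<forall>x\<in>carrier W. f' x = f x)"
    using Q.glue_functionals[OF P.P_Int1_functional(1)[OF V f] P.P_Int1_functional(1)[OF W f] HOL.refl] ..
  have f': "positive_functional Q.S f'" "\<And>x. x \<in> carrier V \<Longrightarrow> f' x = f x"
    "\<And>x. x \<in> carrier W \<Longrightarrow> f' x = f x" using glued by simp_all
  have cf': "Q.couple_functional f'"
    unfolding Q.couple_functional_def
    using P.P_Int1_functional(2)[OF V f] P.P_Int1_functional(2)[OF W f] f'(1)
      bounded_functional_cong[of V f' f, OF f'(2)] bounded_functional_cong[of W f' f, OF f'(3)] by simp
  have agree: "f' x = f x" if E: "E \<in> P_Int1 U X Y" "E \<in> P_Int1 U' V W" and x: "x \<in> carrier E" for E x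
  proof -
    interpret PE: banach_ideal P.S E by (rule P.P_Int1_banach_ideal[OF E(1)])
    interpret QE: banach_ideal Q.S E by (rule Q.P_Int1_banach_ideal[OF E(2)])
    have VE: "vector_lattice E" using PE.banach by (simp add: banach_lattice_def)
    have fE: "positive_functional E f" by (rule P.P_Int1_functional(1)[OF E(1) f])
    have f'E: "positive_functional E f'" by (rule Q.P_Int1_functional(1)[OF E(2) cf'])
    have pos: "f' p = f p" if p: "p \<in> carrier E" "le E (vzero E) p" for p
    proof -
      have pQ: "p \<in> carrier Q.S" "le Q.S (vzero Q.S) p"
        using p QE.ideal_carrier[OF p(1)] QE.ideal_le[OF QE.ideal_zero_closed p(1)]
        by (simp_all add: QE.ideal_zero)
      obtain v w where vw: "v \<in> carrier V" "w \<in> carrier W" "le Q.S (vzero Q.S) v"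
          "le Q.S (vzero Q.S) w" "p = vadd Q.S v w"
        by (rule Q.positive_decomposition[OF pQ])
      have vwS: "v \<in> carrier Q.S" "w \<in> carrier Q.S"
        using Q.X.ideal_carrier[OF vw(1)] Q.Y.ideal_carrier[OF vw(2)] .
      have "v \<in> carrier E"
        by (rule QE.ideal_between[OF p(1) vwS(1) vw(3)])
          (unfold vw(5), rule Q.le_add_nonneg(1)[OF vwS vw(4)])
      moreover have "w \<in> carrier E"
        by (rule QE.ideal_between[OF p(1) vwS(2) vw(4)])
          (unfold vw(5), rule Q.le_add_nonneg(2)[OF vwS(2,1) vw(3)])
      ultimately have vwE: "v \<in> carrier E" "w \<in> carrier E" .
      have "p = vadd E v w" using vw(5) QE.ideal_add[OF vwE] by simp
      then have "f' p = f' v + f' w" "f p = f v + f w"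
        using vector_lattice.functional_add[OF VE f'E vwE]
          vector_lattice.functional_add[OF VE fE vwE] by simp_all
      then show ?thesis using f'(2)[OF vw(1)] f'(3)[OF vw(2)] by simp
    qed
    show ?thesis by (rule vector_lattice.functional_eq_by_pos[OF VE f'E fE x pos])
  qed
  show ?thesis
    by (intro exI[of _ f'] conjI cf' ballI) (erule IntE, rule agree)
qed

text \<open>For each functional, interpolation of \<open>X\<close> and \<open>Y\<close> bounds the rank-one maximum of the first
  pair at \<open>b\<close> by that of the second, and interpolation of \<open>V\<close> and \<open>W\<close> goes back at \<open>a\<close>; in between,
  the hypotheses on \<open>V\<close> and \<open>W\<close> lead from \<open>b\<close> to \<open>a\<close>.\<close>

lemma norm_comparison:
  assumes a: "a \<in> carrier X" "a \<in> carrier Y" "a \<in> pos_cone P.S" "a \<noteq> vzero P.S"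
    and b: "b \<in> carrier X" "b \<in> carrier Y" "b \<in> pos_cone P.S" and k: "0 < k"
    and le: "vnorm V b \<le> k * vnorm V a" "vnorm W b \<le> k * vnorm W a"
  shows "vnorm X b \<le> k * vnorm X a \<and> vnorm Y b \<le> k * vnorm Y a"
proof -
  have bV: "b \<in> carrier V" "b \<in> carrier W" by (rule inter_carriers[OF b(1,2)])+
  have bQ: "b \<in> pos_cone Q.S"
    using b(3) P.P_Int1_pos_cone[OF V bV(1)] Q.P_Int1_pos_cone[OF Q.X_in_P_Int1 bV(1)] by simp
  have ineq: "max (functional_norm X f * vnorm X b) (functional_norm Y f * vnorm Y b)
      \<le> k * max (functional_norm X f * vnorm X a) (functional_norm Y f * vnorm Y a)"
    if f: "P.couple_functional f" for f
  proof -
    obtain f' where ft0: "Q.couple_functional f' \<and>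
        (\<forall>E\<in>P_Int1 U X Y \<inter> P_Int1 U' V W. \<forall>x\<in>carrier E. f' x = f x)"
      using transfer_functional[OF f] ..
    have f': "Q.couple_functional f'"
      "\<And>E x. E \<in> P_Int1 U X Y \<Longrightarrow> E \<in> P_Int1 U' V W \<Longrightarrow> x \<in> carrier E \<Longrightarrow> f' x = f x"
      using ft0 by (simp, metis IntI)
    have fX: "functional_norm X f' = functional_norm X f"
      by (rule functional_norm_cong) (rule f'(2)[OF P.X_in_P_Int1 X])
    have fY: "functional_norm Y f' = functional_norm Y f"
      by (rule functional_norm_cong) (rule f'(2)[OF P.Y_in_P_Int1 Y])
    have fV: "functional_norm V f' = functional_norm V f"
      by (rule functional_norm_cong) (rule f'(2)[OF V Q.X_in_P_Int1])
    have fW: "functional_norm W f' = functional_norm W f"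
      by (rule functional_norm_cong) (rule f'(2)[OF W Q.Y_in_P_Int1])
    have nn: "0 \<le> functional_norm V f" "0 \<le> functional_norm W f"
      using Q.X.functional_norm_nonneg[OF Q.couple_functional_X[OF f'(1)]]
        Q.Y.functional_norm_nonneg[OF Q.couple_functional_Y[OF f'(1)]] by (simp_all add: fV fW)
    have "functional_norm X f * vnorm X b
        \<le> max (functional_norm V f * vnorm V b) (functional_norm W f * vnorm W b)"
      using Q.rank_one_inequality[OF X f'(1) bV bQ] unfolding fX fV fW .
    moreover have "functional_norm Y f * vnorm Y b
        \<le> max (functional_norm V f * vnorm V b) (functional_norm W f * vnorm W b)"
      using Q.rank_one_inequality[OF Y f'(1) bV bQ] unfolding fY fV fW .
    ultimately have "max (functional_norm X f * vnorm X b) (functional_norm Y f * vnorm Y b)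
        \<le> max (functional_norm V f * vnorm V b) (functional_norm W f * vnorm W b)"
      by (rule max.boundedI)
    also have "\<dots> \<le> max (functional_norm V f * (k * vnorm V a)) (functional_norm W f * (k * vnorm W a))"
      by (rule max.mono[OF mult_left_mono[OF le(1) nn(1)] mult_left_mono[OF le(2) nn(2)]])
    also have "\<dots> = k * max (functional_norm V f * vnorm V a) (functional_norm W f * vnorm W a)"
      unfolding mult.left_commute[of _ k] using k by (simp add: max_mult_distrib_left)
    also have "\<dots> \<le> k * max (functional_norm X f * vnorm X a) (functional_norm Y f * vnorm Y a)"
      by (rule mult_left_mono[OF max.boundedI[OF P.rank_one_inequality[OF V f a(1-3)]
            P.rank_one_inequality[OF W f a(1-3)]] less_imp_le[OF k]])
    finally show ?thesis .
  qed
  have "le P.S (vzero P.S) a" using a(3) by (simp add: pos_cone_def)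
  from P.rank_one_comparison[OF a(1,2) this a(4) b(1,2) k ineq] show ?thesis by (rule conjI)
qed

lemma inter_norms_proportional:
  "\<exists>k>0. \<exists>l>0. (\<forall>a\<in>carrier X \<inter> carrier Y. a \<in> pos_cone P.S \<longrightarrow> vnorm X a = k * vnorm V a \<and> vnorm Y a = l * vnorm W a) \<or>
    (\<forall>a\<in>carrier X \<inter> carrier Y. a \<in> pos_cone P.S \<longrightarrow> vnorm X a = k * vnorm W a \<and> vnorm Y a = l * vnorm V a)"
proof -
  interpret flip: twin_pairs U' U \<tau>' \<tau> V W X Y by (rule twin_flip)
  interpret PV: banach_ideal P.S V by (rule P.P_Int1_banach_ideal[OF V])
  interpret PW: banach_ideal P.S W by (rule P.P_Int1_banach_ideal[OF W])
  interpret QX: banach_ideal Q.S X by (rule Q.P_Int1_banach_ideal[OF X])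
  define D where "D = {a \<in> carrier X \<inter> carrier Y. a \<in> pos_cone P.S \<and> a \<noteq> vzero P.S}"
  have zero: "vzero Q.S = vzero P.S" using QX.ideal_zero P.X.ideal_zero by simp
  have D: "a \<in> carrier X" "a \<in> carrier Y" "a \<in> pos_cone P.S" "a \<noteq> vzero P.S"
    "a \<in> carrier V" "a \<in> carrier W" "a \<in> pos_cone Q.S" "a \<noteq> vzero Q.S" if "a \<in> D" for a
  proof -
    show a: "a \<in> carrier X" "a \<in> carrier Y" "a \<in> pos_cone P.S" "a \<noteq> vzero P.S"
      using that by (simp_all add: D_def)
    show aV: "a \<in> carrier V" "a \<in> carrier W" by (rule inter_carriers[OF a(1,2)])+
    show "a \<in> pos_cone Q.S"
      using a(3) P.P_Int1_pos_cone[OF V aV(1)] Q.P_Int1_pos_cone[OF Q.X_in_P_Int1 aV(1)] by simp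
    show "a \<noteq> vzero Q.S" using a(4) zero by simp
  qed
  have "\<exists>k>0. \<exists>l>0. (\<forall>a\<in>D. vnorm X a = k * vnorm V a \<and> vnorm Y a = l * vnorm W a) \<or>
     (\<forall>a\<in>D. vnorm X a = k * vnorm W a \<and> vnorm Y a = l * vnorm V a)"
  proof (rule norm_pairs_proportional_or_swapped)
    show "0 < vnorm X a \<and> 0 < vnorm Y a \<and> 0 < vnorm V a \<and> 0 < vnorm W a" if "a \<in> D" for a
      by (intro conjI P.X.norm_pos P.Y.norm_pos PV.norm_pos PW.norm_pos D[OF that])
    show "(vnorm X b \<le> k * vnorm X a \<and> vnorm Y b \<le> k * vnorm Y a) \<longleftrightarrow>
        (vnorm V b \<le> k * vnorm V a \<and> vnorm W b \<le> k * vnorm W a)"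
      if a: "a \<in> D" and b: "b \<in> D" and k: "0 < k" for a b k
    proof
      assume "vnorm X b \<le> k * vnorm X a \<and> vnorm Y b \<le> k * vnorm Y a"
      then show "vnorm V b \<le> k * vnorm V a \<and> vnorm W b \<le> k * vnorm W a"
        by (elim conjE) (rule flip.norm_comparison[OF D(5-8)[OF a] D(5-7)[OF b] k])
    next
      assume "vnorm V b \<le> k * vnorm V a \<and> vnorm W b \<le> k * vnorm W a"
      then show "vnorm X b \<le> k * vnorm X a \<and> vnorm Y b \<le> k * vnorm Y a"
        by (elim conjE) (rule norm_comparison[OF D(1-4)[OF a] D(1-3)[OF b] k])
    qed
  qed
  then obtain k l where kl: "0 < k" "0 < l"
    "(\<forall>a\<in>D. vnorm X a = k * vnorm V a \<and> vnorm Y a = l * vnorm W a) \<or>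
     (\<forall>a\<in>D. vnorm X a = k * vnorm W a \<and> vnorm Y a = l * vnorm V a)" by blast
  have zeros: "vnorm X (vzero P.S) = 0" "vnorm Y (vzero P.S) = 0" "vnorm V (vzero P.S) = 0"
    "vnorm W (vzero P.S) = 0"
    by (rule P.X.norm_zero P.Y.norm_zero PV.norm_zero PW.norm_zero)+
  have extend: "\<forall>a\<in>carrier X \<inter> carrier Y. a \<in> pos_cone P.S \<longrightarrow> R a"
    if "\<forall>a\<in>D. R a" "R (vzero P.S)" for R
  proof (intro ballI impI)
    fix a assume "a \<in> carrier X \<inter> carrier Y" "a \<in> pos_cone P.S"
    then show "R a" using that by (cases "a = vzero P.S") (simp_all add: D_def)
  qed
  have "(\<forall>a\<in>carrier X \<inter> carrier Y. a \<in> pos_cone P.S \<longrightarrow> vnorm X a = k * vnorm V a \<and> vnorm Y a = l * vnorm W a) \<or>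
    (\<forall>a\<in>carrier X \<inter> carrier Y. a \<in> pos_cone P.S \<longrightarrow> vnorm X a = k * vnorm W a \<and> vnorm Y a = l * vnorm V a)"
    using kl(3)
  proof (rule disj_forward)
    show "\<forall>a\<in>carrier X \<inter> carrier Y. a \<in> pos_cone P.S \<longrightarrow> vnorm X a = k * vnorm V a \<and> vnorm Y a = l * vnorm W a"
      if "\<forall>a\<in>D. vnorm X a = k * vnorm V a \<and> vnorm Y a = l * vnorm W a"
      by (rule extend[OF that]) (simp only: zeros mult_zero_right simp_thms)
    show "\<forall>a\<in>carrier X \<inter> carrier Y. a \<in> pos_cone P.S \<longrightarrow> vnorm X a = k * vnorm W a \<and> vnorm Y a = l * vnorm V a"
      if "\<forall>a\<in>D. vnorm X a = k * vnorm W a \<and> vnorm Y a = l * vnorm V a"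
      by (rule extend[OF that]) (simp only: zeros mult_zero_right simp_thms)
  qed
  with kl(1,2) show ?thesis by (intro exI[of _ k] exI[of _ l] conjI)
qed

text \<open>Cutting \<open>f\<close> down to its part on \<open>V\<close> gives a functional that vanishes on \<open>Y\<close> and on
  \<open>W\<close>. Its rank-one operators admit every positive target in \<open>X\<close> for the first pair and in \<open>V\<close> for
  the second, so each of \<open>X\<close> and \<open>V\<close> contains the other, with proportional norms.\<close>

lemma proportional_if_annihilator:
  assumes f: "P.couple_functional f" and fY: "\<And>y. y \<in> carrier Y \<Longrightarrow> f y = 0"
    and v: "v \<in> carrier V" "f v \<noteq> 0"
  shows "X \<cong>\<^sub>p V"
proof -
  interpret flip: twin_pairs U' U \<tau>' \<tau> V W X Y by (rule twin_flip)
  interpret PV: banach_ideal P.S V by (rule P.P_Int1_banach_ideal[OF V])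
  interpret QY: banach_ideal Q.S Y by (rule Q.P_Int1_banach_ideal[OF Y])
  have fV: "positive_functional V f" "bounded_functional V f"
    using P.P_Int1_functional[OF V f] .
  have zeroW: "positive_functional W (\<lambda>_. 0)" by (simp add: positive_functional_def)
  have agree: "f x = 0" if "x \<in> carrier V" "x \<in> carrier W" for x
  proof -
    have "x \<in> carrier X \<inter> carrier Y" unfolding inter_eq using that by (rule IntI)
    then show ?thesis using fY by simp
  qed
  obtain h' where glued: "positive_functional Q.S h' \<and> (\<forall>x\<in>carrier V. h' x = f x) \<and> (\<forall>x\<in>carrier W. h' x = 0)"
    using Q.glue_functionals[OF fV(1) zeroW agree] ..
  have h': "positive_functional Q.S h'" "\<And>x. x \<in> carrier V \<Longrightarrow> h' x = f x"
    "\<And>x. x \<in> carrier W \<Longrightarrow> h' x = 0" using glued by simp_all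
  have "bounded_functional V h'" using fV(2) bounded_functional_cong[of V h' f, OF h'(2)] by simp
  moreover have "bounded_functional W h'"
    unfolding bounded_functional_def using h'(3) by (intro exI[of _ 0]) (simp add: pos_cone_def)
  ultimately have ch': "Q.couple_functional h'"
    using h'(1) by (simp add: Q.couple_functional_def)
  obtain h where h0: "P.couple_functional h \<and>
      (\<forall>E\<in>P_Int1 U' V W \<inter> P_Int1 U X Y. \<forall>x\<in>carrier E. h x = h' x)"
    using flip.transfer_functional[OF ch'] ..
  have ch: "P.couple_functional h"
    and hh': "\<And>E x. E \<in> P_Int1 U' V W \<Longrightarrow> E \<in> P_Int1 U X Y \<Longrightarrow> x \<in> carrier E \<Longrightarrow> h x = h' x"
    using h0 by (simp, metis IntI)
  have h'Y_pos: "h' y = 0" if y: "y \<in> carrier Y" "le Q.S (vzero Q.S) y" for y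
  proof -
    obtain u w where uw: "u \<in> carrier V" "w \<in> carrier W" "le Q.S (vzero Q.S) u"
        "le Q.S (vzero Q.S) w" "y = vadd Q.S u w"
      by (rule Q.positive_decomposition[OF QY.ideal_carrier[OF y(1)] y(2)])
    have uwS: "u \<in> carrier Q.S" "w \<in> carrier Q.S"
      using Q.X.ideal_carrier[OF uw(1)] Q.Y.ideal_carrier[OF uw(2)] .
    have "u \<in> carrier Y"
      by (rule QY.ideal_between[OF y(1) uwS(1) uw(3)])
        (unfold uw(5), rule Q.le_add_nonneg(1)[OF uwS uw(4)])
    then show ?thesis
      using Q.functional_add[OF h'(1) uwS] h'(2)[OF uw(1)] h'(3)[OF uw(2)] fY uw(5) by simp
  qed
  have hY: "h y = 0" if y: "y \<in> carrier Y" for y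
  proof -
    have yS: "y \<in> carrier Q.S" by (rule QY.ideal_carrier[OF y])
    have "h' (vabs Q.S y) = 0"
      by (rule h'Y_pos[OF QY.ideal_abs_closed[OF y] Q.abs_nonneg[OF yS]])
    then show ?thesis
      using Q.functional_abs[OF h'(1) yS] hh'[OF Y P.Y_in_P_Int1 y] by simp
  qed
  have hv: "h v \<noteq> 0" using hh'[OF Q.X_in_P_Int1 V v(1)] h'(2)[OF v(1)] v(2) by simp
  have ph: "positive_functional P.S h" using ch by (simp add: P.couple_functional_def)
  obtain x where x: "x \<in> carrier X" "h x \<noteq> 0"
  proof -
    obtain x y where xy: "x \<in> carrier X" "y \<in> carrier Y" "v = vadd P.S x y"
      using P.decomposition[OF PV.ideal_carrier[OF v(1)]] by blast
    then have "h v = h x + h y"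
      using P.functional_add[OF ph P.X.ideal_carrier[OF xy(1)] P.Y.ideal_carrier[OF xy(2)]] by simp
    with xy hY hv that show thesis by simp
  qed
  have h'x: "h' x \<noteq> 0" using hh'[OF X P.X_in_P_Int1 x(1)] x(2) by simp
  have normX: "functional_norm X h' = functional_norm X h"
    by (rule functional_norm_cong) (rule hh'[OF X P.X_in_P_Int1, symmetric])
  have normV: "functional_norm V h' = functional_norm V h"
    by (rule functional_norm_cong) (rule hh'[OF Q.X_in_P_Int1 V, symmetric])
  have to_V: "a \<in> carrier V \<and> functional_norm V h * vnorm V a \<le> functional_norm X h * vnorm X a"
    if "a \<in> carrier X" "a \<in> pos_cone P.S" for a
    using P.rank_one_inequality_annihilator[OF V ch hY that v(1) hv] by blast
  have to_X: "a \<in> carrier X \<and> functional_norm X h * vnorm X a \<le> functional_norm V h * vnorm V a"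
    if "a \<in> carrier V" "a \<in> pos_cone Q.S" for a
    using Q.rank_one_inequality_annihilator[OF X ch' h'(3) that x(1) h'x] by (simp add: normX normV)
  have pos_eq: "a \<in> pos_cone Q.S \<longleftrightarrow> a \<in> pos_cone P.S" if "a \<in> carrier V" for a
    using P.P_Int1_pos_cone[OF V that] Q.P_Int1_pos_cone[OF Q.X_in_P_Int1 that] by simp
  have "carrier X \<subseteq> carrier V"
  proof (rule P.ideal_subset_by_pos[OF P.X.ideal PV.ideal])
    fix a assume a: "a \<in> carrier X" "le P.S (vzero P.S) a"
    then have "a \<in> pos_cone P.S" using P.X.ideal_carrier by (simp add: pos_cone_def)
    with to_V[OF a(1)] show "a \<in> carrier V" by blast
  qed
  moreover have "carrier V \<subseteq> carrier X"
  proof (rule P.ideal_subset_by_pos[OF PV.ideal P.X.ideal])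
    fix a assume a: "a \<in> carrier V" "le P.S (vzero P.S) a"
    then have "a \<in> pos_cone P.S" using PV.ideal_carrier by (simp add: pos_cone_def)
    then have "a \<in> pos_cone Q.S" using pos_eq[OF a(1)] by simp
    with to_X[OF a(1)] show "a \<in> carrier X" by blast
  qed
  ultimately have eq: "carrier X = carrier V" by (rule equalityI)
  have "functional_norm X h \<noteq> 0"
    using P.X.functional_norm_zero_iff[OF P.couple_functional_X[OF ch]] x by blast
  then have nX: "0 < functional_norm X h"
    using P.X.functional_norm_nonneg[OF P.couple_functional_X[OF ch]] by simp
  have "functional_norm V h \<noteq> 0"
    using PV.functional_norm_zero_iff[OF P.P_Int1_functional[OF V ch]] v(1) hv by blast
  then have nV: "0 < functional_norm V h"
    using PV.functional_norm_nonneg[OF P.P_Int1_functional[OF V ch]] by simp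
  show ?thesis
  proof (rule P.proportionalI[OF P.X.banach_ideal_axioms PV.banach_ideal_axioms eq])
    show "0 < functional_norm V h / functional_norm X h" using nX nV by simp
    fix a assume a: "a \<in> carrier X" "le P.S (vzero P.S) a"
    then have aP: "a \<in> pos_cone P.S" using P.X.ideal_carrier by (simp add: pos_cone_def)
    have aV: "a \<in> carrier V" using a(1) eq by simp
    have "functional_norm X h * vnorm X a = functional_norm V h * vnorm V a"
      using to_V[OF a(1) aP] to_X[OF aV] aP pos_eq[OF aV] by simp
    then show "vnorm X a = functional_norm V h / functional_norm X h * vnorm V a"
      using nX by (simp add: field_simps)
  qed
qed

lemma proportional_if_not_dense:
  assumes "\<not> norm_dense (carrier X \<inter> carrier Y) X"
  shows "X \<cong>\<^sub>p V \<or> X \<cong>\<^sub>p W"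
proof -
  interpret swap: twin_pairs U U' \<tau> \<tau>' X Y W V by (rule twin_swap)
  interpret QX: banach_ideal Q.S X by (rule Q.P_Int1_banach_ideal[OF X])
  obtain f where "P.couple_functional f \<and> (\<forall>y\<in>carrier Y. f y = 0) \<and> (\<exists>x\<in>carrier X. f x \<noteq> 0)"
    using P.annihilator_if_not_dense[OF assms] ..
  then have f: "P.couple_functional f" and fY: "\<And>y. y \<in> carrier Y \<Longrightarrow> f y = 0"
    and "\<exists>x\<in>carrier X. f x \<noteq> 0" by simp_all
  then obtain x where x: "x \<in> carrier X" "f x \<noteq> 0" by blast
  obtain f' where ft0: "Q.couple_functional f' \<and>
      (\<forall>E\<in>P_Int1 U X Y \<inter> P_Int1 U' V W. \<forall>x\<in>carrier E. f' x = f x)"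
    using transfer_functional[OF f] ..
  have f': "Q.couple_functional f'"
    "\<And>E x. E \<in> P_Int1 U X Y \<Longrightarrow> E \<in> P_Int1 U' V W \<Longrightarrow> x \<in> carrier E \<Longrightarrow> f' x = f x"
    using ft0 by (simp, metis IntI)
  have pf': "positive_functional Q.S f'" using f'(1) by (simp add: Q.couple_functional_def)
  obtain v w where vw: "v \<in> carrier V" "w \<in> carrier W" "x = vadd Q.S v w"
    using Q.decomposition[OF QX.ideal_carrier[OF x(1)]] by blast
  have "f x = f v + f w"
    using Q.functional_add[OF pf' Q.X.ideal_carrier[OF vw(1)] Q.Y.ideal_carrier[OF vw(2)]] vw(3)
      f'(2)[OF P.X_in_P_Int1 X x(1)] f'(2)[OF V Q.X_in_P_Int1 vw(1)]
      f'(2)[OF W Q.Y_in_P_Int1 vw(2)] by simp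
  then have "f v \<noteq> 0 \<or> f w \<noteq> 0" using x(2) by auto
  then show ?thesis
    using proportional_if_annihilator[OF f fY vw(1)] swap.proportional_if_annihilator[OF f fY vw(2)]
    by blast
qed

end

lemma norm_dense_self:
  assumes E: "banach_lattice E" and sub: "carrier E \<subseteq> D"
  shows "norm_dense D E"
  unfolding norm_dense_def
proof (intro ballI allI impI)
  interpret E: banach_lattice E by (rule E)
  fix x and e :: real assume x: "x \<in> pos_cone E" and e: "0 < e"
  then have "x \<in> carrier E" by (simp add: pos_cone_def)
  then have "vnorm E (vdiff E x x) = 0" using E.norm_eq_zero[of "vzero E"] by simp
  then show "\<exists>d\<in>D. d \<in> pos_cone E \<and> vnorm E (vdiff E x d) < e"
    using x e sub \<open>x \<in> carrier E\<close> by (intro bexI[of _ x]) auto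
qed

lemma proportional_carrier: "E \<cong>\<^sub>p F \<Longrightarrow> carrier E = carrier F"
  by (simp add: proportional_def same_vector_lattice_def)

context twin_pairs
begin

text \<open>If the intersection fails to be dense in \<open>Y\<close> or \<open>W\<close> as well, annihilators give that space a
  partner, which cannot be \<open>V\<close> or \<open>X\<close>, as then the intersection would be all of \<open>X\<close>. If it is dense in
  both, the norms on the intersection decide, and a swapped match there only means that all four
  norms are proportional on it.\<close>

lemma remaining_proportional:
  assumes nd: "\<not> norm_dense (carrier X \<inter> carrier Y) X" and XV: "X \<cong>\<^sub>p V"
  shows "Y \<cong>\<^sub>p W"
proof -
  have not_all: "\<not> carrier X \<subseteq> carrier X \<inter> carrier Y"
    using norm_dense_self[OF P.UX.banach] nd by blast
  have eq: "carrier X = carrier V" by (rule proportional_carrier[OF XV])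
  interpret flip: twin_pairs U' U \<tau>' \<tau> V W X Y by (rule twin_flip)
  interpret flips: twin_pairs U' U \<tau>' \<tau> V W Y X by (rule flip.twin_swap)
  interpret both: twin_pairs U U' \<tau> \<tau>' Y X V W by (rule flips.twin_flip)
  interpret swap: twin_pairs U U' \<tau> \<tau>' X Y W V by (rule twin_swap)
  interpret swapflip: twin_pairs U' U \<tau>' \<tau> W V X Y by (rule swap.twin_flip)
  consider (Y) "\<not> norm_dense (carrier Y \<inter> carrier X) Y"
    | (W) "\<not> norm_dense (carrier W \<inter> carrier V) W"
    | (dense) "norm_dense (carrier X \<inter> carrier Y) Y" "norm_dense (carrier X \<inter> carrier Y) W"
    using inter_eq by (metis Int_commute)
  then show ?thesis
  proof cases
    case Y
    have "\<not> Y \<cong>\<^sub>p V"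
    proof
      assume "Y \<cong>\<^sub>p V"
      then have "carrier Y = carrier X" using proportional_carrier eq by blast
      then show False using not_all by simp
    qed
    then show ?thesis using both.proportional_if_not_dense[OF Y] by blast
  next
    case W
    have "\<not> W \<cong>\<^sub>p X"
    proof
      assume "W \<cong>\<^sub>p X"
      then have "carrier W = carrier X" by (rule proportional_carrier)
      then have "carrier X \<inter> carrier Y = carrier X" using inter_eq eq by simp
      then show False using not_all by simp
    qed
    then show ?thesis using swapflip.proportional_if_not_dense[OF W] proportional_sym by blast
  next
    case dense
    obtain p where p: "0 < p" "\<And>x. x \<in> carrier X \<Longrightarrow> vnorm X x = p * vnorm V x"
      using XV by (auto simp: proportional_def)
    obtain k l where kl: "0 < k" "0 < l"
      "(\<forall>a\<in>carrier X \<inter> carrier Y. a \<in> pos_cone P.S \<longrightarrow> vnorm X a = k * vnorm V a \<and> vnorm Y a = l * vnorm W a) \<or>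
       (\<forall>a\<in>carrier X \<inter> carrier Y. a \<in> pos_cone P.S \<longrightarrow> vnorm X a = k * vnorm W a \<and> vnorm Y a = l * vnorm V a)"
      using inter_norms_proportional by blast
    have "\<exists>m>0. \<forall>a\<in>carrier X \<inter> carrier Y. a \<in> pos_cone P.S \<longrightarrow> vnorm Y a = m * vnorm W a"
      using kl(3)
    proof
      assume *: "\<forall>a\<in>carrier X \<inter> carrier Y. a \<in> pos_cone P.S \<longrightarrow>
        vnorm X a = k * vnorm W a \<and> vnorm Y a = l * vnorm V a"
      have "vnorm Y a = (l * k / p) * vnorm W a"
        if "a \<in> carrier X \<inter> carrier Y" "a \<in> pos_cone P.S" for a
      proof -
        have "p * vnorm V a = k * vnorm W a" "vnorm Y a = l * vnorm V a"
          using * that p(2)[of a] by auto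
        then show ?thesis using p(1) by (simp add: field_simps)
      qed
      then show ?thesis using kl p(1) by (intro exI[of _ "l * k / p"]) simp
    qed (use kl(2) in blast)
    then obtain m where m: "0 < m"
      "\<And>a. a \<in> carrier X \<Longrightarrow> a \<in> carrier Y \<Longrightarrow> a \<in> pos_cone P.S \<Longrightarrow> vnorm Y a = m * vnorm W a"
      by blast
    show ?thesis by (rule P.proportional_if_dense[OF P.Y_in_P_Int1 W m dense])
  qed
qed

lemma conclusion_if_not_dense:
  assumes nd: "\<not> norm_dense (carrier X \<inter> carrier Y) X"
  shows "(X \<cong>\<^sub>p V \<and> Y \<cong>\<^sub>p W) \<or> (X \<cong>\<^sub>p W \<and> Y \<cong>\<^sub>p V)"
proof -
  interpret swap: twin_pairs U U' \<tau> \<tau>' X Y W V by (rule twin_swap)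
  show ?thesis
    using proportional_if_not_dense[OF nd] remaining_proportional[OF nd]
      swap.remaining_proportional[OF nd] by blast
qed

theorem twin_pairs_proportional: "(X \<cong>\<^sub>p V \<and> Y \<cong>\<^sub>p W) \<or> (X \<cong>\<^sub>p W \<and> Y \<cong>\<^sub>p V)"
proof -
  interpret flip: twin_pairs U' U \<tau>' \<tau> V W X Y by (rule twin_flip)
  interpret flips: twin_pairs U' U \<tau>' \<tau> V W Y X by (rule flip.twin_swap)
  interpret both: twin_pairs U U' \<tau> \<tau>' Y X V W by (rule flips.twin_flip)
  interpret swap: twin_pairs U U' \<tau> \<tau>' X Y W V by (rule twin_swap)
  interpret swapflip: twin_pairs U' U \<tau>' \<tau> W V X Y by (rule swap.twin_flip)
  let ?D = "carrier X \<inter> carrier Y"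
  consider (X) "\<not> norm_dense ?D X" | (Y) "\<not> norm_dense (carrier Y \<inter> carrier X) Y"
    | (V) "\<not> norm_dense (carrier V \<inter> carrier W) V" | (W) "\<not> norm_dense (carrier W \<inter> carrier V) W"
    | (dense) "norm_dense ?D X" "norm_dense ?D Y" "norm_dense ?D V" "norm_dense ?D W"
    using inter_eq by (metis Int_commute)
  then show ?thesis
  proof cases
    case X
    then show ?thesis by (rule conclusion_if_not_dense)
  next
    case Y
    from both.conclusion_if_not_dense[OF this] show ?thesis by blast
  next
    case V
    from flip.conclusion_if_not_dense[OF this] show ?thesis using proportional_sym by blast
  next
    case W
    from swapflip.conclusion_if_not_dense[OF this] show ?thesis using proportional_sym by blast
  next
    case dense
    obtain k l where kl: "0 < k" "0 < l"
      "(\<forall>a\<in>?D. a \<in> pos_cone P.S \<longrightarrow> vnorm X a = k * vnorm V a \<and> vnorm Y a = l * vnorm W a) \<or>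
       (\<forall>a\<in>?D. a \<in> pos_cone P.S \<longrightarrow> vnorm X a = k * vnorm W a \<and> vnorm Y a = l * vnorm V a)"
      using inter_norms_proportional by blast
    from kl(3) show ?thesis
    proof
      assume *: "\<forall>a\<in>?D. a \<in> pos_cone P.S \<longrightarrow> vnorm X a = k * vnorm V a \<and> vnorm Y a = l * vnorm W a"
      have "X \<cong>\<^sub>p V"
        by (rule P.proportional_if_dense[OF P.X_in_P_Int1 V kl(1) _ dense(1,3)]) (use * in simp)
      moreover have "Y \<cong>\<^sub>p W"
        by (rule P.proportional_if_dense[OF P.Y_in_P_Int1 W kl(2) _ dense(2,4)]) (use * in simp)
      ultimately show ?thesis by blast
    next
      assume *: "\<forall>a\<in>?D. a \<in> pos_cone P.S \<longrightarrow> vnorm X a = k * vnorm W a \<and> vnorm Y a = l * vnorm V a"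
      have "X \<cong>\<^sub>p W"
        by (rule P.proportional_if_dense[OF P.X_in_P_Int1 W kl(1) _ dense(1,4)]) (use * in simp)
      moreover have "Y \<cong>\<^sub>p V"
        by (rule P.proportional_if_dense[OF P.Y_in_P_Int1 V kl(2) _ dense(2,3)]) (use * in simp)
      ultimately show ?thesis by blast
    qed
  qed
qed

end

theorem theorem2:
  fixes U U' :: "'a vector_lattice"
    and \<tau> \<tau>' :: "'a topology"
    and X Y V W :: "'a normed_lattice"
  assumes "interpolation_pair U \<tau> X Y"
    and "interpolation_pair U' \<tau>' V W"
    and "P_Int1 U X Y = P_Int1 U' V W"
  shows "(X \<cong>\<^sub>p V \<and> Y \<cong>\<^sub>p W) \<or> (X \<cong>\<^sub>p W \<and> Y \<cong>\<^sub>p V)"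
proof -
  interpret P: interpolation_couple U \<tau> X Y by (rule interpolation_couple.intro) (rule assms(1))
  interpret Q: interpolation_couple U' \<tau>' V W by (rule interpolation_couple.intro) (rule assms(2))
  interpret twin_pairs U U' \<tau> \<tau>' X Y V W
    by (intro twin_pairs.intro twin_pairs_axioms.intro P.interpolation_couple_axioms
        Q.interpolation_couple_axioms)
      (use P.X_in_P_Int1 P.Y_in_P_Int1 Q.X_in_P_Int1 Q.Y_in_P_Int1 assms(3) in simp_all)
  show ?thesis by (rule twin_pairs_proportional)
qed

end
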